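(* Let $q>1$ be an integer, let $\chi$ be a primitive Dirichlet character modulo $q$, and let $N\ge 0$ be an integer. Then $$\int_{-\infty}^{\infty}\left|L\left(\tfrac12+it,\chi\right)\right|^2\frac{t^N\,dt}{\cosh(\pi t)} = -\chi(-1)(-1)^{\lfloor N/2\rfloor}B_N\left(\tfrac12\right)\frac{\varphi(q)}{q}+\sum_{k=1}^{N+1}S_{-\frac12}(N,k-1)\,\frac{(2\pi i q)^k}{q^2k^2}\sum_{1\le a,b\le q}B_k\left(\tfrac aq\right)B_k\left(\tfrac bq\right)\mathscr{T}_{\chi,N}(ab)\,\xi_q^{ab},$$ where for $c\in\mathbb{Z}$ $$\mathscr{T}_{\chi,N}(c)=-i^N\left[\tau(\overline\chi)\,\chi(c)+(-1)^N\tau(\chi)\,\overline\chi(c)\right].$$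
   Context: $\xi_q=e^{2\pi i/q}$; $\tau(\chi)=\sum_{a=1}^{q-1}\chi(a)\xi_q^a$ is the Gauss sum; $L(s,\chi)=\sum_{n\ge1}\chi(n)n^{-s}$ for $\mathrm{Re}(s)>1$, extended by analytic continuation to $\mathbb{C}$; $\overline\chi$ is the complex conjugate character; $\varphi$ is Euler's totient function. $B_n(x)=\sum_{k=0}^n\binom nk B_{n-k}x^k$ is the $n$-th Bernoulli polynomial, where $B_k$ are the Bernoulli numbers ($B_0=1$, $B_1=-1/2$, $B_2=1/6$, ...). The non-central Stirling numbers of the second kind $S_\alpha(n,k)$ ($n,k\ge 0$) are defined inductively by $S_\alpha(n,0)=(-\alpha)^n$ for $n\ge0$, $S_\alpha(0,k)=0$ for $k\ge1$, and $S_\alpha(n+1,k)=S_\alpha(n,k-1)+(k-\alpha)S_\alpha(n,k)$ for $n\ge 0$, $k\ge1$; here $\alpha=-1/2$. *)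

theory Defs
  imports "HOL-Complex_Analysis.Complex_Analysis" "HOL-Number_Theory.Totient"
begin

definition dirichlet_character :: "nat \<Rightarrow> (int \<Rightarrow> complex) \<Rightarrow> bool" where
  "dirichlet_character q chi \<longleftrightarrow>
     (\<forall>n. chi (n + int q) = chi n) \<and>
     (\<forall>m n. chi (m * n) = chi m * chi n) \<and>
     (\<forall>n. chi n \<noteq> 0 \<longleftrightarrow> coprime n (int q))"

text \<open>A character mod \<open>q\<close> is primitive if it is not induced by a character whose modulus is a
  proper divisor of \<open>q\<close>.\<close>

definition primitive_character :: "nat \<Rightarrow> (int \<Rightarrow> complex) \<Rightarrow> bool" where
  "primitive_character q chi \<longleftrightarrow>
     dirichlet_character q chi \<and>
     \<not> (\<exists>d \<psi>. d dvd q \<and> d < q \<and> dirichlet_character d \<psi> \<and>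
              (\<forall>n. coprime n (int q) \<longrightarrow> chi n = \<psi> n))"

definition cnj_character :: "(int \<Rightarrow> complex) \<Rightarrow> int \<Rightarrow> complex" where
  "cnj_character chi n = cnj (chi n)"

definition xi :: "nat \<Rightarrow> complex" where
  "xi q = exp (2 * of_real pi * \<i> / of_nat q)"

definition gauss_sum :: "nat \<Rightarrow> (int \<Rightarrow> complex) \<Rightarrow> complex" where
  "gauss_sum q chi = (\<Sum>a=1..q-1. chi (int a) * xi q ^ a)"

text \<open>The analytic continuation of the Dirichlet series from \<open>Re s > 1\<close> to the whole plane, unique
  by the identity theorem. It exists whenever \<open>chi\<close> is a non-principal character, in particular for
  every primitive character of modulus \<open>> 1\<close>; for a principal character (pole at \<open>s = 1\<close>) the
  value is unspecified.\<close>

definition Dirichlet_L :: "(int \<Rightarrow> complex) \<Rightarrow> complex \<Rightarrow> complex" where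
  "Dirichlet_L chi = (THE f. f holomorphic_on UNIV \<and>
     (\<forall>s. Re s > 1 \<longrightarrow> f s = (\<Sum>n. chi (int (Suc n)) * of_nat (Suc n) powr (-s))))"

text \<open>Bernoulli numbers, with \<open>B\<^sub>1 = -1/2\<close>: the recurrence is
  \<open>(\<Sum>k\<le>n. (n + 1 choose k) * B\<^sub>k) = 0\<close> for \<open>n \<ge> 1\<close>, solved for the last term.\<close>

fun bernoulli :: "nat \<Rightarrow> real" where
  "bernoulli 0 = 1"
| "bernoulli (Suc n) =
     - (\<Sum>k\<le>n. real ((n + 2) choose k) * bernoulli k) / real (n + 2)"

definition bernoulli_poly :: "nat \<Rightarrow> real \<Rightarrow> real" where
  "bernoulli_poly n x = (\<Sum>k\<le>n. real (n choose k) * bernoulli (n - k) * x ^ k)"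

fun noncentral_stirling :: "real \<Rightarrow> nat \<Rightarrow> nat \<Rightarrow> real" where
  "noncentral_stirling \<alpha> n 0 = (- \<alpha>) ^ n"
| "noncentral_stirling \<alpha> 0 (Suc k) = 0"
| "noncentral_stirling \<alpha> (Suc n) (Suc k) =
     noncentral_stirling \<alpha> n k + (real (Suc k) - \<alpha>) * noncentral_stirling \<alpha> n (Suc k)"

definition T_twist :: "nat \<Rightarrow> (int \<Rightarrow> complex) \<Rightarrow> nat \<Rightarrow> int \<Rightarrow> complex" where
  "T_twist q chi N c =
     - (\<i> ^ N) * (gauss_sum q (cnj_character chi) * chi c
                  + (-1) ^ N * gauss_sum q chi * cnj_character chi c)"

end

theory Submission
  imports Defs "HOL-Number_Theory.Residues" "HOL-Probability.Sinc_Integral" "HOL-Probability.Characteristic_Functions"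
begin

text \<open>
  On the critical line, \<open>\<Gamma>(s) \<Gamma>(1 - s) = \<pi> / sin (\<pi> s)\<close> says that \<open>\<pi> / cosh (\<pi> t)\<close> is \<open>|\<Gamma>(1/2 + it)|\<^sup>2\<close>,
  and \<open>\<Gamma>(s) L(s, \<chi>)\<close> is the Mellin transform of \<open>F(x) = \<Sum>\<chi>(n) exp(-nx)\<close>. So \<open>|L|\<^sup>2 / cosh\<close> is, up to a
  constant, the square of the absolute value of the Fourier transform of \<open>f(u) = exp(u/2) F(exp u)\<close>.
  All derivatives of \<open>f\<close> decay exponentially, and \<open>t\<^sup>N\<close> turns into an \<open>N\<close>-th derivative, so Parseval's
  identity (\<open>weighted_parseval\<close>) converts the moment into the integral of \<open>f\<close> against the conjugate of
  its \<open>N\<close>-th derivative. With \<open>\<theta> = x d/dx\<close>, that derivative corresponds to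
  \<open>(\<theta> + 1/2)\<^sup>N = \<Sum>S(N,k) x\<^sup>k (d/dx)\<^sup>k\<close>, which is where the non-central Stirling numbers come from. What is
  left are the integrals of \<open>x\<^sup>k F(x) G\<^sup>(\<^sup>k\<^sup>)(x)\<close> over the positive half line, with \<open>G\<close> the function that
  belongs to the conjugate character. The integrands are even, so these are half of the integrals over
  the whole line (\<open>crit_product_integral\<close>).

  The function \<open>F\<close> is rational in \<open>exp(-x)\<close>. It has period \<open>2\<pi>i\<close>, decays exponentially in both directions
  and has only simple poles, at points \<open>2\<pi>ib/q\<close> where \<open>q\<close> does not divide \<open>b\<close>; there is no pole at 0, because
  the values of \<open>\<chi>\<close> sum to zero. If \<open>p\<close> is the Bernoulli polynomial that is scaled such that \<open>p(x + 2\<pi>i) - p(x) = x\<^sup>k\<close>, then comparing the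
  integrals of \<open>p F G\<^sup>(\<^sup>k\<^sup>)\<close> over the real line and over its translate by \<open>2\<pi>i\<close> expresses the integral by
  the residues at these poles (\<open>moment_integral\<close>).

  Each residue has three contributions. The polar part of \<open>F\<close> against that of \<open>G\<close> gives the term with
  \<open>B\<^sub>N(1/2) \<phi>(q)/q\<close>, by the identity \<open>bernc_eq_sum_stirling\<close>. The polar part of \<open>F\<close> against the regular
  part of \<open>G\<close> gives products of Bernoulli polynomials, since the Taylor coefficients of the regular
  part are twisted generalised Bernoulli numbers (\<open>higher_deriv_regular_part\<close>). The regular part of \<open>F\<close>
  against the polar part of \<open>G\<close> involves derivatives of a product; the sum over \<open>k\<close> with Stirling weights
  collapses it to the same shape, because \<open>\<theta> + 1/2\<close> is minus its own formal adjoint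
  (\<open>stirling_adjoint\<close>). Primitivity enters through the evaluation of the finite Fourier coefficients of
  \<open>\<chi>\<close>, which are the residues of \<open>F\<close>, by Gauss sums (\<open>char_coeff_eq\<close>).

  The L-function is specified as an entire function that extends the Dirichlet series. Its existence
  comes from repeated integration by parts in the Mellin integral (\<open>L_cont_Suc\<close>).
\<close>

section \<open>Dirichlet characters and their finite Fourier transform\<close>

text \<open>The powers of \<open>xi q\<close> with arbitrary integer exponents, since the finite Fourier coefficients
  below involve negative ones.\<close>

definition add_char :: "nat \<Rightarrow> int \<Rightarrow> complex" where
  "add_char q n = exp (2 * of_real pi * \<i> * of_int n / of_nat q)"

lemma add_char_0 [simp]: "add_char q 0 = 1"
  by (simp add: add_char_def)

lemma add_char_add: "add_char q (m + n) = add_char q m * add_char q n"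
  by (simp add: add_char_def ring_distribs add_divide_distrib exp_add)

lemma add_char_cnj: "cnj (add_char q n) = add_char q (- n)"
  by (simp add: add_char_def exp_cnj)

lemma xi_power: "xi q ^ k = add_char q (int k)"
  by (simp add: xi_def add_char_def mult_ac flip: exp_of_nat_mult)

lemma add_char_power: "add_char q n ^ k = add_char q (int k * n)"
  by (simp add: add_char_def mult_ac flip: exp_of_nat_mult)

lemma add_char_eq_1_iff:
  assumes "q > 0"
  shows "add_char q n = 1 \<longleftrightarrow> int q dvd n"
proof
  assume "add_char q n = 1"
  then obtain k :: int where k: "2 * pi * of_int n / of_nat q = of_int (2 * k) * pi"
    by (auto simp: add_char_def exp_eq_1)
  then have "real_of_int n = real_of_int (k * int q)"
    using assms by (simp add: field_simps)
  then have "n = k * int q"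
    using of_int_eq_iff by blast
  then show "int q dvd n" by simp
next
  assume "int q dvd n"
  then obtain k where k: "n = int q * k" ..
  have "add_char q n = exp (of_int k * (2 * of_real pi * \<i>))"
    using assms by (simp add: add_char_def k field_simps)
  also have "\<dots> = 1"
    using exp_2pi_1_int[of k] by (simp add: mult_ac)
  finally show "add_char q n = 1" .
qed

lemma add_char_cong:
  assumes "q > 0" "[m = n] (mod int q)"
  shows "add_char q m = add_char q n"
proof -
  have "int q dvd m - n"
    using assms(2) by (simp add: cong_iff_dvd_diff)
  then have "add_char q (m - n) = 1"
    using assms(1) by (simp add: add_char_eq_1_iff)
  then show ?thesis
    using add_char_add[of q "m - n" n] by simp
qed

lemma sum_period_eq:
  fixes f :: "int \<Rightarrow> complex"
  assumes "q > 0" and f: "\<And>m n. [m = n] (mod int q) \<Longrightarrow> f m = f n"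
  shows "(\<Sum>a=1..q. f (int a)) = (\<Sum>r\<in>{0..<int q}. f r)"
proof -
  have "(\<Sum>a=1..q. f (int a)) = (\<Sum>a\<in>{1..<q}. f (int a)) + f (int q)"
    using assms(1) by (simp add: sum.last_plus atLeastLessThanSuc_atLeastAtMost[symmetric] sum.atLeastLessThan_Suc)
  also have "f (int q) = f 0"
    by (intro f) (simp add: cong_def)
  also have "(\<Sum>a\<in>{1..<q}. f (int a)) + f 0 = (\<Sum>a\<in>{0..<q}. f (int a))"
    using assms(1) by (simp add: sum.atLeast_Suc_lessThan)
  also have "\<dots> = (\<Sum>r\<in>{0..<int q}. f r)"
    by (rule sum.reindex_bij_witness[of _ nat int]) auto
  finally show ?thesis .
qed

text \<open>A map that is injective modulo \<open>q\<close> permutes the finitely many residues, so substituting it does not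
  change a sum over a period. The substitutions used are shifts, reflections and multiplications by
  units.\<close>

lemma sum_period_reindex:
  fixes f :: "int \<Rightarrow> complex"
  assumes "q > 0" and f: "\<And>m n. [m = n] (mod int q) \<Longrightarrow> f m = f n"
    and g: "\<And>m n. [g m = g n] (mod int q) \<longleftrightarrow> [m = n] (mod int q)"
  shows "(\<Sum>a=1..q. f (g (int a))) = (\<Sum>a=1..q. f (int a))"
proof -
  let ?I = "{0..<int q}" and ?h = "\<lambda>r. g r mod int q"
  have inj: "inj_on ?h ?I"
    using g by (auto simp: inj_on_def cong_def)
  have sub: "?h ` ?I \<subseteq> ?I"
    using assms(1) by auto
  have im: "?h ` ?I = ?I"
    by (rule endo_inj_surj[OF _ sub inj]) simp
  have "(\<Sum>a=1..q. f (g (int a))) = (\<Sum>r\<in>?I. f (g r))"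
    using assms(1) f g by (intro sum_period_eq[of q "\<lambda>r. f (g r)"]) auto
  also have "\<dots> = (\<Sum>r\<in>?I. f (?h r))"
    by (intro sum.cong refl f) (simp add: cong_def)
  also have "\<dots> = (\<Sum>r\<in>?h ` ?I. f r)"
    using inj by (simp add: sum.reindex)
  also have "\<dots> = (\<Sum>a=1..q. f (int a))"
    using im sum_period_eq[of q f] assms(1) f by simp
  finally show ?thesis .
qed

text \<open>If \<open>n\<close> is not a multiple of \<open>q\<close>, the shift of \<open>b\<close> by one multiplies the sum by a number other
  than 1.\<close>

lemma sum_add_char:
  assumes "q > 0"
  shows "(\<Sum>b=1..q. add_char q (int b * n)) = (if int q dvd n then of_nat q else 0)"
proof (cases "int q dvd n")
  case True
  then have "add_char q (int b * n) = 1" for b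
    using assms by (simp add: add_char_eq_1_iff)
  with True show ?thesis by simp
next
  case False
  have "(\<Sum>b=1..q. add_char q (int b * n)) = (\<Sum>b=1..q. add_char q ((int b + 1) * n))"
    using assms
    by (intro sum_period_reindex[of q "\<lambda>b. add_char q (b * n)" "\<lambda>b. b + 1", symmetric])
       (auto intro!: add_char_cong cong_mult simp: cong_add_rcancel)
  also have "\<dots> = add_char q n * (\<Sum>b=1..q. add_char q (int b * n))"
    by (simp add: sum_distrib_left algebra_simps add_char_add)
  finally have "(add_char q n - 1) * (\<Sum>b=1..q. add_char q (int b * n)) = 0"
    by (simp add: algebra_simps)
  with False show ?thesis
    using assms by (simp add: add_char_eq_1_iff)
qed

text \<open>The finite Fourier coefficients of \<open>chi\<close>. They become the residues of its generating function.\<close>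

definition char_coeff :: "nat \<Rightarrow> (int \<Rightarrow> complex) \<Rightarrow> int \<Rightarrow> complex" where
  "char_coeff q chi b = (\<Sum>a=1..q. chi (int a) * add_char q (- (int a * b))) / of_nat q"

locale dirichlet_char =
  fixes q :: nat and chi :: "int \<Rightarrow> complex"
  assumes q: "q > 1" and chi: "dirichlet_character q chi"
begin

lemma char_mult: "chi (m * n) = chi m * chi n"
  using chi unfolding dirichlet_character_def by blast

lemma char_nonzero_iff: "chi n \<noteq> 0 \<longleftrightarrow> coprime n (int q)"
  using chi unfolding dirichlet_character_def by blast

lemma char_cong:
  assumes "[m = n] (mod int q)"
  shows "chi m = chi n"
proof -
  have step: "chi (n + int q) = chi n" for n
    using chi unfolding dirichlet_character_def by blast
  have per: "chi (n + int k * int q) = chi n" for k :: nat and n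
  proof (induction k)
    case (Suc k)
    have "n + int (Suc k) * int q = (n + int k * int q) + int q"
      by (simp add: algebra_simps)
    then have "chi (n + int (Suc k) * int q) = chi (n + int k * int q)"
      by (simp only: step)
    also have "\<dots> = chi n" by (rule Suc)
    finally show ?case .
  qed simp
  have "\<exists>k. m = n + int q * k"
    using cong_sym[OF assms] by (simp only: cong_iff_lin)
  then obtain k where k: "m = n + k * int q"
    by (metis mult.commute)
  show ?thesis
  proof (cases "k \<ge> 0")
    case True
    then show ?thesis using per[of n "nat k"] k by simp
  next
    case False
    then show ?thesis using per[of m "nat (- k)"] k by (simp add: algebra_simps)
  qed
qed

lemma char_1: "chi 1 = 1"
  using char_mult[of 1 1] char_nonzero_iff[of 1] by simp

lemma char_modulus: "chi (int q) = 0"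
  using char_nonzero_iff[of "int q"] q by auto

lemma char_power: "chi (n ^ k) = chi n ^ k"
  by (induction k) (simp_all add: char_1 char_mult)

text \<open>By Euler's theorem the values at units are roots of unity.\<close>

lemma char_norm:
  assumes "coprime n (int q)"
  shows "cmod (chi n) = 1"
proof -
  define m where "m = nat (n mod int q)"
  have m: "int m = n mod int q"
    using q by (simp add: m_def)
  have "coprime (int m) (int q)"
    using assms q m by (simp add: coprime_mod_left_iff)
  then have "[m ^ totient q = 1] (mod q)"
    using euler_theorem[of m q] by simp
  then have "[int m ^ totient q = 1] (mod int q)"
    by (metis cong_int_iff of_nat_1 of_nat_power)
  then have "chi (int m) ^ totient q = 1"
    using char_cong char_power char_1 by metis
  moreover have "chi (int m) = chi n"
    by (intro char_cong) (simp add: m cong_def)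
  ultimately have "cmod (chi n) ^ totient q = 1"
    by (metis norm_one norm_power)
  moreover have "totient q > 0"
    using q by simp
  ultimately show ?thesis
    using power_eq_1_iff[of "cmod (chi n)" "totient q"] by auto
qed

lemma char_mult_cnj: "chi n * cnj (chi n) = (if coprime n (int q) then 1 else 0)"
  using char_norm[of n] char_nonzero_iff[of n] by (auto simp flip: complex_norm_square)

lemma char_norm_le: "cmod (chi n) \<le> 1"
  using char_norm[of n] char_nonzero_iff[of n] by (cases "coprime n (int q)") auto

lemma char_neg1_sq: "chi (-1) * chi (-1) = 1"
  using char_mult[of "-1" "-1"] char_1 by simp

lemma char_neg1_cnj: "cnj (chi (-1)) = chi (-1)"
proof -
  have "chi (-1) = 1 \<or> chi (-1) = -1"
    using char_neg1_sq by (simp add: square_eq_1_iff)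
  then show ?thesis by auto
qed

lemma char_minus: "chi (- n) = chi (-1) * chi n"
  using char_mult[of "-1" n] by simp

lemma gauss_sum_eq: "gauss_sum q chi = (\<Sum>a=1..q. chi (int a) * add_char q (int a))"
proof -
  obtain r where r: "q = Suc r" using q by (cases q) auto
  have "chi (int (Suc r)) = 0" using char_modulus by (simp only: r)
  then show ?thesis
    by (simp add: gauss_sum_def xi_power r del: of_nat_Suc)
qed

lemma char_coeff_inversion:
  "(\<Sum>b=1..q. char_coeff q chi (int b) * add_char q (int b * n)) = chi n"
proof -
  have "(\<Sum>b=1..q. char_coeff q chi (int b) * add_char q (int b * n)) =
     (\<Sum>b=1..q. (\<Sum>a=1..q. chi (int a) * add_char q (int b * (n - int a)) / of_nat q))"
    unfolding char_coeff_def sum_divide_distrib sum_distrib_right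
    by (intro sum.cong refl) (simp add: algebra_simps add_char_add[symmetric])
  also have "\<dots> = (\<Sum>a=1..q. chi (int a) * (\<Sum>b=1..q. add_char q (int b * (n - int a))) / of_nat q)"
    by (subst sum.swap) (simp add: sum_distrib_left sum_divide_distrib)
  also have "\<dots> = (\<Sum>a=1..q. if [n = int a] (mod int q) then chi (int a) else 0)"
    using q by (intro sum.cong refl) (subst sum_add_char, auto simp: cong_iff_dvd_diff)
  also have "\<dots> = (\<Sum>r\<in>{0..<int q}. if [n = r] (mod int q) then chi r else 0)"
  proof (rule sum_period_eq[of q "\<lambda>r. if [n = r] (mod int q) then chi r else 0"])
    fix k m :: int assume km: "[k = m] (mod int q)"
    then have "[n = k] (mod int q) \<longleftrightarrow> [n = m] (mod int q)"
      by (meson cong_sym cong_trans)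
    with char_cong[OF km] show "(if [n = k] (mod int q) then chi k else 0) =
        (if [n = m] (mod int q) then chi m else 0)" by simp
  qed (use q in simp)
  also have "\<dots> = (\<Sum>r\<in>{n mod int q}. chi r)"
    using q by (intro sum.mono_neutral_cong_right) (auto simp: cong_def)
  also have "\<dots> = chi n"
    using char_cong[of "n mod int q" n] by (simp add: cong_def)
  finally show ?thesis .
qed

text \<open>It suffices to add to \<open>n\<close> the product of \<open>d\<close> and of those primes of \<open>q\<close> that do not divide \<open>n\<close>:
  every prime of \<open>q\<close> then divides exactly one of the two summands.\<close>

lemma coprime_lift:
  fixes n :: int
  assumes "d dvd q" "coprime n (int d)"
  shows "\<exists>m. [m = n] (mod int d) \<and> coprime m (int q)"
proof -
  define P where "P = {p \<in> prime_factors (int q). \<not> p dvd n}"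
  have fin: "finite P" by (simp add: P_def)
  have "coprime (n + int d * \<Prod>P) (int q)"
  proof (rule ccontr)
    assume "\<not> coprime (n + int d * \<Prod>P) (int q)"
    then obtain p where p: "prime p" "p dvd n + int d * \<Prod>P" "p dvd int q"
      using q prime_divisor_exists[of "gcd (n + int d * \<Prod>P) (int q)"] by (auto simp: coprime_iff_gcd_eq_1)
    show False
    proof (cases "p dvd n")
      case True
      then have "p dvd int d * \<Prod>P" using p(2) by (simp add: dvd_add_right_iff)
      then consider "p dvd int d" | "p dvd \<Prod>P" using p(1) by (auto simp: prime_dvd_mult_iff)
      then show False
      proof cases
        case 1
        then show False using True assms(2) p(1) by (meson coprime_common_divisor not_prime_unit)
      next
        case 2
        then obtain r where r: "r \<in> P" "p dvd r"
          using fin p(1) by (auto simp: prime_dvd_prod_iff)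
        then have "prime r" by (auto simp: P_def)
        then have "p = r" using r(2) p(1) by (simp add: primes_dvd_imp_eq)
        then show False using r(1) True by (simp add: P_def)
      qed
    next
      case False
      then have "p \<in> P" using p q by (auto simp: P_def prime_factors_dvd)
      then have "p dvd \<Prod>P" using fin by (meson dvd_prodI)
      then have "p dvd n" using p(2) by (metis dvd_add_left_iff dvd_mult)
      with False show False by simp
    qed
  qed
  moreover have "[n + int d * \<Prod>P = n] (mod int d)"
    by (simp add: cong_def)
  ultimately show ?thesis by blast
qed

text \<open>The quotient of two units of \<open>q\<close> that agree modulo \<open>d\<close> is 1 modulo \<open>d\<close>, so \<open>chi\<close> takes the same value
  at both. The induced character evaluates \<open>chi\<close> at any lift to a unit of \<open>q\<close>.\<close>

lemma factors_through:
  assumes d: "d dvd q" and triv: "\<And>u. coprime u (int q) \<Longrightarrow> [u = 1] (mod int d) \<Longrightarrow> chi u = 1"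
  shows "\<exists>\<psi>. dirichlet_character d \<psi> \<and> (\<forall>n. coprime n (int q) \<longrightarrow> chi n = \<psi> n)"
proof -
  have eq: "chi m = chi n" if "coprime m (int q)" "coprime n (int q)" "[m = n] (mod int d)" for m n
  proof -
    \<comment> \<open>An inverse of \<open>n\<close>; multiplying by it reduces the claim to arguments that are 1 modulo \<open>d\<close>.\<close>
    obtain k where k: "[n * k = 1] (mod int q)"
      using \<open>coprime n (int q)\<close> by (meson cong_solve_coprime_int)
    then have ck: "coprime k (int q)"
      by (metis coprime_iff_invertible_int mult.commute)
    have kd: "[n * k = 1] (mod int d)"
      using k d by (meson cong_dvd_modulus int_dvd_int_iff)
    have "[m * k = n * k] (mod int d)"
      using that(3) by (rule cong_scalar_right)
    then have "[m * k = 1] (mod int d)"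
      using kd cong_trans by blast
    then have "chi (m * k) = 1"
      using that ck by (intro triv) auto
    moreover have "chi (n * k) = 1"
      using char_cong[OF k] char_1 by simp
    ultimately have "chi m * chi k = chi n * chi k"
      by (simp add: char_mult)
    then show ?thesis
      using ck char_nonzero_iff[of k] by simp
  qed
  \<comment> \<open>A lift of the class of \<open>n\<close> modulo \<open>d\<close> to a unit of \<open>q\<close>.\<close>
  define L where "L n = (SOME m. [m = n] (mod int d) \<and> coprime m (int q))" for n
  have L: "[L n = n] (mod int d)" "coprime (L n) (int q)" if "coprime n (int d)" for n
    using someI_ex[OF coprime_lift[OF d that]] unfolding L_def by auto
  define \<psi> where "\<psi> n = (if coprime n (int d) then chi (L n) else 0)" for n
  have \<psi>: "\<psi> n = chi n" if "coprime n (int q)" for n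
  proof -
    have "coprime n (int d)"
      using that d by (meson coprime_divisors dvd_refl int_dvd_int_iff)
    then show ?thesis
      using L[of n] eq[of "L n" n] that by (simp add: \<psi>_def)
  qed
  have cong: "\<psi> m = \<psi> n" if "[m = n] (mod int d)" for m n
  proof -
    have c: "coprime m (int d) \<longleftrightarrow> coprime n (int d)"
      using that by (metis cong_imp_coprime cong_sym)
    show ?thesis
    proof (cases "coprime n (int d)")
      case True
      have "[L m = L n] (mod int d)"
        using L(1)[of m] L(1)[of n] True c that by (meson cong_sym cong_trans)
      then show ?thesis
        using True c L(2) by (auto simp: \<psi>_def intro!: eq)
    qed (use c in \<open>simp add: \<psi>_def\<close>)
  qed
  have "dirichlet_character d \<psi>"
    unfolding dirichlet_character_def
  proof (intro conjI allI)
    show "\<psi> (n + int d) = \<psi> n" for n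
      by (rule cong) (simp add: cong_def)
    show "\<psi> (m * n) = \<psi> m * \<psi> n" for m n
    proof (cases "coprime m (int d) \<and> coprime n (int d)")
      case True
      have "[L m * L n = m * n] (mod int d)"
        using True L(1) by (intro cong_mult) auto
      then have "\<psi> (m * n) = \<psi> (L m * L n)"
        using cong cong_sym by blast
      also have "\<dots> = chi (L m * L n)"
        using True L(2) by (intro \<psi>) auto
      finally show ?thesis
        using True by (simp add: \<psi>_def char_mult)
    qed (auto simp: \<psi>_def)
    show "(\<psi> n \<noteq> 0) = coprime n (int d)" for n
      using L(2)[of n] char_nonzero_iff[of "L n"] by (simp add: \<psi>_def)
  qed
  with \<psi> show ?thesis by metis
qed

text \<open>For \<open>b\<close> prime to \<open>q\<close>, substituting \<open>a \<mapsto> -ab\<close> in the Gauss sum isolates the factor \<open>cnj (chi b)\<close>. If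
  \<open>b\<close> and \<open>q\<close> have a common factor, put \<open>d = q / gcd b q\<close>. Multiplying \<open>a\<close> by a unit \<open>u\<close> that is 1 modulo
  \<open>d\<close> does not change the additive character, so the sum equals \<open>chi u\<close> times itself. If it did not vanish,
  \<open>chi\<close> would be trivial on all such \<open>u\<close> and would factor through the proper divisor \<open>d\<close>.\<close>

lemma char_coeff_eq:
  assumes prim: "primitive_character q chi"
  shows "char_coeff q chi b = chi (-1) * gauss_sum q chi * cnj (chi b) / of_nat q"
proof (cases "coprime b (int q)")
  case True
  have unit: "chi (-1) * cnj (chi b) * chi (- (a * b)) = chi a" for a
  proof -
    have "chi (- (a * b)) = chi (-1) * (chi a * chi b)"
      using char_mult char_minus by metis
    then show ?thesis
      using char_mult_cnj[of b] char_neg1_sq True by (simp add: algebra_simps)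
  qed
  have "(\<Sum>a=1..q. chi (int a) * add_char q (- (int a * b))) =
     (\<Sum>a=1..q. chi (-1) * cnj (chi b) * (chi (- (int a * b)) * add_char q (- (int a * b))))"
    by (intro sum.cong refl) (subst unit[symmetric], simp)
  also have "\<dots> = chi (-1) * cnj (chi b) * (\<Sum>a=1..q. chi (- (int a * b)) * add_char q (- (int a * b)))"
    by (simp add: sum_distrib_left)
  also have "(\<Sum>a=1..q. chi (- (int a * b)) * add_char q (- (int a * b))) =
      (\<Sum>a=1..q. chi (int a) * add_char q (int a))"
    using q True
    by (intro sum_period_reindex[of q "\<lambda>a. chi a * add_char q a" "\<lambda>a. - (a * b)"])
       (auto simp: cong_minus_minus_iff cong_mult_rcancel coprime_commute intro!: arg_cong2[where f = "(*)"] char_cong add_char_cong)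
  finally show ?thesis
    by (simp add: char_coeff_def gauss_sum_eq)
next
  case False
  define S where "S = (\<Sum>a=1..q. chi (int a) * add_char q (- (int a * b)))"
  have "S = 0"
  proof (rule ccontr)
    assume S: "S \<noteq> 0"
    define g where "g = nat (gcd b (int q))"
    have g: "int g = gcd b (int q)" by (simp add: g_def)
    have g1: "g > 1"
    proof -
      have "g \<noteq> 0" using q g by (metis gcd_eq_0_iff of_nat_eq_0_iff not_less_zero)
      moreover have "g \<noteq> 1" using False g by (metis is_unit_gcd of_nat_1 dvd_refl)
      ultimately show ?thesis by simp
    qed
    have gq: "g dvd q" using g by (metis gcd_dvd2 int_dvd_int_iff)
    define d where "d = q div g"
    have dg: "d * g = q" using gq by (simp add: d_def)
    have "chi u = 1" if u: "coprime u (int q)" "[u = 1] (mod int d)" for u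
    proof -
      have ub: "[u * b = b] (mod int q)"
      proof -
        have "int d dvd u - 1" using u(2) by (simp add: cong_iff_dvd_diff)
        moreover have "int g dvd b" using g by simp
        ultimately have "int d * int g dvd (u - 1) * b" by (rule mult_dvd_mono)
        then show ?thesis using dg by (simp add: cong_iff_dvd_diff algebra_simps flip: of_nat_mult)
      qed
      have "S = (\<Sum>a=1..q. chi (u * int a) * add_char q (- ((u * int a) * b)))"
        unfolding S_def using q u(1)
        by (intro sum_period_reindex[of q "\<lambda>a. chi a * add_char q (- (a * b))" "\<lambda>a. u * a", symmetric])
           (auto simp: cong_minus_minus_iff cong_mult_lcancel coprime_commute
              intro!: arg_cong2[where f = "(*)"] char_cong add_char_cong cong_mult)
      also have "\<dots> = (\<Sum>a=1..q. chi u * (chi (int a) * add_char q (- (int a * b))))"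
      proof (intro sum.cong refl)
        fix a
        have "[- ((u * int a) * b) = - (int a * b)] (mod int q)"
          using cong_scalar_left[OF ub, of "int a"] by (simp add: cong_minus_minus_iff mult_ac)
        then have "add_char q (- ((u * int a) * b)) = add_char q (- (int a * b))"
          using q by (intro add_char_cong) auto
        then show "chi (u * int a) * add_char q (- ((u * int a) * b)) =
           chi u * (chi (int a) * add_char q (- (int a * b)))"
          by (simp add: char_mult)
      qed
      also have "\<dots> = chi u * S" by (simp add: S_def sum_distrib_left)
      finally show ?thesis using S by simp
    qed
    then obtain \<psi> where "dirichlet_character d \<psi>" "\<forall>n. coprime n (int q) \<longrightarrow> chi n = \<psi> n"
      using factors_through[of d] dg by (metis dvd_triv_left)
    moreover have "d dvd q" using dg by (metis dvd_triv_left)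
    moreover have "d < q"
    proof -
      have "d > 0" using dg q by (cases d) auto
      then have "d * 1 < d * g" using g1 by (intro mult_strict_left_mono) auto
      then show ?thesis using dg by simp
    qed
    ultimately show False using prim unfolding primitive_character_def by blast
  qed
  moreover have "chi b = 0" using False char_nonzero_iff by blast
  ultimately show ?thesis by (simp add: char_coeff_def S_def)
qed

lemma char_coeff_cong:
  assumes "[b = b'] (mod int q)"
  shows "char_coeff q chi b = char_coeff q chi b'"
proof -
  have "add_char q (- (a * b)) = add_char q (- (a * b'))" for a
    using q assms by (intro add_char_cong) (auto simp: cong_minus_minus_iff intro: cong_scalar_left)
  then show ?thesis by (simp add: char_coeff_def)
qed

lemma char_coeff_minus: "char_coeff q chi (- b) = chi (-1) * char_coeff q chi b"
proof -
  have "(\<Sum>a=1..q. chi (int a) * add_char q (- (int a * (- b)))) =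
     chi (-1) * (\<Sum>a=1..q. chi (- int a) * add_char q (- ((- int a) * b)))"
  proof -
    have "chi (-1) * (chi (- a) * z) = chi a * z" for a :: int and z
      using char_neg1_sq char_minus[of a] by (metis mult.assoc mult_1)
    then show ?thesis by (simp only: sum_distrib_left mult_minus_left mult_minus_right)
  qed
  also have "(\<Sum>a=1..q. chi (- int a) * add_char q (- ((- int a) * b))) =
     (\<Sum>a=1..q. chi (int a) * add_char q (- (int a * b)))"
    using q
    by (intro sum_period_reindex[of q "\<lambda>a. chi a * add_char q (- (a * b))" "\<lambda>a. - a"])
       (auto simp: cong_minus_minus_iff intro!: arg_cong2[where f = "(*)"] char_cong add_char_cong cong_mult)
  finally show ?thesis by (simp add: char_coeff_def)
qed

lemma char_coeff_reflect:
  assumes "b \<le> q"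
  shows "char_coeff q chi (int (q - b)) = chi (-1) * char_coeff q chi (int b)"
proof -
  have "char_coeff q chi (int (q - b)) = char_coeff q chi (- int b)"
    using assms by (intro char_coeff_cong) (simp add: cong_def of_nat_diff)
  then show ?thesis by (simp add: char_coeff_minus)
qed

lemma char_coeff_cnj: "cnj (char_coeff q chi b) = char_coeff q (cnj_character chi) (- b)"
  by (simp add: char_coeff_def cnj_character_def add_char_cnj)

lemma dirichlet_char_cnj: "dirichlet_char q (cnj_character chi)"
proof
  show "dirichlet_character q (cnj_character chi)"
    using chi unfolding dirichlet_character_def cnj_character_def
    by (metis complex_cnj_mult complex_cnj_zero_iff)
qed (rule q)

lemma gauss_sum_cnj: "cnj (gauss_sum q chi) = chi (-1) * gauss_sum q (cnj_character chi)"
proof -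
  have "cnj (gauss_sum q chi) = (\<Sum>a=1..q. cnj (chi (int a)) * add_char q (- int a))"
    by (simp add: gauss_sum_eq add_char_cnj)
  also have "\<dots> = chi (-1) * (\<Sum>a=1..q. cnj (chi (- int a)) * add_char q (- int a))"
  proof -
    have "chi (-1) * (cnj (chi (- a)) * z) = cnj (chi a) * z" for a z
    proof -
      have "cnj (chi (- a)) = chi (-1) * cnj (chi a)"
        by (simp only: char_minus[of a] complex_cnj_mult char_neg1_cnj)
      then show ?thesis
        using char_neg1_sq by (metis mult.assoc mult_1)
    qed
    then show ?thesis by (simp only: sum_distrib_left)
  qed
  also have "(\<Sum>a=1..q. cnj (chi (- int a)) * add_char q (- int a)) =
      (\<Sum>a=1..q. cnj (chi (int a)) * add_char q (int a))"
    using q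
    by (intro sum_period_reindex[of q "\<lambda>a. cnj (chi a) * add_char q a" "\<lambda>a. - a"])
       (auto simp: cong_minus_minus_iff intro!: arg_cong2[where f = "(*)"] arg_cong[of _ _ cnj] char_cong add_char_cong)
  also have "\<dots> = gauss_sum q (cnj_character chi)"
  proof -
    obtain r where r: "q = Suc r" using q by (cases q) auto
    have "chi (int (Suc r)) = 0" using char_modulus by (simp only: r)
    then show ?thesis
      by (simp add: gauss_sum_def xi_power cnj_character_def r del: of_nat_Suc)
  qed
  finally show ?thesis .
qed

text \<open>This is Fourier inversion at \<open>n = 1\<close>: the coefficients are multiples of \<open>cnj (chi b)\<close>, so the inversion
  sum is again a Gauss sum.\<close>

lemma gauss_sum_norm:
  assumes prim: "primitive_character q chi"
  shows "gauss_sum q chi * cnj (gauss_sum q chi) = of_nat q"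
proof -
  have "1 = (\<Sum>b=1..q. char_coeff q chi (int b) * add_char q (int b))"
    using char_coeff_inversion[of 1] char_1 by simp
  also have "\<dots> = chi (-1) * gauss_sum q chi / of_nat q * (\<Sum>b=1..q. cnj (chi (int b)) * add_char q (int b))"
    by (simp add: char_coeff_eq[OF prim] sum_distrib_left algebra_simps sum_divide_distrib)
  also have "(\<Sum>b=1..q. cnj (chi (int b)) * add_char q (int b)) = gauss_sum q (cnj_character chi)"
  proof -
    obtain r where r: "q = Suc r" using q by (cases q) auto
    have "chi (int (Suc r)) = 0" using char_modulus by (simp only: r)
    then show ?thesis
      by (simp add: gauss_sum_def xi_power cnj_character_def r del: of_nat_Suc)
  qed
  finally show ?thesis
    using q by (simp add: gauss_sum_cnj field_simps)
qed

lemma sum_char_mult_cnj: "(\<Sum>b=1..q. chi (int b) * cnj (chi (int b))) = of_nat (totient q)"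
proof -
  have "(\<Sum>b=1..q. chi (int b) * cnj (chi (int b))) = (\<Sum>b\<in>{b\<in>{1..q}. coprime b q}. 1)"
    by (subst sum.inter_filter) (simp_all add: char_mult_cnj)
  also have "{b\<in>{1..q}. coprime b q} = totatives q"
    by (auto simp: totatives_def)
  finally show ?thesis by (simp add: totient_def)
qed

end

text \<open>The vanishing of the sum of the values over a period makes the generating function regular at 0 and
  lets it decay at both ends of the real line. It follows from primitivity and passes to the conjugate
  character at once.\<close>

locale balanced_char = dirichlet_char +
  assumes balanced: "(\<Sum>a=1..q. chi (int a)) = 0"
begin

lemma char_coeff_modulus: "char_coeff q chi (int q) = 0"
proof -
  have "add_char q (- (int a * int q)) = 1" for a
    using q by (simp add: add_char_eq_1_iff)
  then show ?thesis using balanced by (simp add: char_coeff_def)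
qed

lemma char_coeff_inversion':
  "(\<Sum>b\<in>{1..<q}. char_coeff q chi (int b) * add_char q (int b * n)) = chi n"
proof -
  have "{1..q} = insert q {1..<q}" using q by auto
  then show ?thesis
    using char_coeff_inversion[of n] by (simp add: char_coeff_modulus)
qed

lemma sum_char_coeff: "(\<Sum>b\<in>{1..<q}. char_coeff q chi (int b)) = 0"
  using char_coeff_inversion'[of 0] char_nonzero_iff[of 0] q by auto

lemma balanced_char_cnj: "balanced_char q (cnj_character chi)"
proof -
  interpret c: dirichlet_char q "cnj_character chi" by (rule dirichlet_char_cnj)
  have "(\<Sum>a=1..q. cnj_character chi (int a)) = cnj (\<Sum>a=1..q. chi (int a))"
    unfolding cnj_sum cnj_character_def ..
  then show ?thesis
    by unfold_locales (simp only: balanced complex_cnj_zero)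
qed

end

lemma (in dirichlet_char) balanced_if_primitive:
  assumes prim: "primitive_character q chi"
  shows "balanced_char q chi"
proof
  have "char_coeff q chi 0 = 0"
    using char_coeff_eq[OF prim, of 0] char_nonzero_iff[of 0] q by auto
  then show "(\<Sum>a=1..q. chi (int a)) = 0"
    using q by (simp add: char_coeff_def)
qed


section \<open>Non-central Stirling numbers\<close>

lemma stirling_eq_0: "k > n \<Longrightarrow> noncentral_stirling \<alpha> n k = 0"
  by (induction \<alpha> n k rule: noncentral_stirling.induct) auto

lemma stirling_Suc:
  "noncentral_stirling \<alpha> (Suc n) k =
    (if k = 0 then 0 else noncentral_stirling \<alpha> n (k - 1)) + (real k - \<alpha>) * noncentral_stirling \<alpha> n k"
  by (cases k) auto

text \<open>The recurrence as a rule for coefficients. If multiplication by (or application of) some operator maps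
  \<open>g k\<close> to \<open>g (k + 1) + (k - \<alpha>) g k\<close>, then its \<open>n\<close>-th power maps \<open>g 0\<close> to the sum of the \<open>g k\<close> with
  coefficients \<open>S(n, k)\<close>. The two instances that matter are falling factorials, multiplied by \<open>x - \<alpha>\<close>, and
  the functions \<open>x\<^sup>k (d/dx)\<^sup>k F\<close> under \<open>\<theta> - \<alpha>\<close>, where \<open>\<theta> = x d/dx\<close>.\<close>

lemma sum_stirling_Suc:
  fixes g :: "nat \<Rightarrow> 'a::real_vector"
  shows "(\<Sum>k\<le>Suc n. noncentral_stirling \<alpha> (Suc n) k *\<^sub>R g k) =
    (\<Sum>k\<le>n. noncentral_stirling \<alpha> n k *\<^sub>R (g (Suc k) + (real k - \<alpha>) *\<^sub>R g k))"
proof -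
  let ?S = "noncentral_stirling \<alpha> n"
  have "(\<Sum>k\<le>Suc n. noncentral_stirling \<alpha> (Suc n) k *\<^sub>R g k) =
     (\<Sum>k\<le>Suc n. (if k = 0 then 0 else ?S (k - 1)) *\<^sub>R g k) + (\<Sum>k\<le>Suc n. ((real k - \<alpha>) * ?S k) *\<^sub>R g k)"
    by (simp only: stirling_Suc scaleR_add_left sum.distrib)
  also have "(\<Sum>k\<le>Suc n. (if k = 0 then 0 else ?S (k - 1)) *\<^sub>R g k) = (\<Sum>k\<le>n. ?S k *\<^sub>R g (Suc k))"
    by (subst sum.atMost_Suc_shift) simp
  also have "(\<Sum>k\<le>Suc n. ((real k - \<alpha>) * ?S k) *\<^sub>R g k) = (\<Sum>k\<le>n. ?S k *\<^sub>R ((real k - \<alpha>) *\<^sub>R g k))"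
    by (simp add: stirling_eq_0 mult.commute)
  finally show ?thesis
    by (simp add: scaleR_add_right sum.distrib)
qed

text \<open>The number \<open>(k choose j) k! / j!\<close> is the coefficient of \<open>x\<^sup>j (d/dx)\<^sup>j\<close> in the normally ordered form of
  \<open>(d/dx)\<^sup>k x\<^sup>k\<close>; the recurrence expresses \<open>(d/dx)\<^sup>k\<^sup>+\<^sup>1 x\<^sup>k\<^sup>+\<^sup>1 = (\<theta> + k + 1) (d/dx)\<^sup>k x\<^sup>k\<close>.\<close>

lemma choose_fact_recurrence:
  assumes "j > 0"
  shows "real (Suc k choose j) * fact (Suc k) / fact j =
     real (k choose (j - 1)) * fact k / fact (j - 1) + real (k + j + 1) * (real (k choose j) * fact k / fact j)"
proof -
  obtain i where i: "j = Suc i" using assms by (cases j) auto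
  have "Suc i * (k choose Suc i) + i * (k choose i) = k * (k choose i)"
  proof (cases "i \<le> k")
    case True
    have "Suc i * (k choose Suc i) = (k - i) * (k choose i)"
      by (metis Suc_times_binomial_eq binomial_absorb_comp binomial_absorption mult.commute)
    then show ?thesis using True by (simp flip: add_mult_distrib)
  qed (simp add: binomial_eq_0)
  then have "real (Suc i) * real (k choose Suc i) = (real k - real i) * real (k choose i)"
    by (simp add: algebra_simps flip: of_nat_mult of_nat_add)
  then have e: "(real k - real i) * real (k choose i) = (1 + real i) * real (k choose Suc i)" by simp
  have main: "real (Suc k choose j) * fact (Suc k) =
     (1 + real i) * real (k choose i) * fact k + (real k + real i + 2) * real (k choose Suc i) * fact k"
  proof -
    have "real (Suc k choose j) * fact (Suc k) = (real (k choose i) + real (k choose Suc i)) * ((real k + 1) * fact k)"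
      by (simp add: i)
    also have "\<dots> = ((real k - real i) * real (k choose i) + (1 + real i) * real (k choose i) + (real k + 1) * real (k choose Suc i)) * fact k"
      by (simp add: algebra_simps)
    also have "\<dots> = (1 + real i) * real (k choose i) * fact k + (real k + real i + 2) * real (k choose Suc i) * fact k"
      unfolding e by (simp add: algebra_simps)
    finally show ?thesis .
  qed
  have "(1 + real i) * real (k choose i) * fact k / fact j = real (k choose i) * fact k / fact i"
    by (simp add: i)
  then show ?thesis
    unfolding main add_divide_distrib by (simp add: i)
qed

text \<open>The Stirling numbers are the coefficients of \<open>(\<theta> + 1/2)\<^sup>N\<close> in the operators \<open>x\<^sup>k (d/dx)\<^sup>k\<close>. The formal
  adjoint of \<open>\<theta>\<close> is \<open>-\<theta> - 1\<close>, so that \<open>\<theta> + 1/2\<close> is minus its own adjoint. Therefore the operators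
  \<open>(-1)\<^sup>k (d/dx)\<^sup>k x\<^sup>k\<close>, weighted with the same coefficients, add up to \<open>(-1)\<^sup>N (\<theta> + 1/2)\<^sup>N\<close>. The lemma compares
  coefficients in normal order.\<close>

lemma stirling_adjoint:
  "(\<Sum>k\<le>N. noncentral_stirling (-1/2) N k * ((-1) ^ k * (real (k choose j) * fact k / fact j))) =
     (-1) ^ N * noncentral_stirling (-1/2) N j"
proof (induction N arbitrary: j)
  case 0
  show ?case by (cases j) auto
next
  case (Suc N)
  let ?S = "noncentral_stirling (-1/2) N"
  let ?w = "\<lambda>k j. real (k choose j) * fact k / fact j"
  have w: "?w (Suc k) j - (real k + 1/2) * ?w k j =
     (if j = 0 then 0 else ?w k (j - 1)) + (real j + 1/2) * ?w k j" for k
  proof (cases "j = 0")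
    case False
    have *: "A = B + real (k + j + 1) * C \<Longrightarrow> A - (real k + 1/2) * C = B + (real j + 1/2) * C"
      for A B C :: real by (simp add: algebra_simps)
    show ?thesis
      using *[OF choose_fact_recurrence[of j k]] False by simp
  qed (simp add: algebra_simps)
  have "(\<Sum>k\<le>Suc N. noncentral_stirling (-1/2) (Suc N) k * ((-1) ^ k * ?w k j)) =
     (\<Sum>k\<le>N. ?S k * ((-1) ^ Suc k * ?w (Suc k) j + (real k + 1/2) * ((-1) ^ k * ?w k j)))"
    using sum_stirling_Suc[of "-1/2" N "\<lambda>k. (-1) ^ k * ?w k j"] by simp
  also have "\<dots> = (\<Sum>k\<le>N. - (?S k * ((-1) ^ k * (?w (Suc k) j - (real k + 1/2) * ?w k j))))"
  proof (intro sum.cong refl)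
    have "s * (- p * A + c * (p * B)) = - (s * (p * (A - c * B)))" for s p A c B :: real
      by (simp add: algebra_simps)
    then show "?S k * ((-1) ^ Suc k * ?w (Suc k) j + (real k + 1/2) * ((-1) ^ k * ?w k j)) =
        - (?S k * ((-1) ^ k * (?w (Suc k) j - (real k + 1/2) * ?w k j)))" for k
      by (simp only: power_Suc mult_minus1)
  qed
  also have "\<dots> = - (\<Sum>k\<le>N. ?S k * ((-1) ^ k * (if j = 0 then 0 else ?w k (j - 1))))
      - (real j + 1/2) * (\<Sum>k\<le>N. ?S k * ((-1) ^ k * ?w k j))"
    unfolding w
  proof -
    have "- (s * (p * (A + c * B))) = - (s * (p * A)) - c * (s * (p * B))" for s p A c B :: real
      by (simp add: algebra_simps)
    then show "(\<Sum>k\<le>N. - (?S k * ((-1) ^ k * ((if j = 0 then 0 else ?w k (j - 1)) + (real j + 1/2) * ?w k j)))) =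
      - (\<Sum>k\<le>N. ?S k * ((-1) ^ k * (if j = 0 then 0 else ?w k (j - 1))))
      - (real j + 1/2) * (\<Sum>k\<le>N. ?S k * ((-1) ^ k * ?w k j))"
      by (simp only: sum_subtractf sum_negf sum_distrib_left)
  qed
  also have "(\<Sum>k\<le>N. ?S k * ((-1) ^ k * (if j = 0 then 0 else ?w k (j - 1)))) =
      (if j = 0 then 0 else (-1) ^ N * ?S (j - 1))"
    using Suc[of "j - 1"] by simp
  also have "(\<Sum>k\<le>N. ?S k * ((-1) ^ k * ?w k j)) = (-1) ^ N * ?S j"
    by (rule Suc)
  finally have eq: "(\<Sum>k\<le>Suc N. noncentral_stirling (-1/2) (Suc N) k * ((-1) ^ k * ?w k j)) =
    - (if j = 0 then 0 else (-1) ^ N * ?S (j - 1)) - (real j + 1/2) * ((-1) ^ N * ?S j)" .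
  show ?case
    unfolding eq stirling_Suc[of _ N j] by (simp add: algebra_simps)
qed

section \<open>Bernoulli polynomials as Taylor coefficients\<close>

definition bernc :: "nat \<Rightarrow> complex \<Rightarrow> complex" where
  "bernc n x = (\<Sum>k\<le>n. of_nat (n choose k) * of_real (bernoulli (n - k)) * x ^ k)"

lemma bernc_of_real: "bernc n (of_real x) = of_real (bernoulli_poly n x)"
  by (simp add: bernc_def bernoulli_poly_def)

text \<open>The function \<open>(exp z - 1) / z\<close> without its removable singularity. Its inverse \<open>z / (exp z - 1)\<close>, the
  generating function of the Bernoulli numbers, is then holomorphic by a general rule.\<close>

definition expm1_quot :: "complex \<Rightarrow> complex" where
  "expm1_quot z = (if z = 0 then 1 else (exp z - 1) / z)"

lemma exp_eq_1_ball:
  assumes "z \<in> ball 0 (2 * pi)" "exp z = 1"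
  shows "z = (0 :: complex)"
proof -
  obtain n :: int where n: "Re z = 0" "Im z = of_int (2 * n) * pi"
    using assms(2) by (auto simp: exp_eq_1)
  have "\<bar>Im z\<bar> < 2 * pi"
    using assms(1) abs_Im_le_cmod[of z] by simp
  then have "\<bar>real_of_int n\<bar> < 1"
    using n by (simp add: abs_mult)
  then have "n = 0" by linarith
  with n show ?thesis by (simp add: complex_eq_iff)
qed

lemma expm1_quot_holomorphic: "expm1_quot holomorphic_on UNIV"
proof -
  have "(\<lambda>z. if z = 0 then deriv exp 0 else (exp z - exp 0) / (z - 0)) holomorphic_on (UNIV :: complex set)"
    by (rule pole_lemma) (auto intro!: holomorphic_intros)
  also have "deriv exp 0 = (1::complex)"
    by (intro DERIV_imp_deriv) (auto intro!: derivative_eq_intros)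
  finally show ?thesis by (simp add: expm1_quot_def[abs_def] cong: if_cong)
qed

definition bern_gen :: "complex \<Rightarrow> complex" where
  "bern_gen z = inverse (expm1_quot z)"

lemma bern_gen_holomorphic: "bern_gen holomorphic_on ball 0 (2 * pi)"
  unfolding bern_gen_def[abs_def]
proof (rule holomorphic_on_inverse)
  show "expm1_quot holomorphic_on ball 0 (2 * pi)"
    using expm1_quot_holomorphic by (rule holomorphic_on_subset) simp
  show "expm1_quot z \<noteq> 0" if "z \<in> ball 0 (2 * pi)" for z
    using exp_eq_1_ball[OF that] by (auto simp: expm1_quot_def)
qed

lemma bern_gen_mult_exp:
  assumes "z \<in> ball 0 (2 * pi)"
  shows "bern_gen z * (exp z - 1) = z"
  using exp_eq_1_ball[OF assms] by (cases "z = 0") (auto simp: bern_gen_def expm1_quot_def)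

lemma higher_deriv_exp_linear: "(deriv ^^ n) (\<lambda>z. exp (x * z)) = (\<lambda>z. x ^ n * exp (x * z :: complex))"
proof (induction n)
  case (Suc n)
  have "deriv (\<lambda>z. x ^ n * exp (x * z)) z = x ^ Suc n * exp (x * z)" for z
    by (intro DERIV_imp_deriv) (auto intro!: derivative_eq_intros)
  then show ?case using Suc by auto
qed auto

lemma higher_deriv_ident': "(deriv ^^ n) (\<lambda>z. z) = (\<lambda>z::complex. if n = 0 then z else if n = 1 then 1 else 0)"
proof (induction n)
  case (Suc n)
  show ?case
    by (cases "n = 0") (simp_all add: Suc fun_eq_iff)
qed auto

lemma higher_deriv_ident_mult:
  assumes "f holomorphic_on S" "open S" "0 \<in> S"
  shows "(deriv ^^ Suc n) (\<lambda>z::complex. z * f z) 0 = of_nat (Suc n) * (deriv ^^ n) f 0"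
proof -
  have "(deriv ^^ Suc n) (\<lambda>z. z * f z) 0 =
     (\<Sum>i=0..Suc n. of_nat (Suc n choose i) * (deriv ^^ i) (\<lambda>z. z) 0 * (deriv ^^ (Suc n - i)) f 0)"
    using assms by (intro higher_deriv_mult[where S = S]) (auto intro: holomorphic_intros)
  also have "\<dots> = (\<Sum>i\<in>{1}. of_nat (Suc n choose i) * (deriv ^^ i) (\<lambda>z. z) 0 * (deriv ^^ (Suc n - i)) f 0)"
    unfolding higher_deriv_ident' by (intro sum.mono_neutral_right) auto
  finally show ?thesis by (simp add: higher_deriv_ident')
qed

text \<open>Differentiating \<open>bern_gen z * (exp z - 1) = z\<close> at 0, one time more than \<open>n\<close>, by Leibniz' rule yields the recurrence that defines the Bernoulli numbers.\<close>

lemma higher_deriv_bern_gen: "(deriv ^^ n) bern_gen 0 = of_real (bernoulli n)"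
proof (induction n rule: less_induct)
  case (less n)
  show ?case
  proof (cases n)
    case 0
    then show ?thesis by (simp add: bern_gen_def expm1_quot_def)
  next
    case (Suc m)
    let ?b = "\<lambda>n. (deriv ^^ n) bern_gen 0"
    have holo: "(\<lambda>z. exp z - 1) holomorphic_on ball (0::complex) (2 * pi)"
      by (intro holomorphic_intros)
    have d: "(deriv ^^ i) (\<lambda>z. exp z - 1) 0 = (if i = 0 then 0 else 1 :: complex)" for i
    proof -
      have "(deriv ^^ i) (\<lambda>z. exp z - 1) 0 = (deriv ^^ i) (\<lambda>z. exp (1 * z)) 0 - (deriv ^^ i) (\<lambda>z. 1 :: complex) 0"
        using higher_deriv_diff[of "\<lambda>z. exp (1 * z)" UNIV "\<lambda>z. 1" 0 i] by (simp add: holomorphic_intros)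
      also have "\<dots> = (if i = 0 then 0 else 1)"
        unfolding higher_deriv_exp_linear by (simp add: higher_deriv_const)
      finally show ?thesis .
    qed
    have "0 = (deriv ^^ (n + 1)) (\<lambda>z::complex. z) 0"
      by (simp only: higher_deriv_ident') (simp add: Suc)
    also have "\<dots> = (deriv ^^ (n + 1)) (\<lambda>z. bern_gen z * (exp z - 1)) 0"
      by (rule higher_deriv_transform_within_open[where S = "ball 0 (2 * pi)"])
         (auto intro!: holomorphic_intros bern_gen_holomorphic simp: bern_gen_mult_exp)
    also have "\<dots> = (\<Sum>i=0..n+1. of_nat (n + 1 choose i) * ?b i * (deriv ^^ (n + 1 - i)) (\<lambda>z. exp z - 1) 0)"
      by (rule higher_deriv_mult[OF bern_gen_holomorphic holo]) auto
    also have "\<dots> = (\<Sum>i=0..n. of_nat (n + 1 choose i) * ?b i)"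
      unfolding d by (simp add: sum.atLeast0_atMost_Suc)
    also have "\<dots> = (\<Sum>i\<le>m. of_nat (m + 2 choose i) * of_real (bernoulli i)) + of_nat (m + 2) * ?b n"
      using less Suc by (simp add: sum.atLeast0_atMost_Suc atMost_atLeast0 del: binomial_Suc_Suc)
    finally have eq: "0 = (\<Sum>i\<le>m. of_nat (m + 2 choose i) * of_real (bernoulli i)) + of_nat (m + 2) * ?b n" .
    have solve: "0 = A + C * B \<Longrightarrow> C \<noteq> 0 \<Longrightarrow> B = - A / C" for A B C :: complex
      by (simp add: field_simps eq_neg_iff_add_eq_0 add.commute)
    have "?b n = - (\<Sum>i\<le>m. of_nat (m + 2 choose i) * of_real (bernoulli i)) / of_nat (m + 2)"
      by (rule solve[OF eq]) (metis add_2_eq_Suc' of_nat_neq_0)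
    then show ?thesis by (simp add: Suc del: binomial_Suc_Suc)
  qed
qed

lemma bern_gen_exp_holomorphic: "(\<lambda>z. exp (x * z) * bern_gen z) holomorphic_on ball 0 (2 * pi)"
  by (intro holomorphic_intros bern_gen_holomorphic)

lemma higher_deriv_bern_gen_exp: "(deriv ^^ n) (\<lambda>z. exp (x * z) * bern_gen z) 0 = bernc n x"
proof -
  have "(deriv ^^ n) (\<lambda>z. exp (x * z) * bern_gen z) 0 =
     (\<Sum>i=0..n. of_nat (n choose i) * (deriv ^^ i) (\<lambda>z. exp (x * z)) 0 * (deriv ^^ (n - i)) bern_gen 0)"
    by (intro higher_deriv_mult[OF _ bern_gen_holomorphic] holomorphic_intros) auto
  then show ?thesis
    unfolding higher_deriv_exp_linear higher_deriv_bern_gen bernc_def atMost_atLeast0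
    by (simp add: algebra_simps)
qed

text \<open>The generating functions of the two sides agree, because \<open>exp z - 1\<close> cancels the denominator.\<close>

lemma bernc_diff: "bernc n (x + 1) - bernc n x = of_nat n * x ^ (n - 1)"
proof -
  let ?B = "ball 0 (2 * pi) :: complex set"
  have "bernc n (x + 1) - bernc n x =
     (deriv ^^ n) (\<lambda>z. exp ((x + 1) * z) * bern_gen z - exp (x * z) * bern_gen z) 0"
    unfolding higher_deriv_bern_gen_exp[symmetric]
    by (rule higher_deriv_diff[OF bern_gen_exp_holomorphic bern_gen_exp_holomorphic, symmetric]) auto
  also have "\<dots> = (deriv ^^ n) (\<lambda>z. z * exp (x * z)) 0"
  proof (rule higher_deriv_transform_within_open[where S = ?B])
    fix z :: complex assume z: "z \<in> ?B"
    have "exp ((x + 1) * z) * bern_gen z - exp (x * z) * bern_gen z = exp (x * z) * (bern_gen z * (exp z - 1))"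
      by (simp add: ring_distribs exp_add algebra_simps)
    then show "exp ((x + 1) * z) * bern_gen z - exp (x * z) * bern_gen z = z * exp (x * z)"
      using bern_gen_mult_exp[OF z] by simp
  qed (auto intro!: holomorphic_intros bern_gen_holomorphic)
  also have "\<dots> = of_nat n * x ^ (n - 1)"
  proof (cases n)
    case (Suc m)
    have "(deriv ^^ Suc m) (\<lambda>z. z * exp (x * z)) 0 = of_nat (Suc m) * (deriv ^^ m) (\<lambda>z. exp (x * z)) 0"
      by (rule higher_deriv_ident_mult[where S = UNIV]) (auto intro!: holomorphic_intros)
    then show ?thesis by (simp add: Suc higher_deriv_exp_linear del: funpow.simps)
  qed auto
  finally show ?thesis .
qed

text \<open>The generating function at \<open>1 - x\<close> and \<open>z\<close> is that at \<open>x\<close> and \<open>-z\<close>.\<close>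

lemma bernc_reflect: "bernc n (1 - x) = (-1) ^ n * bernc n x"
proof -
  let ?B = "ball 0 (2 * pi) :: complex set"
  have "bernc n (1 - x) = (deriv ^^ n) (\<lambda>z. exp (x * (- 1 * z)) * bern_gen (- 1 * z)) 0"
    unfolding higher_deriv_bern_gen_exp[symmetric]
  proof (rule higher_deriv_transform_within_open[where S = ?B])
    fix z :: complex assume z: "z \<in> ?B"
    show "exp ((1 - x) * z) * bern_gen z = exp (x * (- 1 * z)) * bern_gen (- 1 * z)"
    proof (cases "z = 0")
      case False
      then have "exp z \<noteq> 1" using exp_eq_1_ball[OF z] by auto
      then have "exp z - 1 \<noteq> 0" "1 - exp z \<noteq> 0" by auto
      then show ?thesis
        using False by (simp add: bern_gen_def expm1_quot_def exp_diff exp_minus ring_distribs field_simps)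
    qed (simp add: bern_gen_def expm1_quot_def)
  next
    have "(\<lambda>z. bern_gen (- 1 * z)) holomorphic_on ?B"
      by (rule holomorphic_on_compose_gen[OF _ bern_gen_holomorphic, unfolded o_def]) (auto intro!: holomorphic_intros)
    then show "(\<lambda>z. exp (x * (- 1 * z)) * bern_gen (- 1 * z)) holomorphic_on ?B"
      by (intro holomorphic_intros)
  qed (auto intro!: holomorphic_intros bern_gen_holomorphic)
  also have "\<dots> = (-1) ^ n * (deriv ^^ n) (\<lambda>z. exp (x * z) * bern_gen z) (- 1 * 0)"
    by (rule higher_deriv_compose_linear[OF bern_gen_exp_holomorphic, where S = ?B]) auto
  finally show ?thesis by (simp add: higher_deriv_bern_gen_exp)
qed

lemma bernc_half_odd: "odd n \<Longrightarrow> bernc n (1/2) = 0"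
  using bernc_reflect[of n "1/2"] by simp

lemma bernc_has_deriv: "(bernc (Suc n) has_field_derivative of_nat (Suc n) * bernc n x) (at x)"
proof -
  have "(bernc (Suc n) has_field_derivative
     (\<Sum>k\<le>Suc n. of_nat (Suc n choose k) * of_real (bernoulli (Suc n - k)) * (of_nat k * x ^ (k - 1)))) (at x)"
    unfolding bernc_def[abs_def] by (rule DERIV_sum) (auto intro!: derivative_eq_intros)
  also have "(\<Sum>k\<le>Suc n. of_nat (Suc n choose k) * of_real (bernoulli (Suc n - k)) * (of_nat k * x ^ (k - 1))) =
     (\<Sum>k\<le>n. of_nat (Suc n choose Suc k) * of_real (bernoulli (n - k)) * (of_nat (Suc k) * x ^ k))"
    by (subst sum.atMost_Suc_shift) (simp del: binomial_Suc_Suc of_nat_Suc)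
  also have "\<dots> = of_nat (Suc n) * bernc n x"
  proof -
    have "of_nat (Suc n choose Suc k) * of_nat (Suc k) = (of_nat (Suc n) * of_nat (n choose k) :: complex)" for k
      using Suc_times_binomial_eq[of n k] by (metis of_nat_mult)
    then show ?thesis
      unfolding bernc_def sum_distrib_left by (intro sum.cong refl) (metis (no_types, lifting) mult.assoc mult.commute)
  qed
  finally show ?thesis .
qed

text \<open>The regular part of \<open>exp (x * t) / (exp t - 1)\<close> at its pole \<open>t = 0\<close>. The value at 0 is the one that
  makes it continuous.\<close>

definition bern_rest :: "complex \<Rightarrow> complex \<Rightarrow> complex" where
  "bern_rest x t = (if t = 0 then bernc 1 x else (exp (x * t) * bern_gen t - 1) / t)"

lemma bern_rest_holomorphic: "bern_rest x holomorphic_on ball 0 (2 * pi)"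
proof -
  let ?f = "\<lambda>z. exp (x * z) * bern_gen z"
  have "(\<lambda>z. if z = 0 then deriv ?f 0 else (?f z - ?f 0) / (z - 0)) holomorphic_on ball 0 (2 * pi)"
    by (rule pole_lemma[OF bern_gen_exp_holomorphic]) auto
  moreover have "deriv ?f 0 = bernc 1 x"
    using higher_deriv_bern_gen_exp[of 1 x] by simp
  ultimately show ?thesis
    by (simp add: bern_rest_def[abs_def] bern_gen_def expm1_quot_def cong: if_cong)
qed

lemma bern_rest_eq:
  assumes "t \<in> ball 0 (2 * pi)" "t \<noteq> 0"
  shows "exp (x * t) / (exp t - 1) = 1 / t + bern_rest x t"
proof -
  have "exp t - 1 \<noteq> 0" using assms exp_eq_1_ball[OF assms(1)] by auto
  then show ?thesis
    using assms(2) unfolding bern_rest_def bern_gen_def expm1_quot_def by (simp add: divide_simps)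
qed

lemma higher_deriv_bern_rest: "(deriv ^^ k) (bern_rest x) 0 = bernc (Suc k) x / of_nat (Suc k)"
proof -
  let ?B = "ball 0 (2 * pi) :: complex set"
  have "bernc (Suc k) x = (deriv ^^ Suc k) (\<lambda>t. 1 + t * bern_rest x t) 0"
    unfolding higher_deriv_bern_gen_exp[symmetric]
  proof (rule higher_deriv_transform_within_open[where S = ?B])
    show "(\<lambda>t. 1 + t * bern_rest x t) holomorphic_on ?B"
      by (intro holomorphic_intros bern_rest_holomorphic)
  next
    show "exp (x * t) * bern_gen t = 1 + t * bern_rest x t" for t
      by (simp add: bern_rest_def bern_gen_def expm1_quot_def)
  qed (auto intro!: holomorphic_intros bern_gen_holomorphic)
  also have "\<dots> = (deriv ^^ Suc k) (\<lambda>t. 1) 0 + (deriv ^^ Suc k) (\<lambda>t. t * bern_rest x t) 0"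
    by (rule higher_deriv_add[where S = ?B]) (auto intro!: holomorphic_intros bern_rest_holomorphic)
  also have "\<dots> = of_nat (Suc k) * (deriv ^^ k) (bern_rest x) 0"
  proof -
    have "(deriv ^^ Suc k) (\<lambda>t. 1) (0::complex) = (0 :: complex)"
      by (simp only: higher_deriv_const) simp
    then show ?thesis
      using higher_deriv_ident_mult[OF bern_rest_holomorphic, of k x] by simp
  qed
  finally show ?thesis by (simp del: of_nat_Suc)
qed

section \<open>Stirling numbers and Bernoulli polynomials\<close>

text \<open>The falling factorial \<open>x (x - 1) \<dots> (x - k + 1)\<close>.\<close>

definition falling_poly :: "nat \<Rightarrow> complex poly" where
  "falling_poly k = (\<Prod>i<k. [:- of_nat i, 1:])"

lemma falling_poly_Suc: "falling_poly (Suc k) = falling_poly k * [:- of_nat k, 1:]"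
  by (simp add: falling_poly_def)

lemma poly_falling_Suc: "poly (falling_poly (Suc k)) x = x * poly (falling_poly k) (x - 1)"
proof (induction k)
  case (Suc k)
  have "poly (falling_poly (Suc (Suc k))) x = poly (falling_poly (Suc k)) x * (x - of_nat (Suc k))"
    by (subst falling_poly_Suc) (simp add: algebra_simps)
  also have "\<dots> = x * (poly (falling_poly k) (x - 1) * ((x - 1) - of_nat k))"
    by (simp only: Suc mult.assoc) simp
  also have "poly (falling_poly k) (x - 1) * ((x - 1) - of_nat k) = poly (falling_poly (Suc k)) (x - 1)"
    by (simp only: falling_poly_Suc poly_mult poly_pCons poly_0) (simp add: algebra_simps)
  finally show ?case .
qed (simp add: falling_poly_def)

lemma falling_poly_diff:
  "poly (falling_poly (Suc k)) (x + 1) - poly (falling_poly (Suc k)) x = of_nat (Suc k) * poly (falling_poly k) x"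
proof -
  have "poly (falling_poly (Suc k)) (x + 1) = (x + 1) * poly (falling_poly k) x"
    by (simp add: poly_falling_Suc)
  then show ?thesis by (simp add: falling_poly_Suc algebra_simps)
qed

lemma pderiv_falling_poly_0: "poly (pderiv (falling_poly (Suc k))) 0 = (-1) ^ k * fact k"
proof (induction k)
  case 0
  show ?case by (simp add: falling_poly_def pderiv_pCons)
next
  case (Suc k)
  have "poly (falling_poly (Suc k)) 0 = 0" by (simp add: poly_falling_Suc)
  then show ?case
    using Suc unfolding falling_poly_Suc[of "Suc k"] pderiv_mult
    by (simp add: pderiv_pCons algebra_simps)
qed

lemma power_eq_sum_stirling:
  "(x - of_real \<alpha>) ^ n = (\<Sum>k\<le>n. noncentral_stirling \<alpha> n k *\<^sub>R poly (falling_poly k) x)"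
proof (induction n)
  case 0
  show ?case by (simp add: falling_poly_def)
next
  case (Suc n)
  have "(x - of_real \<alpha>) ^ Suc n =
     (\<Sum>k\<le>n. noncentral_stirling \<alpha> n k *\<^sub>R ((x - of_real \<alpha>) * poly (falling_poly k) x))"
    by (simp add: Suc sum_distrib_left)
  also have "\<dots> = (\<Sum>k\<le>n. noncentral_stirling \<alpha> n k *\<^sub>R
       (poly (falling_poly (Suc k)) x + (real k - \<alpha>) *\<^sub>R poly (falling_poly k) x))"
    by (intro sum.cong refl arg_cong2[where f = scaleR])
       (simp add: falling_poly_Suc scaleR_conv_of_real algebra_simps)
  also have "\<dots> = (\<Sum>k\<le>Suc n. noncentral_stirling \<alpha> (Suc n) k *\<^sub>R poly (falling_poly k) x)"
    by (rule sum_stirling_Suc[symmetric])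
  finally show ?case .
qed

text \<open>Two polynomials have the forward difference \<open>(x - \<alpha>)\<^sup>N\<close>: the one built from \<open>B\<^sub>N\<^sub>+\<^sub>1(x - \<alpha>)\<close>, and the one obtained
  by expanding \<open>(x - \<alpha>)\<^sup>N\<close> into falling factorials and summing each of them. They differ by a constant,
  so their derivatives at 0 agree. These derivatives are the two sides.\<close>

lemma bernc_eq_sum_stirling:
  "bernc N (- of_real \<alpha>) = (\<Sum>k\<le>N. noncentral_stirling \<alpha> N k *\<^sub>R ((-1) ^ k * fact k / of_nat (Suc k)))"
proof -
  define P :: "complex poly" where "P = (\<Sum>k\<le>N. Polynomial.smult (of_real (noncentral_stirling \<alpha> N k) / of_nat (Suc k)) (falling_poly (Suc k)))"
  define B :: "complex poly" where "B = (\<Sum>k\<le>Suc N. Polynomial.monom (of_nat (Suc N choose k) * of_real (bernoulli (Suc N - k))) k)"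
  define Q where "Q = Polynomial.smult (1 / of_nat (Suc N)) (pcompose B [:- of_real \<alpha>, 1:])"
  have B: "poly B x = bernc (Suc N) x" for x
    by (simp only: B_def bernc_def poly_sum poly_monom)
  have Q: "poly Q x = bernc (Suc N) (x - of_real \<alpha>) / of_nat (Suc N)" for x
    by (simp add: Q_def poly_pcompose B)
  have dP: "poly P (x + 1) - poly P x = (x - of_real \<alpha>) ^ N" for x
  proof -
    have "poly P (x + 1) - poly P x = (\<Sum>k\<le>N. of_real (noncentral_stirling \<alpha> N k) / of_nat (Suc k) *
        (poly (falling_poly (Suc k)) (x + 1) - poly (falling_poly (Suc k)) x))"
      by (simp add: P_def poly_sum sum_subtractf[symmetric] algebra_simps del: of_nat_Suc)
    also have "\<dots> = (\<Sum>k\<le>N. of_real (noncentral_stirling \<alpha> N k) * poly (falling_poly k) x)"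
      unfolding falling_poly_diff by (intro sum.cong refl) (simp del: of_nat_Suc)
    finally show ?thesis
      by (simp add: power_eq_sum_stirling[of x \<alpha> N] scaleR_conv_of_real)
  qed
  have dQ: "poly Q (x + 1) - poly Q x = (x - of_real \<alpha>) ^ N" for x
  proof -
    have "bernc (Suc N) (x + 1 - of_real \<alpha>) - bernc (Suc N) (x - of_real \<alpha>) =
       of_nat (Suc N) * (x - of_real \<alpha>) ^ N"
      using bernc_diff[of "Suc N" "x - of_real \<alpha>"] by (simp add: algebra_simps)
    then show ?thesis
      unfolding Q by (simp del: of_nat_Suc add: diff_divide_distrib[symmetric])
  qed
  \<comment> \<open>This vanishes at all natural numbers, by induction along the differences.\<close>
  define D where "D = P - Q - [:poly P 0 - poly Q 0:]"
  have "poly D (of_nat n) = 0" for n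
  proof (induction n)
    case (Suc n)
    have "poly D (of_nat (Suc n)) = poly D (of_nat n) +
       ((poly P (of_nat n + 1) - poly P (of_nat n)) - (poly Q (of_nat n + 1) - poly Q (of_nat n)))"
      by (simp add: D_def algebra_simps)
    then show ?case by (simp only: dP dQ Suc) simp
  qed (simp add: D_def)
  then have "range of_nat \<subseteq> {x. poly D x = 0}" by auto
  moreover have "infinite (range (of_nat :: nat \<Rightarrow> complex))"
    by (simp add: range_inj_infinite inj_of_nat)
  ultimately have "D = 0"
    using poly_roots_finite finite_subset by blast
  then have "P = Q + [:poly P 0 - poly Q 0:]" by (simp add: D_def algebra_simps)
  then have "poly (pderiv P) 0 = poly (pderiv (Q + [:poly P 0 - poly Q 0:])) 0" by simp
  also have "\<dots> = poly (pderiv Q) 0" by (simp add: pderiv_add pderiv_pCons)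
  also have "\<dots> = bernc N (- of_real \<alpha>)"
  proof (rule DERIV_unique)
    show "(poly Q has_field_derivative poly (pderiv Q) 0) (at 0)" by (rule poly_DERIV)
    have "((\<lambda>x. bernc (Suc N) (x - of_real \<alpha>)) has_field_derivative
        of_nat (Suc N) * bernc N (0 - of_real \<alpha>) * 1) (at 0)"
      by (rule DERIV_chain2[OF bernc_has_deriv]) (auto intro!: derivative_eq_intros)
    then have "((\<lambda>x. bernc (Suc N) (x - of_real \<alpha>) / of_nat (Suc N)) has_field_derivative
        of_nat (Suc N) * bernc N (0 - of_real \<alpha>) * 1 / of_nat (Suc N)) (at 0)"
      by (rule DERIV_cdivide)
    then show "(poly Q has_field_derivative bernc N (- of_real \<alpha>)) (at 0)"
      unfolding Q[abs_def, symmetric] by (simp del: of_nat_Suc)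
  qed
  also have "pderiv P = (\<Sum>k\<le>N. pderiv (Polynomial.smult (of_real (noncentral_stirling \<alpha> N k) / of_nat (Suc k)) (falling_poly (Suc k))))"
    unfolding P_def by (rule sum_comp_morphism[symmetric, unfolded o_def]) (simp_all add: pderiv_add)
  also have "poly \<dots> 0 = (\<Sum>k\<le>N. noncentral_stirling \<alpha> N k *\<^sub>R ((-1) ^ k * fact k / of_nat (Suc k)))"
    by (simp add: pderiv_smult poly_sum pderiv_falling_poly_0 scaleR_conv_of_real del: of_nat_Suc)
  finally show ?thesis by simp
qed


section \<open>The generating function of a character\<close>

text \<open>The function \<open>f = 1 / (exp z - 1)\<close> satisfies \<open>f' = -(f + f\<^sup>2)\<close>, so its derivatives are polynomials in
  \<open>f\<close> itself. This makes conjugation, reflection and decay of all derivatives algebraic facts.\<close>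

fun bose_poly :: "nat \<Rightarrow> complex poly" where
  "bose_poly 0 = [:0, 1:]"
| "bose_poly (Suc k) = - pderiv (bose_poly k) * [:0, 1, 1:]"

definition bose :: "nat \<Rightarrow> complex \<Rightarrow> complex" where
  "bose k z = poly (bose_poly k) (1 / (exp z - 1))"

lemma bose_0: "bose 0 z = 1 / (exp z - 1)"
  by (simp add: bose_def)

lemma bose_has_deriv:
  assumes "exp z \<noteq> 1"
  shows "(bose k has_field_derivative bose (Suc k) z) (at z)"
proof -
  define w where "w = 1 / (exp z - 1)"
  have nz: "exp z - 1 \<noteq> 0" using assms by auto
  have "((\<lambda>z. 1 / (exp z - 1)) has_field_derivative - (w + w\<^sup>2)) (at z)"
  proof -
    define e where "e = exp z - 1"
    have "exp z = e + 1" by (simp add: e_def)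
    then have "- exp z / e\<^sup>2 = - (w + w\<^sup>2)"
      using nz by (simp add: w_def e_def[symmetric] power2_eq_square diff_divide_distrib)
    then show ?thesis
      using nz by (auto intro!: derivative_eq_intros simp: e_def power2_eq_square)
  qed
  then have "((\<lambda>z. poly (bose_poly k) (1 / (exp z - 1))) has_field_derivative
      poly (pderiv (bose_poly k)) (1 / (exp z - 1)) * - (w + w\<^sup>2)) (at z)"
    by (rule DERIV_chain2[OF poly_DERIV])
  also have "poly (pderiv (bose_poly k)) (1 / (exp z - 1)) * - (w + w\<^sup>2) = bose (Suc k) z"
    unfolding bose_def w_def[symmetric] by (simp add: power2_eq_square algebra_simps)
  finally show ?thesis
    by (simp add: bose_def[abs_def])
qed

lemma bose_periodic: "bose k (z + 2 * of_real pi * \<i>) = bose k z"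
  by (simp add: bose_def exp_add)

lemma bose_poly_real: "Polynomial.coeff (bose_poly k) i \<in> \<real>"
proof (induction k arbitrary: i)
  case 0
  show ?case by (auto simp: coeff_pCons split: nat.split)
next
  case (Suc k)
  have "Polynomial.coeff [:0, 1, 1:] j \<in> (\<real> :: complex set)" for j
    by (auto simp: coeff_pCons split: nat.split)
  with Suc show ?case
    by (auto simp: coeff_mult coeff_pderiv simp del: mult_pCons_right intro!: sum_in_Reals Reals_mult)
qed

lemma bose_cnj: "bose k (cnj z) = cnj (bose k z)"
proof -
  have "cnj (poly (bose_poly k) (1 / (exp z - 1))) = poly (bose_poly k) (cnj (1 / (exp z - 1)))"
    by (rule poly_cnj_real) (rule bose_poly_real)
  then show ?thesis by (simp add: bose_def exp_cnj)
qed

text \<open>The substitution \<open>w \<mapsto> -1 - w\<close> is what \<open>z \<mapsto> -z\<close> does to \<open>w = 1 / (exp z - 1)\<close>. It leaves \<open>w + w\<^sup>2\<close>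
  unchanged, which makes the induction work.\<close>

lemma bose_poly_reflect:
  "pcompose (bose_poly k) [:-1, -1:] = Polynomial.smult ((-1) ^ Suc k) (bose_poly k) - (if k = 0 then 1 else 0)"
proof (induction k)
  case 0
  show ?case by (simp add: pcompose_pCons one_pCons)
next
  case (Suc k)
  have "pderiv (pcompose (bose_poly k) [:-1, -1:]) = Polynomial.smult ((-1) ^ Suc k) (pderiv (bose_poly k))"
    unfolding Suc by (cases "k = 0") (simp_all add: pderiv_diff pderiv_smult pderiv_minus pderiv_pCons)
  then have "pcompose (pderiv (bose_poly k)) [:-1, -1:] * [:-1:] = Polynomial.smult ((-1) ^ Suc k) (pderiv (bose_poly k))"
    by (simp add: pderiv_pcompose pderiv_pCons)
  then have e: "pcompose (pderiv (bose_poly k)) [:-1, -1:] = Polynomial.smult ((-1) ^ k) (pderiv (bose_poly k))"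
    by (simp add: minus_equation_iff)
  have "pcompose [:0, 1, 1:] [:-1, -1:] = ([:0, 1, 1:] :: complex poly)"
    by (simp add: pcompose_pCons)
  then show ?case
    by (simp add: pcompose_mult pcompose_uminus e del: mult_pCons_right)
qed

lemma bose_minus:
  assumes "exp z \<noteq> 1"
  shows "bose k (- z) = (-1) ^ Suc k * bose k z - (if k = 0 then 1 else 0)"
proof -
  have "exp z - 1 \<noteq> 0" using assms by auto
  then have w: "1 / (exp (- z) - 1) = - 1 - 1 / (exp z - 1)"
    by (simp add: exp_minus field_simps)
  have "bose k (- z) = poly (pcompose (bose_poly k) [:-1, -1:]) (1 / (exp z - 1))"
    by (simp add: bose_def poly_pcompose w)
  then show ?thesis
    unfolding bose_poly_reflect by (simp add: bose_def)
qed

text \<open>The polynomials have no constant term, and \<open>1 / (exp z - 1)\<close> itself decays.\<close>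

lemma bose_bound: "\<exists>C. \<forall>z. Re z \<ge> 1 \<longrightarrow> cmod (bose k z) \<le> C * exp (- Re z)"
proof -
  have "\<exists>Q. bose_poly k = [:0, 1:] * Q"
  proof (cases k)
    case 0
    then show ?thesis by (intro exI[of _ 1]) simp
  next
    case (Suc j)
    have "bose_poly k = [:0, 1:] * (- pderiv (bose_poly j) * [:1, 1:])"
      by (simp add: Suc)
    then show ?thesis by blast
  qed
  then obtain Q where Q: "bose_poly k = [:0, 1:] * Q" ..
  have "bounded (poly Q ` cball 0 1)"
    by (intro compact_imp_bounded compact_continuous_image continuous_intros) auto
  then obtain C where C: "\<And>w. w \<in> cball 0 1 \<Longrightarrow> cmod (poly Q w) \<le> C"
    unfolding bounded_iff by blast
  have "cmod (bose k z) \<le> 2 * C * exp (- Re z)" if z: "Re z \<ge> 1" for z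
  proof -
    define w where "w = 1 / (exp z - 1)"
    have e2: "exp (Re z) \<ge> 2" using z exp_ge_add_one_self[of "Re z"] by linarith
    have "exp (Re z) / 2 \<le> cmod (exp z) - cmod 1" using e2 by simp
    also have "\<dots> \<le> cmod (exp z - 1)" by (rule norm_triangle_ineq2)
    finally have ge: "exp (Re z) / 2 \<le> cmod (exp z - 1)" .
    have "cmod w = 1 / cmod (exp z - 1)" by (simp add: w_def norm_divide)
    also have "\<dots> \<le> 1 / (exp (Re z) / 2)"
      using ge e2 by (intro divide_left_mono mult_pos_pos) (auto intro: less_le_trans[rotated])
    finally have w: "cmod w \<le> 2 * exp (- Re z)" by (simp add: exp_minus field_simps)
    also have "\<dots> \<le> 1" using e2 by (simp add: exp_minus field_simps)
    finally have "cmod (poly Q w) \<le> C" by (intro C) simp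
    then have "cmod w * cmod (poly Q w) \<le> (2 * exp (- Re z)) * C"
      using w by (intro mult_mono) auto
    moreover have "bose k z = w * poly Q w" by (simp add: bose_def Q w_def)
    ultimately show ?thesis by (simp add: norm_mult mult_ac)
  qed
  then show ?thesis by blast
qed

text \<open>The point \<open>2\<pi>ib/q\<close>; modulo \<open>2\<pi>i\<close>, these points contain all poles of the generating function.\<close>

definition lattice_pt :: "nat \<Rightarrow> nat \<Rightarrow> complex" where
  "lattice_pt q b = 2 * of_real pi * \<i> * of_nat b / of_nat q"

text \<open>The \<open>k\<close>-th derivative of the partial fraction decomposition of \<open>\<Sum>\<chi>(n) exp (-nz)\<close>. Starting from the
  decomposition instead of the series makes the meromorphic continuation, the poles and the residues
  immediate; \<open>F_sums\<close> recovers the series. The index \<open>b = 0\<close> is missing because the corresponding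
  coefficient vanishes when the values of the character sum to zero. So 0 is not a pole, and the
  function is smooth on the real line.\<close>

definition char_gen :: "nat \<Rightarrow> (int \<Rightarrow> complex) \<Rightarrow> nat \<Rightarrow> complex \<Rightarrow> complex" where
  "char_gen q chi k z = (\<Sum>b\<in>{1..<q}. char_coeff q chi (int b) * bose k (z - lattice_pt q b))"

lemma Re_lattice_pt [simp]: "Re (lattice_pt q b) = 0"
  by (simp add: lattice_pt_def)

lemma Im_lattice_pt: "Im (lattice_pt q b) = 2 * pi * real b / real q"
  by (simp add: lattice_pt_def)

lemma exp_lattice_pt: "exp (lattice_pt q b) = add_char q (int b)"
  by (simp add: lattice_pt_def add_char_def)

lemma lattice_pt_reflect:
  assumes "b \<le> q" "q > 0"
  shows "lattice_pt q (q - b) = 2 * of_real pi * \<i> - lattice_pt q b"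
  using assms by (simp add: lattice_pt_def of_nat_diff field_simps)

context balanced_char
begin

abbreviation F where "F \<equiv> char_gen q chi"

text \<open>The points at which no summand of the generating function has a pole.\<close>

definition reg :: "complex \<Rightarrow> bool" where
  "reg z \<longleftrightarrow> (\<forall>b\<in>{1..<q}. exp (z - lattice_pt q b) \<noteq> 1)"

lemma regI:
  assumes "\<And>b n. b \<in> {1..<q} \<Longrightarrow> z \<noteq> lattice_pt q b + 2 * of_real pi * \<i> * of_int n"
  shows "reg z"
  unfolding reg_def
proof (intro ballI notI)
  fix b assume b: "b \<in> {1..<q}" and "exp (z - lattice_pt q b) = 1"
  then obtain n :: int where "Re (z - lattice_pt q b) = 0" "Im (z - lattice_pt q b) = of_int (2 * n) * pi"
    unfolding exp_eq_1 by blast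
  then have "z = lattice_pt q b + 2 * of_real pi * \<i> * of_int n"
    by (simp add: complex_eq_iff algebra_simps)
  then show False using assms[OF b] by blast
qed

lemma reg_if_Re: "Re z \<noteq> 0 \<Longrightarrow> reg z"
  by (rule regI) (auto dest!: arg_cong[of _ _ Re])

lemma reg_strip:
  assumes "\<bar>Im z\<bar> < 2 * pi / q"
  shows "reg z"
proof (rule regI)
  fix b :: nat and n :: int
  assume b: "b \<in> {1..<q}"
  show "z \<noteq> lattice_pt q b + 2 * of_real pi * \<i> * of_int n"
  proof
    assume "z = lattice_pt q b + 2 * of_real pi * \<i> * of_int n"
    then have "Im z = 2 * pi / q * of_int (int b + int q * n)"
      using q by (simp add: Im_lattice_pt field_simps)
    then have "2 * pi / q * \<bar>real_of_int (int b + int q * n)\<bar> < 2 * pi / q * 1"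
      using assms q by (simp add: abs_mult)
    then have "\<bar>real_of_int (int b + int q * n)\<bar> < 1"
      using q by (subst (asm) mult_less_cancel_left_pos) auto
    then have "int b = int q * (- n)" by linarith
    then have "int q dvd int b" by simp
    then show False using b by (auto dest: zdvd_imp_le)
  qed
qed

lemma reg_of_real: "reg (of_real x)"
  using q by (intro reg_strip) simp

lemma F_has_deriv:
  assumes "reg z"
  shows "(F k has_field_derivative F (Suc k) z) (at z)"
  unfolding char_gen_def
proof (rule DERIV_sum, rule DERIV_cmult)
  fix b assume b: "b \<in> {1..<q}"
  have "(bose k has_field_derivative bose (Suc k) (z - lattice_pt q b)) (at (z - lattice_pt q b))"
    using assms b by (intro bose_has_deriv) (auto simp: reg_def)
  moreover have "((\<lambda>z. z - lattice_pt q b) has_field_derivative 1) (at z)"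
    by (auto intro!: derivative_eq_intros)
  ultimately show "((\<lambda>z. bose k (z - lattice_pt q b)) has_field_derivative bose (Suc k) (z - lattice_pt q b)) (at z)"
    using DERIV_chain2[of "bose k" "bose (Suc k) (z - lattice_pt q b)" "\<lambda>z. z - lattice_pt q b" z 1 UNIV] by simp
qed

lemma F_periodic: "F k (z + 2 * of_real pi * \<i>) = F k z"
proof -
  have "z + 2 * of_real pi * \<i> - lattice_pt q b = (z - lattice_pt q b) + 2 * of_real pi * \<i>" for b
    by simp
  then show ?thesis by (simp only: char_gen_def bose_periodic)
qed

lemma F_cnj: "cnj (F k z) = char_gen q (cnj_character chi) k (cnj z)"
proof -
  interpret c: balanced_char q "cnj_character chi" by (rule balanced_char_cnj)
  have "cnj (F k z) = (\<Sum>b\<in>{1..<q}. char_coeff q (cnj_character chi) (- int b) * bose k (cnj z - cnj (lattice_pt q b)))"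
    by (simp add: char_gen_def char_coeff_cnj flip: bose_cnj)
  also have "\<dots> = (\<Sum>b\<in>{1..<q}. char_coeff q (cnj_character chi) (int (q - b)) * bose k (cnj z - lattice_pt q (q - b)))"
  proof (intro sum.cong refl arg_cong2[where f = "(*)"])
    fix b assume b: "b \<in> {1..<q}"
    show "char_coeff q (cnj_character chi) (- int b) = char_coeff q (cnj_character chi) (int (q - b))"
      using b by (intro c.char_coeff_cong) (simp add: cong_def of_nat_diff)
    have "cnj (lattice_pt q b) = - lattice_pt q b"
      by (simp add: lattice_pt_def)
    then have "cnj z - cnj (lattice_pt q b) = (cnj z - lattice_pt q (q - b)) + 2 * of_real pi * \<i>"
      using b q by (simp add: lattice_pt_reflect)
    then show "bose k (cnj z - cnj (lattice_pt q b)) = bose k (cnj z - lattice_pt q (q - b))"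
      by (simp only: bose_periodic)
  qed
  also have "\<dots> = (\<Sum>b\<in>{1..<q}. char_coeff q (cnj_character chi) (int b) * bose k (cnj z - lattice_pt q b))"
    by (rule sum.reindex_bij_witness[of _ "\<lambda>b. q - b" "\<lambda>b. q - b"]) auto
  finally show ?thesis by (simp add: char_gen_def)
qed

text \<open>For \<open>k = 0\<close> each summand produces a constant in addition; these cancel because the coefficients sum
  to zero. This is also why the generating function decays towards \<open>-\<infinity>\<close>.\<close>

lemma F_minus:
  assumes "reg z"
  shows "F k (- z) = (-1) ^ Suc k * chi (-1) * F k z"
proof -
  have "F k (- z) = (\<Sum>b\<in>{1..<q}. char_coeff q chi (int (q - b)) * bose k (- z - lattice_pt q (q - b)))"
    unfolding char_gen_def
    by (rule sum.reindex_bij_witness[of _ "\<lambda>b. q - b" "\<lambda>b. q - b"]) auto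
  also have "\<dots> = (\<Sum>b\<in>{1..<q}. (chi (-1) * char_coeff q chi (int b)) *
       ((-1) ^ Suc k * bose k (z - lattice_pt q b) - (if k = 0 then 1 else 0)))"
  proof (intro sum.cong refl arg_cong2[where f = "(*)"])
    fix b assume b: "b \<in> {1..<q}"
    show "char_coeff q chi (int (q - b)) = chi (-1) * char_coeff q chi (int b)"
      using b by (intro char_coeff_reflect) auto
    have "- (z - lattice_pt q b) = (- z - lattice_pt q (q - b)) + 2 * of_real pi * \<i>"
      using b q by (simp add: lattice_pt_reflect)
    then have "bose k (- z - lattice_pt q (q - b)) = bose k (- (z - lattice_pt q b))"
      by (simp only: bose_periodic)
    also have "\<dots> = (-1) ^ Suc k * bose k (z - lattice_pt q b) - (if k = 0 then 1 else 0)"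
      using assms b by (intro bose_minus) (auto simp: reg_def)
    finally show "bose k (- z - lattice_pt q (q - b)) =
      (-1) ^ Suc k * bose k (z - lattice_pt q b) - (if k = 0 then 1 else 0)" .
  qed
  also have "\<dots> = (-1) ^ Suc k * chi (-1) * F k z
       - chi (-1) * (if k = 0 then 1 else 0) * (\<Sum>b\<in>{1..<q}. char_coeff q chi (int b))"
  proof -
    have *: "(x * c) * (s * B - e) = s * x * (c * B) - x * e * c" for x c s B e :: complex
      by (simp add: algebra_simps)
    show ?thesis unfolding char_gen_def * sum_subtractf sum_distrib_left ..
  qed
  finally show ?thesis by (simp only: sum_char_coeff mult_zero_right diff_zero)
qed

lemma F_bound: "\<exists>C. \<forall>z. \<bar>Re z\<bar> \<ge> 1 \<longrightarrow> cmod (F k z) \<le> C * exp (- \<bar>Re z\<bar>)"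
proof -
  obtain C where C: "\<And>z. Re z \<ge> 1 \<Longrightarrow> cmod (bose k z) \<le> C * exp (- Re z)"
    using bose_bound by blast
  define D where "D = (\<Sum>b\<in>{1..<q}. cmod (char_coeff q chi (int b)) * C)"
  have right: "cmod (F k z) \<le> D * exp (- Re z)" if "Re z \<ge> 1" for z
  proof -
    have "cmod (F k z) \<le> (\<Sum>b\<in>{1..<q}. cmod (char_coeff q chi (int b)) * (C * exp (- Re z)))"
      unfolding char_gen_def norm_mult[symmetric]
    proof (rule sum_norm_le)
      fix b
      show "norm (char_coeff q chi (int b) * bose k (z - lattice_pt q b)) \<le>
        cmod (char_coeff q chi (int b)) * (C * exp (- Re z))"
        using C[of "z - lattice_pt q b"] that by (simp add: norm_mult mult_left_mono)
    qed
    then show ?thesis by (simp add: D_def sum_distrib_right mult.assoc)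
  qed
  have "cmod (F k z) \<le> D * exp (- \<bar>Re z\<bar>)" if z: "\<bar>Re z\<bar> \<ge> 1" for z
  proof (cases "Re z \<ge> 1")
    case True
    then show ?thesis using right[of z] by simp
  next
    case False
    then have "Re (- z) \<ge> 1" using z by simp
    moreover have "F k z = (-1) ^ Suc k * chi (-1) * F k (- z)"
      using F_minus[of "- z" k] reg_if_Re[of "- z"] z by auto
    moreover have "cmod (chi (-1)) = 1" by (rule char_norm) auto
    ultimately show ?thesis using right[of "- z"] by (simp add: norm_mult norm_power)
  qed
  then show ?thesis by blast
qed

text \<open>Each summand is a geometric series, and the sum over \<open>b\<close> is finite Fourier inversion.\<close>

lemma F_sums:
  assumes "x > 0"
  shows "(\<lambda>n. chi (int (Suc n)) * exp (- of_nat (Suc n) * of_real x)) sums F 0 (of_real x)"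
proof -
  have "(\<lambda>n. \<Sum>b\<in>{1..<q}. char_coeff q chi (int b) *
       (add_char q (int b) * exp (- of_real x)) ^ Suc n) sums F 0 (of_real x)"
    unfolding char_gen_def
  proof (intro sums_sum sums_mult)
    fix b
    define w where "w = add_char q (int b) * exp (- complex_of_real x)"
    have w: "w = exp (lattice_pt q b - of_real x)"
      by (simp add: w_def exp_diff exp_minus exp_lattice_pt field_simps)
    have "cmod w < 1"
      using assms by (simp add: w)
    then have "(\<lambda>n. w * w ^ n) sums (w * (1 / (1 - w)))"
      by (intro sums_mult geometric_sums) auto
    moreover have "w * (1 / (1 - w)) = bose 0 (of_real x - lattice_pt q b)"
    proof -
      have "w \<noteq> 0" by (simp add: w)
      moreover have "exp (of_real x - lattice_pt q b) = 1 / w"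
        by (simp add: w exp_diff field_simps)
      moreover have "1 / w - 1 = (1 - w) / w" using \<open>w \<noteq> 0\<close> by (simp add: diff_divide_distrib)
      ultimately show ?thesis by (simp add: bose_0)
    qed
    ultimately show "(\<lambda>n. w ^ Suc n) sums bose 0 (of_real x - lattice_pt q b)"
      by simp
  qed
  also have "(\<lambda>n. \<Sum>b\<in>{1..<q}. char_coeff q chi (int b) * (add_char q (int b) * exp (- of_real x)) ^ Suc n) =
     (\<lambda>n. chi (int (Suc n)) * exp (- of_nat (Suc n) * of_real x))"
  proof
    fix n
    have "(add_char q (int b) * exp (- complex_of_real x)) ^ Suc n =
       add_char q (int b * int (Suc n)) * exp (- of_nat (Suc n) * of_real x)" for b
      unfolding power_mult_distrib add_char_power exp_of_nat_mult[symmetric]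
      by (simp only: mult_minus_right mult_minus_left mult.commute)
    then show "(\<Sum>b\<in>{1..<q}. char_coeff q chi (int b) * (add_char q (int b) * exp (- of_real x)) ^ Suc n) =
      chi (int (Suc n)) * exp (- of_nat (Suc n) * of_real x)"
      using char_coeff_inversion'[of "int (Suc n)"]
      by (simp only: mult.assoc[symmetric] sum_distrib_right[symmetric])
  qed
  finally show ?thesis .
qed

text \<open>Grouping the series by residue classes modulo \<open>q\<close> would give this on the right half plane. The finite
  geometric sum \<open>(1 - v\<^sup>q) / (1 - v)\<close>, with \<open>v\<^sup>q\<close> independent of \<open>b\<close>, proves it wherever the
  denominators do not vanish.\<close>

lemma F_closed_form:
  assumes "exp (- (of_nat q * z)) \<noteq> 1"
  shows "F 0 z = (\<Sum>a=1..q. chi (int a) * (exp (- (of_nat a * z)) / (1 - exp (- (of_nat q * z)))))"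
proof -
  define w where "w = exp (- z)"
  have wpow: "w ^ a = exp (- (of_nat a * z))" for a
    by (simp add: w_def flip: exp_of_nat_mult)
  have nz: "1 - w ^ q \<noteq> 0" using assms by (auto simp: wpow)
  have bose_eq: "bose 0 (z - lattice_pt q b) = (\<Sum>j<q. (add_char q (int b) * w) ^ Suc j) / (1 - w ^ q)" for b
  proof -
    define v where "v = add_char q (int b) * w"
    have "add_char q (int b) ^ q = 1"
      using q by (simp add: add_char_power add_char_eq_1_iff)
    then have vq: "v ^ q = w ^ q" by (simp add: v_def power_mult_distrib)
    have v: "v = exp (lattice_pt q b - z)"
      by (simp add: v_def w_def exp_diff exp_minus exp_lattice_pt field_simps)
    have "1 - v ^ q = (1 - v) * (\<Sum>j<q. v ^ j)" by (rule one_diff_power_eq)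
    then have e: "(1 - v) * (\<Sum>j<q. v ^ j) = 1 - w ^ q" by (simp add: vq)
    have "v \<noteq> 0" "1 - v \<noteq> 0" using nz e v by auto
    moreover have "exp (z - lattice_pt q b) = 1 / v" by (simp add: v exp_diff field_simps)
    moreover have "1 / v - 1 = (1 - v) / v" using \<open>v \<noteq> 0\<close> by (simp add: diff_divide_distrib)
    ultimately have "bose 0 (z - lattice_pt q b) = v / (1 - v)"
      by (simp add: bose_0)
    also have "\<dots> = v * (\<Sum>j<q. v ^ j) / (1 - w ^ q)"
      using \<open>1 - v \<noteq> 0\<close> nz by (simp flip: e)
    finally show ?thesis by (simp add: v_def sum_distrib_left)
  qed
  have "F 0 z = (\<Sum>b\<in>{1..<q}. \<Sum>j<q. char_coeff q chi (int b) * add_char q (int b * int (Suc j)) * w ^ Suc j / (1 - w ^ q))"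
    unfolding char_gen_def bose_eq power_mult_distrib add_char_power
    by (simp add: sum_distrib_left sum_divide_distrib mult_ac)
  also have "\<dots> = (\<Sum>j<q. (\<Sum>b\<in>{1..<q}. char_coeff q chi (int b) * add_char q (int b * int (Suc j))) * (w ^ Suc j / (1 - w ^ q)))"
    by (subst sum.swap) (simp only: sum_distrib_right sum_divide_distrib times_divide_eq_right)
  also have "\<dots> = (\<Sum>j<q. chi (int (Suc j)) * (w ^ Suc j / (1 - w ^ q)))"
    by (simp only: char_coeff_inversion')
  also have "\<dots> = (\<Sum>a=1..q. chi (int a) * (w ^ a / (1 - w ^ q)))"
    by (rule sum.reindex_bij_witness[of _ "\<lambda>a. a - 1" Suc]) auto
  finally show ?thesis by (simp add: wpow)
qed

text \<open>Near the pole \<open>p\<close> with index \<open>b\<close>, the closed form is a combination of the functions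
  \<open>exp (xt) / (exp t - 1)\<close> with \<open>t = -q (z - p)\<close> and \<open>x = a/q\<close>, whose regular parts are known. The argument
  is written as a linear polynomial in \<open>z\<close> to match the rule for derivatives of such compositions.\<close>

definition regular_part :: "nat \<Rightarrow> complex \<Rightarrow> complex" where
  "regular_part b z = - (\<Sum>a=1..q. chi (int a) * add_char q (- (int a * int b)) *
      bern_rest (of_nat a / of_nat q) (- of_nat q * z + of_nat q * lattice_pt q b))"

lemma regular_part_arg:
  assumes "z \<in> ball (lattice_pt q b) (2 * pi / q)"
  shows "- of_nat q * z + of_nat q * lattice_pt q b \<in> ball 0 (2 * pi)"
proof -
  have "- of_nat q * z + of_nat q * lattice_pt q b = of_nat q * (lattice_pt q b - z)"
    by (simp add: algebra_simps)
  then have "cmod (- of_nat q * z + of_nat q * lattice_pt q b) = q * dist (lattice_pt q b) z"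
    by (simp add: norm_mult dist_norm)
  also have "\<dots> < 2 * pi" using assms q by (simp add: field_simps)
  finally show ?thesis by simp
qed

lemma regular_part_holomorphic: "regular_part b holomorphic_on ball (lattice_pt q b) (2 * pi / q)"
  unfolding regular_part_def[abs_def]
proof (intro holomorphic_on_minus holomorphic_on_sum holomorphic_on_mult holomorphic_on_const)
  fix a
  show "(\<lambda>z. bern_rest (of_nat a / of_nat q) (- of_nat q * z + of_nat q * lattice_pt q b)) holomorphic_on
    ball (lattice_pt q b) (2 * pi / q)"
    by (rule holomorphic_on_compose_gen[OF _ bern_rest_holomorphic, unfolded o_def])
       (use regular_part_arg in \<open>auto intro!: holomorphic_intros\<close>)
qed

lemma F_laurent:
  assumes "z \<in> ball (lattice_pt q b) (2 * pi / q)" "z \<noteq> lattice_pt q b"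
  shows "F 0 z = char_coeff q chi (int b) / (z - lattice_pt q b) + regular_part b z"
proof -
  define t where "t = - of_nat q * z + of_nat q * lattice_pt q b"
  have t: "t \<in> ball 0 (2 * pi)" "t \<noteq> 0"
    using regular_part_arg[OF assms(1)] assms(2) q by (auto simp: t_def)
  have et: "exp t - 1 \<noteq> 0" using exp_eq_1_ball[OF t(1)] t(2) by auto
  have qz: "- (of_nat a * z) = of_nat a / of_nat q * t - of_nat a * lattice_pt q b" for a
    using q by (simp add: t_def field_simps)
  have e: "exp (- (of_nat a * z)) = exp (of_nat a / of_nat q * t) * add_char q (- (int a * int b))" for a
  proof -
    have "exp (- (of_nat a * lattice_pt q b)) = add_char q (- (int a * int b))"
      by (simp add: lattice_pt_def add_char_def mult_ac)
    then show ?thesis unfolding qz diff_conv_add_uminus exp_add by simp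
  qed
  have eq: "exp (- (of_nat q * z)) = exp t"
  proof -
    have "add_char q (- (int q * int b)) = 1" using q by (simp add: add_char_eq_1_iff)
    then show ?thesis using e[of q] q by simp
  qed
  have "F 0 z = (\<Sum>a=1..q. chi (int a) * (exp (- (of_nat a * z)) / (1 - exp t)))"
    using F_closed_form[of z] et by (simp add: eq)
  also have "\<dots> = (\<Sum>a=1..q. - (chi (int a) * add_char q (- (int a * int b)) * (1 / t))
       - chi (int a) * add_char q (- (int a * int b)) * bern_rest (of_nat a / of_nat q) t)"
  proof (intro sum.cong refl)
    fix a
    have "exp (- (of_nat a * z)) / (1 - exp t) =
       - add_char q (- (int a * int b)) * (exp (of_nat a / of_nat q * t) / (exp t - 1))"
      using et by (simp add: e divide_simps) (simp add: algebra_simps)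
    also have "\<dots> = - add_char q (- (int a * int b)) * (1 / t + bern_rest (of_nat a / of_nat q) t)"
      by (simp only: bern_rest_eq[OF t])
    finally have *: "exp (- (of_nat a * z)) / (1 - exp t) =
       - add_char q (- (int a * int b)) * (1 / t + bern_rest (of_nat a / of_nat q) t)" .
    show "chi (int a) * (exp (- (of_nat a * z)) / (1 - exp t)) =
       - (chi (int a) * add_char q (- (int a * int b)) * (1 / t))
       - chi (int a) * add_char q (- (int a * int b)) * bern_rest (of_nat a / of_nat q) t"
      unfolding * by (simp add: algebra_simps)
  qed
  also have "\<dots> = - (of_nat q * char_coeff q chi (int b)) * (1 / t) + regular_part b z"
  proof -
    have "of_nat q * char_coeff q chi (int b) = (\<Sum>a=1..q. chi (int a) * add_char q (- (int a * int b)))"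
      using q by (simp add: char_coeff_def)
    then show ?thesis
      unfolding regular_part_def t_def[symmetric] sum_subtractf sum_negf
      by (simp only: sum_distrib_right mult_minus_left diff_conv_add_uminus)
  qed
  also have "- (of_nat q * char_coeff q chi (int b)) * (1 / t) = char_coeff q chi (int b) / (z - lattice_pt q b)"
  proof -
    have "t = - of_nat q * (z - lattice_pt q b)" by (simp add: t_def algebra_simps)
    then show ?thesis using q by (simp add: divide_simps)
  qed
  finally show ?thesis .
qed

text \<open>The derivatives of \<open>bern_rest x\<close> at 0 are Bernoulli polynomials in \<open>x\<close>, up to a factor. So the Taylor
  coefficients of the regular part at its pole are twisted generalised Bernoulli numbers.\<close>

lemma higher_deriv_regular_part:
  "(deriv ^^ k) (regular_part b) (lattice_pt q b) =
     - ((- of_nat q) ^ k / of_nat (Suc k) *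
       (\<Sum>a=1..q. chi (int a) * add_char q (- (int a * int b)) * bernc (Suc k) (of_nat a / of_nat q)))"
proof -
  let ?B = "ball (lattice_pt q b) (2 * pi / q)" and ?p = "lattice_pt q b"
  let ?r = "\<lambda>a z. bern_rest (of_nat a / of_nat q) (- of_nat q * z + of_nat q * ?p)"
  let ?c = "\<lambda>a. chi (int a) * add_char q (- (int a * int b))"
  have pB: "?p \<in> ?B" using q by simp
  have holo: "?r a holomorphic_on ?B" for a
    by (rule holomorphic_on_compose_gen[OF _ bern_rest_holomorphic, unfolded o_def])
       (use regular_part_arg in \<open>auto intro!: holomorphic_intros\<close>)
  have d: "(deriv ^^ k) (?r a) ?p = (- of_nat q) ^ k * (bernc (Suc k) (of_nat a / of_nat q) / of_nat (Suc k))" for a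
  proof -
    have "(deriv ^^ k) (?r a) ?p = (- of_nat q) ^ k * (deriv ^^ k) (bern_rest (of_nat a / of_nat q)) (- of_nat q * ?p + of_nat q * ?p)"
      by (rule higher_deriv_compose_linear'[OF bern_rest_holomorphic, where S = ?B])
         (use pB regular_part_arg in auto)
    then show ?thesis by (simp only: higher_deriv_bern_rest) (simp add: higher_deriv_bern_rest)
  qed
  have s: "(deriv ^^ k) (\<lambda>z. \<Sum>a\<in>A. - ?c a * ?r a z) ?p = (\<Sum>a\<in>A. - ?c a * (deriv ^^ k) (?r a) ?p)"
    if "finite A" for A :: "nat set"
    using that
  proof induction
    case (insert a A)
    have "(deriv ^^ k) (\<lambda>z. - ?c a * ?r a z + (\<Sum>a\<in>A. - ?c a * ?r a z)) ?p =
       (deriv ^^ k) (\<lambda>z. - ?c a * ?r a z) ?p + (deriv ^^ k) (\<lambda>z. \<Sum>a\<in>A. - ?c a * ?r a z) ?p"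
      using pB by (intro higher_deriv_add[where S = ?B] holomorphic_on_sum holomorphic_on_mult holo holomorphic_on_const) auto
    also have "(deriv ^^ k) (\<lambda>z. - ?c a * ?r a z) ?p = - ?c a * (deriv ^^ k) (?r a) ?p"
      using pB by (intro higher_deriv_cmult[where A = ?B] holo) auto
    finally show ?case using insert by simp
  qed (simp add: higher_deriv_const)
  have "regular_part b = (\<lambda>z. \<Sum>a=1..q. - ?c a * ?r a z)"
    by (simp add: regular_part_def fun_eq_iff sum_negf)
  then have "(deriv ^^ k) (regular_part b) ?p = (\<Sum>a=1..q. - ?c a * (deriv ^^ k) (?r a) ?p)"
    by (simp only: s[OF finite_atLeastAtMost])
  also have "\<dots> = - ((- of_nat q) ^ k / of_nat (Suc k) *
       (\<Sum>a=1..q. ?c a * bernc (Suc k) (of_nat a / of_nat q)))"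
    unfolding d sum_distrib_left sum_negf[symmetric] by (intro sum.cong refl) (simp del: of_nat_Suc)
  finally show ?thesis .
qed

end


section \<open>Exponential decay and integrals over the line\<close>

lemma integrable_exp_abs:
  assumes "a > 0"
  shows "integrable lborel (\<lambda>x::real. exp (- (a * \<bar>x\<bar>)))"
proof -
  have "integrable lborel (\<lambda>x. indicator {0<..} x *\<^sub>R exp (- (x * a)))"
    using integrable_I0i_exp_mscale[OF assms] by (simp add: set_integrable_def)
  moreover have "integrable lborel (\<lambda>x. indicator {0<..} (0 + (-1) * x) *\<^sub>R exp (- ((0 + (-1) * x) * a)))"
    by (rule lborel_integrable_real_affine[OF calculation]) simp
  ultimately have "integrable lborel (\<lambda>x. indicator {0<..} x *\<^sub>R exp (- (x * a)) +
      indicator {0<..} (0 + (-1) * x) *\<^sub>R exp (- ((0 + (-1) * x) * a)))"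
    by (rule Bochner_Integration.integrable_add)
  then show ?thesis
  proof (rule integrable_cong_AE_imp)
    have "AE x in lborel. x \<noteq> (0::real)" by (rule AE_lborel_singleton)
    then show "AE x in lborel. indicator {0<..} x *\<^sub>R exp (- (x * a)) +
      indicator {0<..} (0 + (-1) * x) *\<^sub>R exp (- ((0 + (-1) * x) * a)) = exp (- (a * \<bar>x\<bar>))"
      by eventually_elim (auto simp: indicator_def mult.commute)
  qed auto
qed

definition exp_decay :: "(real \<Rightarrow> complex) \<Rightarrow> bool" where
  "exp_decay f \<longleftrightarrow> (\<exists>a>0. \<exists>C. \<forall>x. cmod (f x) \<le> C * exp (- (a * \<bar>x\<bar>)))"

lemma exp_decay_integrable:
  assumes "exp_decay f" "continuous_on UNIV f"
  shows "integrable lborel f"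
proof -
  obtain a C where a: "a > 0" and C: "\<And>x. cmod (f x) \<le> C * exp (- (a * \<bar>x\<bar>))"
    using assms(1) unfolding exp_decay_def by blast
  show ?thesis
  proof (rule Bochner_Integration.integrable_bound)
    show "integrable lborel (\<lambda>x. C * exp (- (a * \<bar>x\<bar>)))"
      using integrable_exp_abs[OF a] by simp
    show "f \<in> borel_measurable lborel"
      using borel_measurable_continuous_onI[OF assms(2)] by simp
    show "AE x in lborel. norm (f x) \<le> norm (C * exp (- (a * \<bar>x\<bar>)))"
      using C by (auto intro!: AE_I2 intro: order_trans[OF C abs_ge_self])
  qed
qed

lemma exp_decay_tendsto:
  assumes "exp_decay f"
  shows "(f \<longlongrightarrow> 0) at_top" "(f \<longlongrightarrow> 0) at_bot"
proof -
  obtain a C where a: "a > 0" and C: "\<And>x. cmod (f x) \<le> C * exp (- (a * \<bar>x\<bar>))"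
    using assms(1) unfolding exp_decay_def by blast
  have top: "((\<lambda>x. C * exp (- (a * x))) \<longlongrightarrow> 0) at_top"
    using a by real_asymp
  have bot: "((\<lambda>x. C * exp (a * x)) \<longlongrightarrow> 0) at_bot"
    using a by real_asymp
  show "(f \<longlongrightarrow> 0) at_top"
  proof (rule Lim_null_comparison[OF _ top])
    show "\<forall>\<^sub>F x in at_top. norm (f x) \<le> C * exp (- (a * x))"
      using eventually_ge_at_top[of 0]
    proof eventually_elim
      case (elim x)
      then show ?case using C[of x] by simp
    qed
  qed
  show "(f \<longlongrightarrow> 0) at_bot"
  proof (rule Lim_null_comparison[OF _ bot])
    show "\<forall>\<^sub>F x in at_bot. norm (f x) \<le> C * exp (a * x)"
      using eventually_le_at_bot[of 0]
    proof eventually_elim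
      case (elim x)
      then show ?case using C[of x] by simp
    qed
  qed
qed

lemma integral_derivative_eq_0:
  fixes G :: "real \<Rightarrow> complex"
  assumes deriv: "\<And>x. (G has_vector_derivative g x) (at x)"
    and cont: "continuous_on UNIV g" and int: "integrable lborel g" and dec: "exp_decay G"
  shows "(LBINT x. g x) = 0"
proof -
  have "(LBINT x=-\<infinity>..\<infinity>. g x) = 0 - 0"
  proof (rule interval_integral_FTC_integrable)
    show "(G has_vector_derivative g x) (at x)" for x by (rule deriv)
    show "isCont g x" for x
      using cont by (simp add: continuous_on_eq_continuous_at)
    show "set_integrable lborel (einterval (-\<infinity>) \<infinity>) g"
      using int by (simp add: set_integrable_def)
    show "((G \<circ> real_of_ereal) \<longlongrightarrow> 0) (at_right (-\<infinity>))" "((G \<circ> real_of_ereal) \<longlongrightarrow> 0) (at_left \<infinity>)"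
      using exp_decay_tendsto[OF dec] by (simp_all add: ereal_tendsto_simps)
  qed simp
  then show ?thesis
    by (simp add: interval_lebesgue_integral_def set_lebesgue_integral_def)
qed

section \<open>Fourier inversion and Parseval's identity\<close>

definition fourier :: "(real \<Rightarrow> complex) \<Rightarrow> real \<Rightarrow> complex" where
  "fourier f t = (LBINT u. f u * exp (\<i> * of_real (t * u)))"

lemma norm_exp_i_of_real [simp]: "cmod (exp (\<i> * of_real x)) = 1"
  by simp

lemma integrable_mult_bounded:
  fixes f g :: "real \<Rightarrow> complex"
  assumes f: "integrable lborel f" and g: "g \<in> borel_measurable lborel" and b: "\<And>x. cmod (g x) \<le> B"
  shows "integrable lborel (\<lambda>x. f x * g x)"
proof (rule Bochner_Integration.integrable_bound)
  show "integrable lborel (\<lambda>x. B * cmod (f x))"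
    using f by (intro integrable_mult_right integrable_norm)
  show "(\<lambda>x. f x * g x) \<in> borel_measurable lborel"
    using f g by measurable
  show "AE x in lborel. norm (f x * g x) \<le> norm (B * cmod (f x))"
  proof (rule AE_I2)
    fix x
    have "cmod (f x) * cmod (g x) \<le> cmod (f x) * B"
      by (intro mult_left_mono b) auto
    then show "norm (f x * g x) \<le> norm (B * cmod (f x))"
      by (simp add: norm_mult mult.commute)
  qed
qed

lemma fourier_integrable:
  assumes "integrable lborel f"
  shows "integrable lborel (\<lambda>u. f u * exp (\<i> * of_real (t * u)))"
  by (rule integrable_mult_bounded[OF assms, of _ 1]) auto

lemma norm_fourier_le: "cmod (fourier f t) \<le> (LBINT u. cmod (f u))"
proof -
  have "cmod (fourier f t) \<le> (LBINT u. cmod (f u * exp (\<i> * of_real (t * u))))"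
    unfolding fourier_def by (rule integral_norm_bound)
  also have "\<dots> = (LBINT u. cmod (f u))"
    by (simp add: norm_mult)
  finally show ?thesis .
qed

lemma cnj_fourier: "cnj (fourier f t) = fourier (\<lambda>u. cnj (f u)) (- t)"
proof -
  have "cnj (fourier f t) = (LBINT u. cnj (f u * exp (\<i> * of_real (t * u))))"
    unfolding fourier_def by (rule Bochner_Integration.integral_cnj[symmetric])
  then show ?thesis by (simp add: fourier_def exp_cnj)
qed

text \<open>Both sides are the double integral of \<open>A t * B u * exp (i c t u)\<close>, by Fubini.\<close>

lemma fourier_exchange:
  assumes A: "integrable lborel A" and B: "integrable lborel B"
  shows "(LBINT t. A t * fourier B (c * t)) = (LBINT u. B u * fourier A (c * u))"
proof -
  have [measurable]: "A \<in> borel_measurable lborel" "B \<in> borel_measurable lborel"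
    using A B by auto
  let ?h = "\<lambda>t u. A t * B u * exp (\<i> * of_real (c * t * u))"
  have "(LBINT t. A t * fourier B (c * t)) = (LBINT t. LBINT u. ?h t u)"
    unfolding fourier_def by (subst integral_mult_right_zero[symmetric]) (simp add: mult_ac)
  also have "\<dots> = (LBINT u. LBINT t. ?h t u)"
  proof (rule lborel_pair.Fubini_integral[symmetric], rule lborel_pair.Fubini_integrable)
    show "case_prod ?h \<in> borel_measurable (lborel \<Otimes>\<^sub>M lborel)" by measurable
    show "integrable lborel (\<lambda>t. LBINT u. norm (case_prod ?h (t, u)))"
      using A B by (simp add: norm_mult)
    show "AE t in lborel. integrable lborel (\<lambda>u. case_prod ?h (t, u))"
    proof (rule AE_I2)
      fix t
      have "integrable lborel (\<lambda>u. A t * (B u * exp (\<i> * of_real ((c * t) * u))))"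
        by (intro integrable_mult_right fourier_integrable B)
      then show "integrable lborel (\<lambda>u. case_prod ?h (t, u))" by (simp add: mult_ac)
    qed
  qed
  also have "\<dots> = (LBINT u. B u * fourier A (c * u))"
    unfolding fourier_def by (subst integral_mult_right_zero[symmetric]) (simp add: mult_ac)
  finally show ?thesis .
qed

lemma fourier_std_normal:
  "fourier (\<lambda>x. of_real (std_normal_density x)) s = of_real (exp (- s\<^sup>2 / 2))"
proof -
  have "char std_normal_distribution s = (CLINT x|std_normal_distribution. iexp (s * x))"
    by (simp add: char_def)
  also have "\<dots> = (LBINT x. std_normal_density x *\<^sub>R iexp (s * x))"
    by (rule integral_density) auto
  also have "\<dots> = fourier (\<lambda>x. of_real (std_normal_density x)) s"
    by (simp add: fourier_def scaleR_conv_of_real)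
  finally show ?thesis
    by (simp add: char_std_normal_distribution)
qed

text \<open>Damp the outer integral by the Gaussian \<open>exp (-(t/n)\<^sup>2/2)\<close>. Moving the Fourier transform to the Gaussian
  turns the damped integral into the average of \<open>f\<close> over a Gaussian of width \<open>1/n\<close> around \<open>u\<close>. As \<open>n\<close> grows,
  dominated convergence yields the inversion integral on one side and \<open>2\<pi> f u\<close> on the other.\<close>

lemma fourier_inversion:
  fixes f :: "real \<Rightarrow> complex"
  assumes cont: "continuous_on UNIV f" and bdd: "\<And>u. cmod (f u) \<le> B"
    and int: "integrable lborel f" and intf: "integrable lborel (fourier f)"
  shows "fourier (fourier f) (- u) = of_real (2 * pi) * f u"
proof -
  let ?\<phi> = "\<lambda>x. complex_of_real (std_normal_density x)"
  have [measurable]: "f \<in> borel_measurable lborel" "fourier f \<in> borel_measurable lborel"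
    using int intf by auto
  \<comment> \<open>The width parameter; the successor keeps it positive.\<close>
  define c where "c n = real (Suc n)" for n
  have c: "c n > 0" for n by (simp add: c_def)
  have c0: "(\<lambda>n. 1 / c n) \<longlonglongrightarrow> 0"
    unfolding c_def using LIMSEQ_inverse_real_of_nat by (simp add: inverse_eq_divide)
  define m where "m n t = exp (- (\<i> * of_real (u * t))) * of_real (exp (- (t / c n)\<^sup>2 / 2))" for n t
  have m_int: "integrable lborel (m n)" for n
  proof -
    have "integrable lborel (\<lambda>t. std_normal_density (0 + (1 / c n) * t))"
      using c[of n] by (intro lborel_integrable_real_affine) auto
    then have "integrable lborel (\<lambda>t. of_real (sqrt (2 * pi) * std_normal_density (0 + (1 / c n) * t)) :: complex)"
      by (intro integrable_of_real integrable_mult_right)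
    then have "integrable lborel (\<lambda>t. complex_of_real (exp (- (t / c n)\<^sup>2 / 2)))"
      by (simp add: std_normal_density_def)
    then have "integrable lborel (\<lambda>t. complex_of_real (exp (- (t / c n)\<^sup>2 / 2)) * exp (\<i> * of_real ((- u) * t)))"
      by (rule fourier_integrable)
    then show ?thesis by (simp add: m_def[abs_def] mult.commute)
  qed
  have m_fourier: "fourier (m n) v = sqrt (2 * pi) * c n * exp (- (c n * (v - u))\<^sup>2 / 2)" for n v
  proof -
    let ?e = "\<lambda>t. complex_of_real (exp (- (t / c n)\<^sup>2 / 2)) * exp (\<i> * of_real ((v - u) * t))"
    have "fourier (m n) v = (LBINT t. ?e t)"
      unfolding fourier_def m_def
      by (intro Bochner_Integration.integral_cong refl)
         (simp add: exp_add[symmetric] ring_distribs mult.assoc mult.left_commute)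
    also have "\<dots> = \<bar>c n\<bar> *\<^sub>R (LBINT t. ?e (0 + c n * t))"
      using c[of n] by (intro lborel_integral_real_affine) auto
    also have "(LBINT t. ?e (0 + c n * t)) =
       (LBINT t. of_real (sqrt (2 * pi)) * (?\<phi> t * exp (\<i> * of_real ((c n * (v - u)) * t))))"
      using c[of n] by (intro Bochner_Integration.integral_cong refl) (simp add: std_normal_density_def mult_ac)
    also have "\<dots> = of_real (sqrt (2 * pi)) * fourier ?\<phi> (c n * (v - u))"
      unfolding fourier_def by (rule integral_mult_right_zero)
    finally show ?thesis
      using c[of n] by (simp add: fourier_std_normal scaleR_conv_of_real)
  qed
  have lim1: "(\<lambda>n. LBINT t. m n t * fourier f t) \<longlonglongrightarrow> fourier (fourier f) (- u)"
    unfolding fourier_def[of "fourier f"]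
  proof (rule integral_dominated_convergence[where w = "\<lambda>t. cmod (fourier f t)"])
    show "integrable lborel (\<lambda>t. cmod (fourier f t))" using intf by simp
    show "AE t in lborel. (\<lambda>n. m n t * fourier f t) \<longlonglongrightarrow> fourier f t * exp (\<i> * of_real (- u * t))"
    proof (rule AE_I2)
      fix t
      have "(\<lambda>n. - (t * (1 / c n))\<^sup>2 / 2) \<longlonglongrightarrow> - (t * 0)\<^sup>2 / 2"
        by (intro tendsto_intros c0) auto
      then have "(\<lambda>n. exp (- (t / c n)\<^sup>2 / 2)) \<longlonglongrightarrow> exp 0"
        by (intro tendsto_exp) simp
      then have "(\<lambda>n. exp (- (\<i> * of_real (u * t))) * of_real (exp (- (t / c n)\<^sup>2 / 2)) * fourier f t) \<longlonglongrightarrow>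
         exp (- (\<i> * of_real (u * t))) * of_real (exp 0) * fourier f t"
        by (intro tendsto_mult tendsto_const tendsto_of_real)
      then show "(\<lambda>n. m n t * fourier f t) \<longlonglongrightarrow> fourier f t * exp (\<i> * of_real (- u * t))"
        by (simp add: m_def mult.commute)
    qed
    show "AE t in lborel. norm (m n t * fourier f t) \<le> cmod (fourier f t)" for n
    proof (rule AE_I2)
      fix t
      have "cmod (m n t) \<le> 1"
        unfolding m_def norm_mult using norm_exp_i_of_real[of "- (u * t)"] by simp
      then show "norm (m n t * fourier f t) \<le> cmod (fourier f t)"
        by (simp add: norm_mult mult_left_le_one_le)
    qed
    show "(\<lambda>t. m n t * fourier f t) \<in> borel_measurable lborel" for n
      using m_int[of n] by measurable
  qed measurable
  have eq: "(LBINT t. m n t * fourier f t) = (LBINT y. of_real (2 * pi) * (f (u + y / c n) * ?\<phi> y))" for n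
  proof -
    have "(LBINT t. m n t * fourier f t) = (LBINT v. f v * fourier (m n) v)"
      using fourier_exchange[OF m_int int, of n 1] by simp
    also have "\<dots> = \<bar>1 / c n\<bar> *\<^sub>R (LBINT y. f (u + 1 / c n * y) * fourier (m n) (u + 1 / c n * y))"
      using c[of n] by (intro lborel_integral_real_affine) auto
    also have "\<dots> = (LBINT y. (1 / c n) *\<^sub>R (f (u + 1 / c n * y) * fourier (m n) (u + 1 / c n * y)))"
      using c[of n] by simp
    also have "\<dots> = (LBINT y. of_real (2 * pi) * (f (u + y / c n) * ?\<phi> y))"
    proof (intro Bochner_Integration.integral_cong refl)
      fix y
      have "fourier (m n) (u + 1 / c n * y) = of_real (sqrt (2 * pi) * c n * exp (- y\<^sup>2 / 2))"
        unfolding m_fourier using c[of n] by simp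
      also have "\<dots> = of_real (c n * (2 * pi) * std_normal_density y)"
      proof (rule arg_cong[where f = of_real])
        have "2 * pi * (1 / sqrt (2 * pi)) = sqrt (2 * pi)"
          by (simp add: real_div_sqrt)
        then show "sqrt (2 * pi) * c n * exp (- y\<^sup>2 / 2) = c n * (2 * pi) * std_normal_density y"
          unfolding std_normal_density_def by (metis mult.assoc mult.commute)
      qed
      finally show "(1 / c n) *\<^sub>R (f (u + 1 / c n * y) * fourier (m n) (u + 1 / c n * y)) =
         of_real (2 * pi) * (f (u + y / c n) * ?\<phi> y)"
        using c[of n] by (simp add: scaleR_conv_of_real mult_ac)
    qed
    finally show ?thesis .
  qed
  have lim2: "(\<lambda>n. LBINT y. of_real (2 * pi) * (f (u + y / c n) * ?\<phi> y)) \<longlonglongrightarrow>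
     (LBINT y. of_real (2 * pi) * (f u * ?\<phi> y))"
  proof (rule integral_dominated_convergence[where w = "\<lambda>y. 2 * pi * (B * std_normal_density y)"])
    show "integrable lborel (\<lambda>y. 2 * pi * (B * std_normal_density y))"
      using integrable_normal_density[of 1 0] by simp
    show "AE y in lborel. (\<lambda>n. of_real (2 * pi) * (f (u + y / c n) * ?\<phi> y)) \<longlonglongrightarrow> of_real (2 * pi) * (f u * ?\<phi> y)"
    proof (rule AE_I2)
      fix y
      have "(\<lambda>n. u + y * (1 / c n)) \<longlonglongrightarrow> u + y * 0"
        by (intro tendsto_intros c0)
      then have "(\<lambda>n. f (u + y / c n)) \<longlonglongrightarrow> f u"
        using cont by (intro continuous_on_tendsto_compose[OF cont]) auto
      then show "(\<lambda>n. of_real (2 * pi) * (f (u + y / c n) * ?\<phi> y)) \<longlonglongrightarrow> of_real (2 * pi) * (f u * ?\<phi> y)"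
        by (intro tendsto_intros)
    qed
    show "AE y in lborel. norm (of_real (2 * pi) * (f (u + y / c n) * ?\<phi> y)) \<le> 2 * pi * (B * std_normal_density y)" for n
      by (rule AE_I2) (auto simp: norm_mult intro!: mult_right_mono bdd)
    show "(\<lambda>y. of_real (2 * pi) * (f (u + y / c n) * ?\<phi> y)) \<in> borel_measurable lborel" for n
      by measurable
  qed measurable
  have "fourier (fourier f) (- u) = (LBINT y. of_real (2 * pi) * (f u * ?\<phi> y))"
    using LIMSEQ_unique[OF lim1] lim2 unfolding eq by blast
  also have "\<dots> = of_real (2 * pi) * (f u * (LBINT y. ?\<phi> y))"
    by simp
  also have "(LBINT y. ?\<phi> y) = 1"
    using fourier_std_normal[of 0] by (simp add: fourier_def)
  finally show ?thesis by simp
qed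

text \<open>Moving the transform from \<open>g\<close> to \<open>fourier f\<close> reduces the identity to Fourier inversion for \<open>f\<close>.\<close>

lemma fourier_parseval:
  fixes f g :: "real \<Rightarrow> complex"
  assumes "continuous_on UNIV f" "\<And>u. cmod (f u) \<le> B" "integrable lborel f"
    and "integrable lborel (fourier f)" and g: "integrable lborel g"
  shows "(LBINT t. fourier f t * cnj (fourier g t)) = of_real (2 * pi) * (LBINT u. f u * cnj (g u))"
proof -
  have g': "integrable lborel (\<lambda>u. cnj (g u))" using g by simp
  have "(LBINT t. fourier f t * cnj (fourier g t)) = (LBINT t. fourier f t * fourier (\<lambda>u. cnj (g u)) ((-1) * t))"
    by (simp add: cnj_fourier)
  also have "\<dots> = (LBINT u. cnj (g u) * fourier (fourier f) ((-1) * u))"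
    by (rule fourier_exchange[OF assms(4) g'])
  also have "\<dots> = (LBINT u. of_real (2 * pi) * (f u * cnj (g u)))"
    using fourier_inversion[OF assms(1-4)] by (simp add: mult_ac)
  finally show ?thesis by simp
qed

lemma fourier_deriv:
  assumes f: "exp_decay f" "\<And>u. (f has_vector_derivative f' u) (at u)"
    and f': "exp_decay f'" "continuous_on UNIV f'"
  shows "fourier f' t = - (\<i> * of_real t) * fourier f t"
proof -
  let ?e = "\<lambda>u. exp (\<i> * of_real (t * u))"
  have contf: "continuous_on UNIV f"
    using f(2) by (meson continuous_on_eq_continuous_within has_vector_derivative_continuous has_vector_derivative_at_within)
  have intf: "integrable lborel f" and intf': "integrable lborel f'"
    using exp_decay_integrable f(1) contf f' by auto
  have "(LBINT u. f' u * ?e u + (\<i> * of_real t) * (f u * ?e u)) = 0"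
  proof (rule integral_derivative_eq_0)
    show "((\<lambda>u. f u * ?e u) has_vector_derivative f' u * ?e u + (\<i> * of_real t) * (f u * ?e u)) (at u)" for u
    proof -
      have "((\<lambda>z. exp (\<i> * of_real t * z)) has_field_derivative (\<i> * of_real t) * exp (\<i> * of_real t * of_real u)) (at (of_real u))"
        by (auto intro!: derivative_eq_intros)
      from has_vector_derivative_real_field[OF this]
      have "(?e has_vector_derivative (\<i> * of_real t) * ?e u) (at u)"
        by (simp add: mult.assoc)
      from has_vector_derivative_mult[OF f(2) this] show ?thesis
        by (simp add: mult_ac add.commute)
    qed
    show "continuous_on UNIV (\<lambda>u. f' u * ?e u + (\<i> * of_real t) * (f u * ?e u))"
      by (intro continuous_intros f' contf)
    show "integrable lborel (\<lambda>u. f' u * ?e u + (\<i> * of_real t) * (f u * ?e u))"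
      by (intro Bochner_Integration.integrable_add integrable_mult_right fourier_integrable intf intf')
    show "exp_decay (\<lambda>u. f u * ?e u)"
      using f(1) by (simp add: exp_decay_def norm_mult)
  qed
  then have "fourier f' t + (\<i> * of_real t) * fourier f t = 0"
    unfolding fourier_def
    by (subst (asm) Bochner_Integration.integral_add)
       (use fourier_integrable[OF intf, of t] fourier_integrable[OF intf', of t] in auto)
  then show ?thesis by (simp add: add_eq_0_iff)
qed

lemma integrable_if_quadratic_decay:
  fixes f :: "real \<Rightarrow> complex"
  assumes [measurable]: "f \<in> borel_measurable lborel" and "\<And>t. (1 + t\<^sup>2) * cmod (f t) \<le> C"
  shows "integrable lborel f"
proof (rule Bochner_Integration.integrable_bound)
  show "integrable lborel (\<lambda>t::real. C * inverse (1 + t\<^sup>2))"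
    using integrable_inverse_1_plus_square by (simp add: set_integrable_def)
  show "AE t in lborel. norm (f t) \<le> norm (C * inverse (1 + t\<^sup>2))"
  proof (rule AE_I2)
    fix t :: real
    have p: "1 + t\<^sup>2 > 0" by (simp add: add_pos_nonneg)
    have "norm (f t) \<le> C * inverse (1 + t\<^sup>2)"
      using assms(2)[of t] p by (simp add: field_simps)
    then show "norm (f t) \<le> norm (C * inverse (1 + t\<^sup>2))" by simp
  qed
qed measurable

lemma fourier_measurable [measurable]:
  assumes "integrable lborel f"
  shows "fourier f \<in> borel_measurable lborel"
proof -
  have [measurable]: "f \<in> borel_measurable lborel" using assms by auto
  show ?thesis unfolding fourier_def[abs_def] by measurable
qed

text \<open>A function \<open>f 0\<close> together with all its derivatives \<open>f n\<close>, each of exponential decay.\<close>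

locale smooth_decay =
  fixes f :: "nat \<Rightarrow> real \<Rightarrow> complex"
  assumes deriv: "\<And>n u. (f n has_vector_derivative f (Suc n) u) (at u)"
    and decay: "\<And>n. exp_decay (f n)"
begin

lemma cont: "continuous_on UNIV (f n)"
  using deriv by (meson continuous_on_eq_continuous_within has_vector_derivative_continuous has_vector_derivative_at_within)

lemma integrable_f: "integrable lborel (f n)"
  using decay cont by (rule exp_decay_integrable)

lemma fourier_f: "fourier (f n) t = (- (\<i> * of_real t)) ^ n * fourier (f 0) t"
proof (induction n)
  case (Suc n)
  have "fourier (f (Suc n)) t = - (\<i> * of_real t) * fourier (f n) t"
    by (rule fourier_deriv[OF decay deriv decay cont])
  then show ?case by (simp add: Suc)
qed auto

text \<open>The transforms of the derivatives of orders \<open>n\<close> and \<open>n + 2\<close> are bounded, which bounds the function by a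
  multiple of \<open>1 / (1 + t\<^sup>2)\<close>.\<close>

lemma integrable_power_fourier: "integrable lborel (\<lambda>t. of_real t ^ n * fourier (f 0) t)"
proof (rule integrable_if_quadratic_decay)
  have [measurable]: "fourier (f 0) \<in> borel_measurable lborel"
    by (rule fourier_measurable[OF integrable_f])
  show "(\<lambda>t. of_real t ^ n * fourier (f 0) t) \<in> borel_measurable lborel"
    by measurable
  have b: "\<bar>t\<bar> ^ m * cmod (fourier (f 0) t) \<le> (LBINT u. cmod (f m u))" for m t
  proof -
    have "\<bar>t\<bar> ^ m * cmod (fourier (f 0) t) = cmod (fourier (f m) t)"
      by (simp add: fourier_f[of m] norm_mult norm_power)
    then show ?thesis using norm_fourier_le by simp
  qed
  show "(1 + t\<^sup>2) * cmod (of_real t ^ n * fourier (f 0) t) \<le> (LBINT u. cmod (f n u)) + (LBINT u. cmod (f (n + 2) u))" for t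
  proof -
    have "(1 + t\<^sup>2) * cmod (of_real t ^ n * fourier (f 0) t) =
      \<bar>t\<bar> ^ n * cmod (fourier (f 0) t) + \<bar>t\<bar> ^ (n + 2) * cmod (fourier (f 0) t)"
      by (simp add: norm_mult norm_power power_add algebra_simps power2_eq_square)
    also have "\<dots> \<le> (LBINT u. cmod (f n u)) + (LBINT u. cmod (f (n + 2) u))"
      by (intro add_mono b)
    finally show ?thesis .
  qed
qed

lemma bounded_f: "\<exists>B. \<forall>u. cmod (f n u) \<le> B"
proof -
  obtain a C where a: "a > 0" and C: "\<And>x. cmod (f n x) \<le> C * exp (- (a * \<bar>x\<bar>))"
    using decay[of n] unfolding exp_decay_def by blast
  have "cmod (f n u) \<le> \<bar>C\<bar>" for u
  proof -
    have "C * exp (- (a * \<bar>u\<bar>)) \<le> \<bar>C\<bar> * 1"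
      using a by (intro mult_mono) auto
    then show ?thesis using C[of u] by simp
  qed
  then show ?thesis by blast
qed

lemma integrable_weighted: "integrable lborel (\<lambda>t. t ^ N * (cmod (fourier (f 0) t))\<^sup>2)"
proof -
  have "integrable lborel (\<lambda>t. (of_real t ^ N * fourier (f 0) t) * cnj (fourier (f 0) t))"
  proof (rule integrable_mult_bounded[OF integrable_power_fourier])
    show "(\<lambda>t. cnj (fourier (f 0) t)) \<in> borel_measurable lborel"
      by (rule measurable_compose[OF fourier_measurable[OF integrable_f]])
         (simp add: borel_measurable_continuous_onI continuous_on_cnj)
    show "cmod (cnj (fourier (f 0) t)) \<le> (LBINT u. cmod (f 0 u))" for t
      using norm_fourier_le by simp
  qed
  then have "integrable lborel (\<lambda>t. complex_of_real (t ^ N * (cmod (fourier (f 0) t))\<^sup>2))"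
    by (simp add: mult.assoc complex_norm_square[unfolded of_real_power])
  then show ?thesis by (simp only: complex_of_real_integrable_eq)
qed

text \<open>The power \<open>t\<^sup>N\<close> is absorbed into one of the two factors, where it becomes an \<open>N\<close>-th derivative.\<close>

lemma weighted_parseval:
  "complex_of_real (LBINT t. t ^ N * (cmod (fourier (f 0) t))\<^sup>2) =
     of_real (2 * pi) * (- \<i>) ^ N * (LBINT u. f 0 u * cnj (f N u))"
proof -
  obtain B where B: "\<And>u. cmod (f 0 u) \<le> B" using bounded_f by blast
  have "complex_of_real (LBINT t. t ^ N * (cmod (fourier (f 0) t))\<^sup>2) =
      (LBINT t. complex_of_real (t ^ N * (cmod (fourier (f 0) t))\<^sup>2))"
    by (rule integral_complex_of_real[symmetric])
  also have "\<dots> = (LBINT t. (- \<i>) ^ N * (fourier (f 0) t * cnj (fourier (f N) t)))"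
  proof (intro Bochner_Integration.integral_cong refl)
    fix t :: real
    have "(- \<i>) ^ N * (\<i> * of_real t) ^ N = complex_of_real t ^ N"
      by (simp flip: power_mult_distrib)
    then have "complex_of_real (t ^ N * (cmod (fourier (f 0) t))\<^sup>2) =
       (- \<i>) ^ N * (\<i> * of_real t) ^ N * (fourier (f 0) t * cnj (fourier (f 0) t))"
      by (simp add: complex_norm_square[unfolded of_real_power])
    also have "(\<i> * of_real t) ^ N * cnj (fourier (f 0) t) = cnj (fourier (f N) t)"
      by (simp add: fourier_f[of N])
    then have "(- \<i>) ^ N * (\<i> * of_real t) ^ N * (fourier (f 0) t * cnj (fourier (f 0) t)) =
       (- \<i>) ^ N * (fourier (f 0) t * cnj (fourier (f N) t))"
      by (simp only: mult.assoc mult.left_commute)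
    finally show "complex_of_real (t ^ N * (cmod (fourier (f 0) t))\<^sup>2) =
       (- \<i>) ^ N * (fourier (f 0) t * cnj (fourier (f N) t))" .
  qed
  also have "\<dots> = (- \<i>) ^ N * (of_real (2 * pi) * (LBINT u. f 0 u * cnj (f N u)))"
    using fourier_parseval[OF cont B integrable_f _ integrable_f, of N] integrable_power_fourier[of 0] by simp
  finally show ?thesis by simp
qed

end


section \<open>Shifting the line of integration\<close>

lemma exp_decayI:
  fixes f :: "real \<Rightarrow> complex"
  assumes cont: "continuous_on UNIV f" and a: "a > 0"
    and bound: "\<And>x. \<bar>x\<bar> \<ge> r \<Longrightarrow> cmod (f x) \<le> C * exp (- (a * \<bar>x\<bar>))"
  shows "exp_decay f"
proof -
  have "compact (f ` {-r..r})"
    by (intro compact_continuous_image continuous_on_subset[OF cont]) auto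
  then have "bounded (f ` {-r..r})" by (rule compact_imp_bounded)
  then obtain M where M: "\<And>x. x \<in> {-r..r} \<Longrightarrow> cmod (f x) \<le> M"
    unfolding bounded_iff by blast
  have "cmod (f x) \<le> (\<bar>C\<bar> + \<bar>M\<bar> * exp (a * \<bar>r\<bar>)) * exp (- (a * \<bar>x\<bar>))" for x
  proof (cases "\<bar>x\<bar> \<ge> r")
    case True
    have "C * exp (- (a * \<bar>x\<bar>)) \<le> (\<bar>C\<bar> + \<bar>M\<bar> * exp (a * \<bar>r\<bar>)) * exp (- (a * \<bar>x\<bar>))"
      by (intro mult_right_mono) (auto intro: order_trans[OF abs_ge_self])
    then show ?thesis using bound[OF True] by linarith
  next
    case False
    have "x \<in> {-r..r}" using False by (auto simp: abs_if split: if_splits)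
    then have "cmod (f x) \<le> \<bar>M\<bar> * 1" using M[of x] by linarith
    also have "1 \<le> exp (a * (\<bar>r\<bar> - \<bar>x\<bar>))" using False a by simp
    then have "\<bar>M\<bar> * 1 \<le> \<bar>M\<bar> * exp (a * (\<bar>r\<bar> - \<bar>x\<bar>))" by (intro mult_left_mono) auto
    also have "\<dots> = \<bar>M\<bar> * exp (a * \<bar>r\<bar>) * exp (- (a * \<bar>x\<bar>))"
      by (simp add: right_diff_distrib exp_diff exp_minus field_simps)
    also have "\<dots> \<le> (\<bar>C\<bar> + \<bar>M\<bar> * exp (a * \<bar>r\<bar>)) * exp (- (a * \<bar>x\<bar>))"
      by (intro mult_right_mono) auto
    finally show ?thesis .
  qed
  then show ?thesis using a unfolding exp_decay_def by blast
qed

lemma tendsto_integral_expanding: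
  fixes g :: "real \<Rightarrow> complex"
  assumes g: "integrable lborel g"
  shows "(\<lambda>n. integral {- real (Suc n)..real (Suc n)} g) \<longlonglongrightarrow> (LBINT x. g x)"
proof -
  have [measurable]: "g \<in> borel_measurable lborel" using g by auto
  have "(\<lambda>n. LBINT x. indicator {- real (Suc n)..real (Suc n)} x *\<^sub>R g x) \<longlonglongrightarrow> (LBINT x. g x)"
  proof (rule integral_dominated_convergence[where w = "\<lambda>x. cmod (g x)"])
    show "integrable lborel (\<lambda>x. cmod (g x))" using g by simp
    show "AE x in lborel. (\<lambda>n. indicator {- real (Suc n)..real (Suc n)} x *\<^sub>R g x) \<longlonglongrightarrow> g x"
    proof (rule AE_I2, rule tendsto_eventually)
      fix x :: real
      obtain m where m: "\<bar>x\<bar> \<le> real m" using real_arch_simple by blast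
      show "\<forall>\<^sub>F n in sequentially. indicator {- real (Suc n)..real (Suc n)} x *\<^sub>R g x = g x"
        using eventually_ge_at_top[of m]
      proof eventually_elim
        case (elim n)
        then have "x \<in> {- real (Suc n)..real (Suc n)}" using m by auto
        then show ?case by simp
      qed
    qed
    show "AE x in lborel. norm (indicator {- real (Suc n)..real (Suc n)} x *\<^sub>R g x) \<le> cmod (g x)" for n
      by (rule AE_I2) (simp add: indicator_def)
  qed measurable
  moreover have "(LBINT x. indicator {- real (Suc n)..real (Suc n)} x *\<^sub>R g x) =
      integral {- real (Suc n)..real (Suc n)} g" for n
  proof -
    have "set_integrable lborel {- real (Suc n)..real (Suc n)} g"
      unfolding set_integrable_def by (rule integrable_mult_indicator[OF _ g]) auto
    then show ?thesis
      using set_borel_integral_eq_integral(2) by (simp add: set_lebesgue_integral_def)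
  qed
  ultimately show ?thesis by simp
qed

text \<open>The residue theorem on the rectangle with vertices \<open>-R\<close>, \<open>R\<close>, \<open>R + ih\<close>, \<open>-R + ih\<close>. The decay makes the
  vertical sides disappear as \<open>R\<close> tends to infinity and the integrals over the horizontal lines converge.\<close>

lemma strip_integral_residues:
  fixes f :: "complex \<Rightarrow> complex"
  assumes P: "finite P" "\<And>z. z \<in> P \<Longrightarrow> Re z = 0 \<and> 0 < Im z \<and> Im z < h" and h: "h > 0"
    and d: "d > 0" and holo: "f holomorphic_on {z. - d < Im z \<and> Im z < h + d} - P"
    and bound: "\<And>z. 1 \<le> \<bar>Re z\<bar> \<Longrightarrow> 0 \<le> Im z \<Longrightarrow> Im z \<le> h \<Longrightarrow> cmod (f z) \<le> C * exp (- \<bar>Re z\<bar>)"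
  shows "integrable lborel (\<lambda>x. f (of_real x))" "integrable lborel (\<lambda>x. f (of_real x + \<i> * of_real h))"
    and "(LBINT x. f (of_real x)) - (LBINT x. f (of_real x + \<i> * of_real h)) =
      2 * of_real pi * \<i> * (\<Sum>p\<in>P. residue f p)"
proof -
  let ?S = "{z. - d < Im z \<and> Im z < h + d}"
  have S: "open ?S" "convex ?S"
  proof -
    have e: "?S = {z. - d < Im z} \<inter> {z. Im z < h + d}" by auto
    show "open ?S" unfolding e by (intro open_Int open_halfspace_Im_gt open_halfspace_Im_lt)
    show "convex ?S" unfolding e by (intro convex_Int convex_halfspace_Im_gt convex_halfspace_Im_lt)
  qed
  have contf: "continuous_on (?S - P) f" using holo by (rule holomorphic_on_imp_continuous_on)
  have cont0: "continuous_on UNIV (\<lambda>x. f (of_real x))"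
    by (rule continuous_on_compose2[OF contf]) (use P(2) d h in \<open>force intro: continuous_intros\<close>)+
  have conth: "continuous_on UNIV (\<lambda>x. f (of_real x + \<i> * of_real h))"
    by (rule continuous_on_compose2[OF contf]) (use P(2) d h in \<open>force intro: continuous_intros\<close>)+
  have int0: "integrable lborel (\<lambda>x. f (of_real x))"
  proof (intro exp_decay_integrable cont0 exp_decayI[of _ 1 1 C])
    show "cmod (f (of_real x)) \<le> C * exp (- (1 * \<bar>x\<bar>))" if "1 \<le> \<bar>x\<bar>" for x
      using bound[of "of_real x"] that h by simp
  qed auto
  have inth: "integrable lborel (\<lambda>x. f (of_real x + \<i> * of_real h))"
  proof (intro exp_decay_integrable conth exp_decayI[of _ 1 1 C])
    show "cmod (f (of_real x + \<i> * of_real h)) \<le> C * exp (- (1 * \<bar>x\<bar>))" if "1 \<le> \<bar>x\<bar>" for x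
      using bound[of "of_real x + \<i> * of_real h"] that h by simp
  qed auto
  show "integrable lborel (\<lambda>x. f (of_real x))" "integrable lborel (\<lambda>x. f (of_real x + \<i> * of_real h))"
    by fact+
  \<comment> \<open>The contribution of the two vertical sides.\<close>
  define s where "s R = contour_integral (linepath (Complex R 0) (Complex R h)) f -
      contour_integral (linepath (Complex (- R) 0) (Complex (- R) h)) f" for R
  have rect: "integral {-R..R} (\<lambda>x. f (of_real x)) - integral {-R..R} (\<lambda>x. f (of_real x + \<i> * of_real h)) + s R =
     2 * of_real pi * \<i> * (\<Sum>p\<in>P. residue f p)" if R: "R > 0" for R
  proof -
    let ?a1 = "Complex (- R) 0" and ?a2 = "Complex R 0" and ?a3 = "Complex R h" and ?a4 = "Complex (- R) h"
    have im: "path_image (rectpath ?a1 ?a3) \<subseteq> ?S - P"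
    proof
      fix z assume "z \<in> path_image (rectpath ?a1 ?a3)"
      then have "Re z \<in> {-R, R} \<and> Im z \<in> {0..h} \<or> Im z \<in> {0, h} \<and> Re z \<in> {-R..R}"
        using R h by (auto simp: path_image_rectpath)
      then show "z \<in> ?S - P" using R h d P(2)[of z] by auto
    qed
    have seg: "closed_segment ?a1 ?a2 \<union> closed_segment ?a2 ?a3 \<union> closed_segment ?a3 ?a4 \<union> closed_segment ?a4 ?a1 \<subseteq> ?S - P"
      using im by (simp add: rectpath_def Let_def path_image_join Un_assoc)
    have ci: "f contour_integrable_on linepath x y" if "closed_segment x y \<subseteq> ?S - P" for x y
      by (intro contour_integrable_continuous_linepath continuous_on_subset[OF contf that])
    have ci': "f contour_integrable_on linepath ?a1 ?a2" "f contour_integrable_on linepath ?a2 ?a3"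
      "f contour_integrable_on linepath ?a3 ?a4" "f contour_integrable_on linepath ?a4 ?a1"
      using seg by (auto intro!: ci)
    have "contour_integral (rectpath ?a1 ?a3) f = 2 * of_real pi * \<i> * (\<Sum>p\<in>P. winding_number (rectpath ?a1 ?a3) p * residue f p)"
    proof (subst Residue_theorem[of ?S P])
      show "connected ?S" using S(2) by (rule convex_connected)
      show "\<forall>z. z \<notin> ?S \<longrightarrow> winding_number (rectpath ?a1 ?a3) z = 0"
      proof (intro allI impI)
        fix z assume "z \<notin> ?S"
        then have "z \<notin> cbox ?a1 ?a3" using d by (auto simp: in_cbox_complex_iff)
        then show "winding_number (rectpath ?a1 ?a3) z = 0"
          using R h by (intro winding_number_rectpath_outside) auto
      qed
    qed (use S holo im P(1) in auto)
    also have "(\<Sum>p\<in>P. winding_number (rectpath ?a1 ?a3) p * residue f p) = (\<Sum>p\<in>P. residue f p)"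
    proof (intro sum.cong refl)
      fix p assume "p \<in> P"
      then have "p \<in> box ?a1 ?a3" using P(2)[of p] R by (auto simp: in_box_complex_iff)
      then show "winding_number (rectpath ?a1 ?a3) p * residue f p = residue f p"
        by (simp add: winding_number_rectpath)
    qed
    also have "contour_integral (rectpath ?a1 ?a3) f = contour_integral (linepath ?a1 ?a2) f +
       (contour_integral (linepath ?a2 ?a3) f + (contour_integral (linepath ?a3 ?a4) f + contour_integral (linepath ?a4 ?a1) f))"
      using ci' by (simp add: rectpath_def Let_def contour_integral_join contour_integrable_join valid_path_join)
    also have "contour_integral (linepath ?a3 ?a4) f = - contour_integral (linepath ?a4 ?a3) f"
      using seg by (intro contour_integral_reverse_linepath continuous_on_subset[OF contf]) (auto simp: closed_segment_commute)
    also have "contour_integral (linepath ?a4 ?a1) f = - contour_integral (linepath ?a1 ?a4) f"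
      using seg by (intro contour_integral_reverse_linepath continuous_on_subset[OF contf]) (auto simp: closed_segment_commute)
    also have "contour_integral (linepath ?a1 ?a2) f = integral {-R..R} (\<lambda>x. f (of_real x))"
      using R by (subst contour_integral_linepath_Reals_eq) (auto simp: complex_is_Real_iff)
    also have "contour_integral (linepath ?a4 ?a3) f = contour_integral (linepath ?a1 ?a2) (\<lambda>z. f (z + \<i> * of_real h))"
    proof -
      have lp: "linepath ?a4 ?a3 x = linepath ?a1 ?a2 x + \<i> * of_real h" for x
        by (simp add: linepath_def complex_eq_iff algebra_simps)
      have df: "?a3 - ?a4 = ?a2 - ?a1" by (simp add: complex_eq_iff)
      show ?thesis
        unfolding contour_integral_integral vector_derivative_linepath_at lp df ..
    qed
    also have "\<dots> = integral {-R..R} (\<lambda>x. f (of_real x + \<i> * of_real h))"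
      using R by (subst contour_integral_linepath_Reals_eq) (auto simp: complex_is_Real_iff)
    finally show ?thesis by (simp add: s_def algebra_simps)
  qed
  have s_lim: "(\<lambda>n. s (real (Suc n))) \<longlonglongrightarrow> 0"
  proof (rule Lim_null_comparison)
    show "(\<lambda>n. 2 * (\<bar>C\<bar> * exp (- real (Suc n)) * h)) \<longlonglongrightarrow> 0"
      by real_asymp
    show "\<forall>\<^sub>F n in sequentially. norm (s (real (Suc n))) \<le> 2 * (\<bar>C\<bar> * exp (- real (Suc n)) * h)"
    proof (intro always_eventually allI)
      fix n
      have side: "cmod (contour_integral (linepath (Complex R 0) (Complex R h)) f) \<le> \<bar>C\<bar> * exp (- \<bar>R\<bar>) * h"
        if R: "\<bar>R\<bar> \<ge> 1" for R
      proof -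
        have im: "Re z = R \<and> 0 \<le> Im z \<and> Im z \<le> h" if "z \<in> closed_segment (Complex R 0) (Complex R h)" for z
          using that h by (auto simp: closed_segment_same_Re closed_segment_eq_real_ivl)
        have "cmod (contour_integral (linepath (Complex R 0) (Complex R h)) f) \<le>
           (\<bar>C\<bar> * exp (- \<bar>R\<bar>)) * cmod (Complex R h - Complex R 0)"
        proof (rule contour_integral_bound_linepath)
          show "f contour_integrable_on linepath (Complex R 0) (Complex R h)"
            using im d R P(2)
            by (intro contour_integrable_continuous_linepath continuous_on_subset[OF contf]) force
          fix z assume "z \<in> closed_segment (Complex R 0) (Complex R h)"
          from im[OF this] have "cmod (f z) \<le> C * exp (- \<bar>R\<bar>)" using bound[of z] R by auto
          also have "\<dots> \<le> \<bar>C\<bar> * exp (- \<bar>R\<bar>)" by (intro mult_right_mono) auto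
          finally show "cmod (f z) \<le> \<bar>C\<bar> * exp (- \<bar>R\<bar>)" .
        qed auto
        also have "Complex R h - Complex R 0 = \<i> * of_real h" by (simp add: complex_eq_iff)
        finally show ?thesis using h by (simp add: norm_mult)
      qed
      have "norm (s (real (Suc n))) \<le> cmod (contour_integral (linepath (Complex (real (Suc n)) 0) (Complex (real (Suc n)) h)) f)
          + cmod (contour_integral (linepath (Complex (- real (Suc n)) 0) (Complex (- real (Suc n)) h)) f)"
        unfolding s_def by (rule norm_triangle_ineq4)
      also have "\<dots> \<le> \<bar>C\<bar> * exp (- real (Suc n)) * h + \<bar>C\<bar> * exp (- real (Suc n)) * h"
        using side[of "real (Suc n)"] side[of "- real (Suc n)"] by (intro add_mono) (simp_all del: of_nat_Suc)
      finally show "norm (s (real (Suc n))) \<le> 2 * (\<bar>C\<bar> * exp (- real (Suc n)) * h)" by linarith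
    qed
  qed
  have "(\<lambda>n. integral {- real (Suc n)..real (Suc n)} (\<lambda>x. f (of_real x)) -
        integral {- real (Suc n)..real (Suc n)} (\<lambda>x. f (of_real x + \<i> * of_real h)) + s (real (Suc n)))
     \<longlonglongrightarrow> (LBINT x. f (of_real x)) - (LBINT x. f (of_real x + \<i> * of_real h)) + 0"
    by (intro tendsto_intros tendsto_integral_expanding int0 inth s_lim)
  then have "(\<lambda>n::nat. 2 * of_real pi * \<i> * (\<Sum>p\<in>P. residue f p))
     \<longlonglongrightarrow> (LBINT x. f (of_real x)) - (LBINT x. f (of_real x + \<i> * of_real h)) + 0"
    by (simp only: rect of_nat_0_less_iff zero_less_Suc)
  then show "(LBINT x. f (of_real x)) - (LBINT x. f (of_real x + \<i> * of_real h)) =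
      2 * of_real pi * \<i> * (\<Sum>p\<in>P. residue f p)"
    by (simp add: LIMSEQ_const_iff)
qed

text \<open>The function \<open>f\<close> has a simple pole at \<open>z0\<close>, and \<open>g\<close> has the pole of the \<open>k\<close>-th derivative of a function
  with a simple pole, so neither has further polar terms. Expanding the product leaves a pole of order
  \<open>k + 2\<close>, one of order \<open>k + 1\<close> and one of order 1, each with a holomorphic numerator.\<close>

lemma residue_pole_product:
  fixes p \<Phi> \<Psi> :: "complex \<Rightarrow> complex"
  assumes r: "r > 0" and holo: "p holomorphic_on ball z0 r" "\<Phi> holomorphic_on ball z0 r" "\<Psi> holomorphic_on ball z0 r"
    and f: "\<And>z. z \<in> ball z0 r \<Longrightarrow> z \<noteq> z0 \<Longrightarrow> f z = c / (z - z0) + \<Phi> z"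
    and g: "\<And>z. z \<in> ball z0 r \<Longrightarrow> z \<noteq> z0 \<Longrightarrow>
      g z = (-1) ^ k * fact k * d / (z - z0) ^ Suc k + (deriv ^^ k) \<Psi> z"
  shows "residue (\<lambda>z. p z * (f z * g z)) z0 =
     c * d * ((-1) ^ k * (deriv ^^ Suc k) p z0 / of_nat (Suc k))
     + d * ((-1) ^ k * (deriv ^^ k) (\<lambda>z. p z * \<Phi> z) z0) + c * (p z0 * (deriv ^^ k) \<Psi> z0)"
proof -
  let ?B = "ball z0 r"
  let ?\<Psi> = "(deriv ^^ k) \<Psi>"
  define e where "e = (-1) ^ k * fact k * d"
  let ?t1 = "\<lambda>z. c * e * p z / (z - z0) ^ Suc (Suc k)" and ?t2 = "\<lambda>z. e * (p z * \<Phi> z) / (z - z0) ^ Suc k"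
    and ?t3 = "\<lambda>z. c * (p z * ?\<Psi> z) / (z - z0) ^ Suc 0" and ?t4 = "\<lambda>z. p z * (\<Phi> z * ?\<Psi> z)"
  have z0: "z0 \<in> ?B" using r by simp
  have h\<Psi>: "?\<Psi> holomorphic_on ?B" by (rule holomorphic_higher_deriv[OF holo(3)]) simp
  note hh = holo h\<Psi>
  have hs: "p holomorphic_on ?B - {z0}" "\<Phi> holomorphic_on ?B - {z0}" "?\<Psi> holomorphic_on ?B - {z0}"
    using hh by (auto intro: holomorphic_on_subset)
  have "residue (\<lambda>z. p z * (f z * g z)) z0 = residue (\<lambda>z. ?t1 z + (?t2 z + (?t3 z + ?t4 z))) z0"
  proof (rule residue_cong)
    have "eventually (\<lambda>z. z \<in> ?B - {z0}) (at z0)"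
      using z0 by (intro eventually_at_in_open) auto
    then show "eventually (\<lambda>z. p z * (f z * g z) = ?t1 z + (?t2 z + (?t3 z + ?t4 z))) (at z0)"
    proof eventually_elim
      case (elim z)
      have *: "P * ((C / w + A) * (E / W + D)) = C * E * P / (w * W) + (E * (P * A) / W + (C * (P * D) / w + P * (A * D)))"
        for P C w A E W D :: complex
        by (simp add: ring_distribs mult_ac)
      show ?case
        using elim *[of "p z" c "z - z0" "\<Phi> z" e "(z - z0) ^ Suc k" "?\<Psi> z"]
        by (simp add: f g e_def)
    qed
  qed simp
  also have "\<dots> = residue ?t1 z0 + (residue ?t2 z0 + (residue ?t3 z0 + residue ?t4 z0))"
    using z0 hs by (subst residue_add[of ?B], auto intro!: holomorphic_intros)+
  also have "residue ?t1 z0 = (deriv ^^ Suc k) (\<lambda>z. c * e * p z) z0 / fact (Suc k)"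
    using z0 hh by (intro residue_holomorphic_over_power[of ?B]) (auto intro!: holomorphic_intros)
  also have "\<dots> = c * d * ((-1) ^ k * (deriv ^^ Suc k) p z0 / of_nat (Suc k))"
    by (simp only: higher_deriv_cmult[OF holo(1) z0 open_ball]) (simp add: e_def del: funpow.simps)
  also have "residue ?t2 z0 = (deriv ^^ k) (\<lambda>z. e * (p z * \<Phi> z)) z0 / fact k"
    using z0 hh by (intro residue_holomorphic_over_power[of ?B]) (auto intro!: holomorphic_intros)
  also have "\<dots> = d * ((-1) ^ k * (deriv ^^ k) (\<lambda>z. p z * \<Phi> z) z0)"
    using higher_deriv_cmult[OF holomorphic_on_mult[OF holo(1,2)] z0, of k e] by (simp add: e_def)
  also have "residue ?t3 z0 = (deriv ^^ 0) (\<lambda>z. c * (p z * ?\<Psi> z)) z0 / fact 0"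
    using z0 hh by (intro residue_holomorphic_over_power[of ?B]) (auto intro!: holomorphic_intros)
  also have "residue ?t4 z0 = 0"
    using z0 hh by (intro residue_holo[of ?B]) (auto intro!: holomorphic_intros)
  finally show ?thesis by simp
qed

section \<open>Bernoulli primitives\<close>

text \<open>The polynomial whose increment along the period \<open>2\<pi>i\<close> is \<open>z\<^sup>k\<close>. As \<open>k\<close> varies these polynomials differentiate
  into one another like powers.\<close>

definition bern_prim :: "nat \<Rightarrow> complex \<Rightarrow> complex" where
  "bern_prim k z = (2 * of_real pi * \<i>) ^ k * bernc (Suc k) (z / (2 * of_real pi * \<i>)) / of_nat (Suc k)"

lemma bern_prim_shift: "bern_prim k (z + 2 * of_real pi * \<i>) - bern_prim k z = z ^ k"
proof -
  let ?p = "2 * of_real pi * \<i>"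
  have "(z + ?p) / ?p = z / ?p + 1" by (simp add: add_divide_distrib)
  then have "bern_prim k (z + ?p) - bern_prim k z =
     ?p ^ k * (bernc (Suc k) (z / ?p + 1) - bernc (Suc k) (z / ?p)) / of_nat (Suc k)"
    by (simp add: bern_prim_def diff_divide_distrib right_diff_distrib)
  also have "\<dots> = ?p ^ k * (z / ?p) ^ k"
    unfolding bernc_diff by (simp del: of_nat_Suc)
  finally show ?thesis by (simp add: power_divide)
qed

lemma bern_prim_has_deriv:
  "(bern_prim k has_field_derivative (2 * of_real pi * \<i>) ^ k * bernc k (z / (2 * of_real pi * \<i>)) / (2 * of_real pi * \<i>)) (at z)"
proof -
  let ?p = "2 * of_real pi * \<i>"
  have "((\<lambda>z. bernc (Suc k) (z / ?p)) has_field_derivative of_nat (Suc k) * bernc k (z / ?p) * (1 / ?p)) (at z)"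
    by (rule DERIV_chain2[OF bernc_has_deriv]) (auto intro!: derivative_eq_intros)
  from DERIV_cmult[OF this, of "?p ^ k / of_nat (Suc k)"] show ?thesis
    by (simp add: bern_prim_def[abs_def] mult_ac del: of_nat_Suc)
qed

lemma bern_prim_Suc_has_deriv:
  "(bern_prim (Suc k) has_field_derivative of_nat (Suc k) * bern_prim k z) (at z)"
  using bern_prim_has_deriv[of "Suc k" z] by (simp add: bern_prim_def del: of_nat_Suc)

lemma bern_prim_holomorphic: "bern_prim k holomorphic_on S"
  using bern_prim_has_deriv by (meson field_differentiable_def field_differentiable_at_within holomorphic_on_def)

lemma higher_deriv_bern_prim:
  "(deriv ^^ j) (bern_prim (k + j)) z = fact (k + j) / fact k * bern_prim k z"
proof (induction j arbitrary: z)
  case (Suc j)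
  have "(deriv ^^ Suc j) (bern_prim (k + Suc j)) z = (deriv ^^ j) (deriv (bern_prim (Suc (k + j)))) z"
    by (simp add: funpow_swap1)
  also have "deriv (bern_prim (Suc (k + j))) = (\<lambda>z. of_nat (Suc (k + j)) * bern_prim (k + j) z)"
    using bern_prim_Suc_has_deriv by (intro ext DERIV_imp_deriv)
  also have "(deriv ^^ j) \<dots> z = of_nat (Suc (k + j)) * (deriv ^^ j) (bern_prim (k + j)) z"
    by (rule higher_deriv_cmult[OF bern_prim_holomorphic[of _ UNIV]]) auto
  finally show ?case by (simp only: Suc) simp
qed simp

lemma higher_deriv_bern_prim_top: "(deriv ^^ Suc k) (bern_prim k) z = fact k / (2 * of_real pi * \<i>)"
proof -
  have "(deriv ^^ k) (bern_prim k) = (\<lambda>z. fact k * bern_prim 0 z)"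
    using higher_deriv_bern_prim[of k 0] by auto
  then have "(deriv ^^ Suc k) (bern_prim k) z = deriv (\<lambda>z. fact k * bern_prim 0 z) z"
    by simp
  also have "\<dots> = fact k * (bernc 0 (z / (2 * of_real pi * \<i>)) / (2 * of_real pi * \<i>))"
    using DERIV_cmult[OF bern_prim_has_deriv[of 0 z], of "fact k"] by (intro DERIV_imp_deriv) simp
  finally show ?thesis by (simp add: bernc_def)
qed

lemma power_le_fact_exp:
  fixes x :: real
  assumes "x \<ge> 0"
  shows "x ^ j \<le> fact j * exp x"
proof -
  have "(\<Sum>n\<in>{j}. inverse (fact n) * x ^ n) \<le> (\<Sum>n. inverse (fact n) * x ^ n)"
    using assms by (intro sum_le_suminf summable_exp) auto
  then have "inverse (fact j) * x ^ j \<le> exp x"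
    by (simp add: exp_def scaleR_conv_of_real)
  then show ?thesis by (simp add: field_simps)
qed

lemma bern_prim_bound:
  "\<exists>D. \<forall>z. \<bar>Im z\<bar> \<le> h \<longrightarrow> cmod (bern_prim k z) \<le> D * exp \<bar>Re z\<bar>"
proof -
  let ?p = "2 * of_real pi * \<i>"
  define e where "e j = ?p ^ k / of_nat (Suc k) * of_nat (Suc k choose j) * of_real (bernoulli (Suc k - j)) / ?p ^ j" for j
  have eq: "bern_prim k z = (\<Sum>j\<le>Suc k. e j * z ^ j)" for z
    unfolding bern_prim_def bernc_def e_def sum_distrib_left sum_divide_distrib
    by (intro sum.cong refl) (simp add: power_divide mult.commute del: of_nat_Suc binomial_Suc_Suc)
  define D where "D = (\<Sum>j\<le>Suc k. cmod (e j) * (fact j * exp h))"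
  have "cmod (bern_prim k z) \<le> D * exp \<bar>Re z\<bar>" if z: "\<bar>Im z\<bar> \<le> h" for z
  proof -
    have "cmod (bern_prim k z) \<le> (\<Sum>j\<le>Suc k. cmod (e j) * (fact j * exp h) * exp \<bar>Re z\<bar>)"
      unfolding eq
    proof (rule sum_norm_le)
      fix j
      have "cmod z \<le> \<bar>Re z\<bar> + h" using cmod_le[of z] z by linarith
      then have "fact j * exp (cmod z) \<le> fact j * (exp h * exp \<bar>Re z\<bar>)"
        by (simp add: exp_add[symmetric] add.commute)
      then have "cmod z ^ j \<le> fact j * (exp h * exp \<bar>Re z\<bar>)"
        by (rule order_trans[OF power_le_fact_exp[OF norm_ge_zero]])
      then have "cmod (e j) * cmod z ^ j \<le> cmod (e j) * (fact j * (exp h * exp \<bar>Re z\<bar>))"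
        by (rule mult_left_mono) simp
      then show "norm (e j * z ^ j) \<le> cmod (e j) * (fact j * exp h) * exp \<bar>Re z\<bar>"
        by (simp add: norm_mult norm_power mult.assoc)
    qed
    then show ?thesis by (simp only: D_def sum_distrib_right)
  qed
  then show ?thesis by blast
qed

section \<open>Evaluation of the moment integrals\<close>

context balanced_char
begin

lemma reg_punctured_ball:
  assumes "z \<in> ball (lattice_pt q b) (2 * pi / q)" "z \<noteq> lattice_pt q b"
  shows "reg z"
proof (rule regI, rule notI)
  fix b' :: nat and n :: int
  assume z: "z = lattice_pt q b' + 2 * of_real pi * \<i> * of_int n"
  let ?m = "int b' - int b + int q * n"
  have "z - lattice_pt q b = (2 * of_real pi * \<i> / of_nat q) * of_int ?m"
    using q by (simp add: z lattice_pt_def field_simps)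
  then have "cmod (z - lattice_pt q b) = 2 * pi / q * \<bar>real_of_int ?m\<bar>"
    by (simp add: norm_mult norm_divide del: of_int_add of_int_diff of_int_mult)
  moreover have "cmod (z - lattice_pt q b) < 2 * pi / q * 1"
    using assms(1) by (simp add: dist_norm norm_minus_commute)
  ultimately have "2 * pi / q * \<bar>real_of_int ?m\<bar> < 2 * pi / q * 1" by simp
  then have "\<bar>real_of_int ?m\<bar> < 1"
    using q by (subst (asm) mult_less_cancel_left_pos) auto
  then have "?m = 0" by linarith
  with \<open>z - lattice_pt q b = (2 * of_real pi * \<i> / of_nat q) * of_int ?m\<close> assms(2) show False by simp
qed

lemma reg_wide_strip:
  assumes "- (2 * pi / q) < Im z" "Im z < 2 * pi + 2 * pi / q" "z \<notin> lattice_pt q ` {1..<q}"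
  shows "reg z"
proof (rule regI, rule notI)
  fix b :: nat and n :: int
  assume b: "b \<in> {1..<q}" and z: "z = lattice_pt q b + 2 * of_real pi * \<i> * of_int n"
  let ?m = "int b + int q * n"
  have im: "Im z = 2 * pi / q * of_int ?m"
    using q by (simp add: z Im_lattice_pt field_simps)
  have pos: "2 * pi / q > 0" using q by simp
  have "2 * pi / q * (-1) < 2 * pi / q * of_int ?m"
    using assms(1) unfolding im[symmetric] by simp
  moreover have "2 * pi / q * of_int ?m < 2 * pi / q * (real q + 1)"
    using assms(2) q unfolding im[symmetric] by (simp add: ring_distribs)
  ultimately have "-1 < real_of_int ?m" "real_of_int ?m < real q + 1"
    by (simp_all only: mult_less_cancel_left_pos[OF pos])
  then have m: "0 \<le> ?m" "?m \<le> int q" by linarith+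
  have "n = 0"
  proof (rule ccontr)
    assume "n \<noteq> 0"
    then consider "n \<ge> 1" | "n \<le> -1" by linarith
    then show False
    proof cases
      case 1
      then have "int q * n \<ge> int q * 1" by (intro mult_left_mono) auto
      then show False using m b by simp
    next
      case 2
      then have "int q * n \<le> int q * (-1)" by (intro mult_left_mono) auto
      then show False using m b by simp
    qed
  qed
  then show False using z b assms(3) by simp
qed

lemma F_holomorphic:
  assumes "\<And>z. z \<in> S \<Longrightarrow> reg z"
  shows "F k holomorphic_on S"
  using F_has_deriv assms by (meson field_differentiable_def field_differentiable_at_within holomorphic_on_def)

text \<open>Differentiating the Laurent expansion of \<open>F\<close> term by term.\<close>

lemma F_laurent_deriv:
  assumes "z \<in> ball (lattice_pt q b) (2 * pi / q)" "z \<noteq> lattice_pt q b"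
  shows "F k z = (-1) ^ k * fact k * char_coeff q chi (int b) / (z - lattice_pt q b) ^ Suc k + (deriv ^^ k) (regular_part b) z"
  using assms
proof (induction k arbitrary: z)
  case 0
  then show ?case using F_laurent by simp
next
  case (Suc k)
  let ?p = "lattice_pt q b" and ?c = "char_coeff q chi (int b)"
  let ?B = "ball ?p (2 * pi / q)"
  have "((deriv ^^ k) (regular_part b) has_field_derivative (deriv ^^ Suc k) (regular_part b) z) (at z)"
    using Suc.prems has_field_derivative_higher_deriv[OF regular_part_holomorphic] by simp
  moreover have "((\<lambda>z. (-1) ^ k * fact k * ?c / (z - ?p) ^ Suc k) has_field_derivative
      (-1) ^ Suc k * fact (Suc k) * ?c / (z - ?p) ^ Suc (Suc k)) (at z)"
  proof -
    have nz: "z - ?p \<noteq> 0" using Suc.prems by simp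
    have "((\<lambda>z. A / (z - ?p) ^ Suc k) has_field_derivative - A * of_nat (Suc k) / (z - ?p) ^ Suc (Suc k)) (at z)" for A
    proof -
      have "((\<lambda>z. A / (z - ?p) ^ Suc k) has_field_derivative
         - (A * (of_nat (Suc k) * (z - ?p) ^ k)) / ((z - ?p) ^ Suc k * (z - ?p) ^ Suc k)) (at z)"
        using nz by (auto intro!: derivative_eq_intros simp del: power_Suc of_nat_Suc)
      moreover have "- (A * (of_nat (Suc k) * (z - ?p) ^ k)) / ((z - ?p) ^ Suc k * (z - ?p) ^ Suc k) =
         - A * of_nat (Suc k) / (z - ?p) ^ Suc (Suc k)"
      proof -
        have "- (A * (m * w ^ k)) / (w ^ Suc k * w ^ Suc k) = - A * m / w ^ Suc (Suc k)" if "w \<noteq> 0" for m w :: complex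
          using that by (simp add: divide_simps)
        then show ?thesis using nz by blast
      qed
      ultimately show ?thesis by simp
    qed
    from this[of "(-1) ^ k * fact k * ?c"] show ?thesis by (simp add: mult_ac)
  qed
  ultimately have d: "((\<lambda>z. (-1) ^ k * fact k * ?c / (z - ?p) ^ Suc k + (deriv ^^ k) (regular_part b) z) has_field_derivative
      (-1) ^ Suc k * fact (Suc k) * ?c / (z - ?p) ^ Suc (Suc k) + (deriv ^^ Suc k) (regular_part b) z) (at z)"
    by (intro DERIV_add)
  have "(F k has_field_derivative
      (-1) ^ Suc k * fact (Suc k) * ?c / (z - ?p) ^ Suc (Suc k) + (deriv ^^ Suc k) (regular_part b) z) (at z)"
    by (rule has_field_derivative_transform_within_open[OF d, of "?B - {?p}"]) (use Suc in auto)
  then show ?case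
    using F_has_deriv[OF reg_punctured_ball[OF Suc.prems]] DERIV_unique by blast
qed

text \<open>The function of the conjugate character, which on the real line is the complex conjugate of \<open>F\<close>; the
  regular part of \<open>G\<close>; and the residues of \<open>F\<close> and \<open>G\<close> at the poles.\<close>

abbreviation "G \<equiv> char_gen q (cnj_character chi)"
abbreviation "G_part \<equiv> balanced_char.regular_part q (cnj_character chi)"
abbreviation "res_F b \<equiv> char_coeff q chi (int b)"
abbreviation "res_G b \<equiv> char_coeff q (cnj_character chi) (int b)"

lemma inj_lattice_pt: "inj_on (lattice_pt q) {1..<q}"
  using q by (auto simp: inj_on_def lattice_pt_def)

text \<open>The product \<open>F G\<^sup>(\<^sup>k\<^sup>)\<close> has period \<open>2\<pi>i\<close>, so multiplying it by \<open>bern_prim k\<close> gives a function whose difference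
  between the real line and its translate is minus the integrand.\<close>

lemma moment_integral:
  shows "integrable lborel (\<lambda>x. of_real x ^ k * (F 0 (of_real x) * G k (of_real x)))"
    and "(LBINT x. of_real x ^ k * (F 0 (of_real x) * G k (of_real x))) =
      - 2 * of_real pi * \<i> * (\<Sum>b\<in>{1..<q}. residue (\<lambda>z. bern_prim k z * (F 0 z * G k z)) (lattice_pt q b))"
proof -
  interpret c: balanced_char q "cnj_character chi" by (rule balanced_char_cnj)
  let ?f = "\<lambda>z. bern_prim k z * (F 0 z * G k z)"
  obtain D where D: "\<And>z. \<bar>Im z\<bar> \<le> 2 * pi \<Longrightarrow> cmod (bern_prim k z) \<le> D * exp \<bar>Re z\<bar>"
    using bern_prim_bound by blast
  obtain A where A: "\<And>z. \<bar>Re z\<bar> \<ge> 1 \<Longrightarrow> cmod (F 0 z) \<le> A * exp (- \<bar>Re z\<bar>)"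
    using F_bound by blast
  obtain B where B: "\<And>z. \<bar>Re z\<bar> \<ge> 1 \<Longrightarrow> cmod (G k z) \<le> B * exp (- \<bar>Re z\<bar>)"
    using c.F_bound by blast
  let ?P = "lattice_pt q ` {1..<q}"
  have P: "Re z = 0 \<and> 0 < Im z \<and> Im z < 2 * pi" if "z \<in> ?P" for z
    using that q by (auto simp: Im_lattice_pt field_simps)
  have bound: "cmod (?f z) \<le> D * A * B * exp (- \<bar>Re z\<bar>)" if "1 \<le> \<bar>Re z\<bar>" "0 \<le> Im z" "Im z \<le> 2 * pi" for z
  proof -
    have "cmod (?f z) \<le> (D * exp \<bar>Re z\<bar>) * ((A * exp (- \<bar>Re z\<bar>)) * (B * exp (- \<bar>Re z\<bar>)))"
      unfolding norm_mult using that
      by (intro mult_mono D A B mult_nonneg_nonneg order_trans[OF norm_ge_zero D] order_trans[OF norm_ge_zero A]) auto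
    also have "\<dots> = D * A * B * exp (- \<bar>Re z\<bar>)"
      by (simp add: exp_minus field_simps)
    finally show ?thesis .
  qed
  have holo: "?f holomorphic_on {z. - (2 * pi / q) < Im z \<and> Im z < 2 * pi + 2 * pi / q} - ?P"
    by (intro holomorphic_on_mult bern_prim_holomorphic F_holomorphic c.F_holomorphic)
       (auto intro!: reg_wide_strip c.reg_wide_strip)
  have dpos: "2 * pi / q > 0" using q by simp
  note S = strip_integral_residues[OF _ P _ dpos holo bound]
  have per: "?f (of_real x) - ?f (of_real x + \<i> * of_real (2 * pi)) =
     - (of_real x ^ k * (F 0 (of_real x) * G k (of_real x)))" for x
  proof -
    have e: "of_real x + \<i> * of_real (2 * pi) = of_real x + 2 * of_real pi * \<i>" by simp
    have "?f (of_real x) - ?f (of_real x + \<i> * of_real (2 * pi)) =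
      - ((bern_prim k (of_real x + 2 * of_real pi * \<i>) - bern_prim k (of_real x)) * (F 0 (of_real x) * G k (of_real x)))"
      unfolding e F_periodic c.F_periodic by (simp add: algebra_simps)
    then show ?thesis by (simp only: bern_prim_shift)
  qed
  have int: "integrable lborel (\<lambda>x. ?f (of_real x))" "integrable lborel (\<lambda>x. ?f (of_real x + \<i> * of_real (2 * pi)))"
    by (rule S(1); simp) (rule S(2); simp)
  have "integrable lborel (\<lambda>x. - (?f (of_real x) - ?f (of_real x + \<i> * of_real (2 * pi))))"
    by (intro Bochner_Integration.integrable_minus Bochner_Integration.integrable_diff int)
  then show "integrable lborel (\<lambda>x. of_real x ^ k * (F 0 (of_real x) * G k (of_real x)))"
    unfolding per by simp
  have "(LBINT x. of_real x ^ k * (F 0 (of_real x) * G k (of_real x))) =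
     (LBINT x. - (?f (of_real x) - ?f (of_real x + \<i> * of_real (2 * pi))))"
    unfolding per by simp
  also have "\<dots> = - ((LBINT x. ?f (of_real x)) - (LBINT x. ?f (of_real x + \<i> * of_real (2 * pi))))"
    using int by simp
  also have "(LBINT x. ?f (of_real x)) - (LBINT x. ?f (of_real x + \<i> * of_real (2 * pi))) =
     2 * of_real pi * \<i> * (\<Sum>p\<in>?P. residue ?f p)"
    by (rule S(3)) auto
  also have "(\<Sum>p\<in>?P. residue ?f p) = (\<Sum>b\<in>{1..<q}. residue ?f (lattice_pt q b))"
    using sum.reindex[OF inj_lattice_pt, of "residue ?f"] by (simp only: o_def)
  finally show "(LBINT x. of_real x ^ k * (F 0 (of_real x) * G k (of_real x))) =
      - 2 * of_real pi * \<i> * (\<Sum>b\<in>{1..<q}. residue ?f (lattice_pt q b))"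
    by simp
qed

lemma moment_residue:
  "residue (\<lambda>z. bern_prim k z * (F 0 z * G k z)) (lattice_pt q b) =
     res_F b * res_G b * ((-1) ^ k * fact k / of_nat (Suc k) / (2 * of_real pi * \<i>))
     + res_G b * ((-1) ^ k * (\<Sum>j\<le>k. of_nat (k choose j) * fact k / fact j *
          (bern_prim j (lattice_pt q b) * (deriv ^^ j) (regular_part b) (lattice_pt q b))))
     + res_F b * (bern_prim k (lattice_pt q b) * (deriv ^^ k) (G_part b) (lattice_pt q b))"
proof -
  interpret c: balanced_char q "cnj_character chi" by (rule balanced_char_cnj)
  let ?p = "lattice_pt q b" and ?B = "ball (lattice_pt q b) (2 * pi / q)"
  have pB: "?p \<in> ?B" using q by simp
  have "residue (\<lambda>z. bern_prim k z * (F 0 z * G k z)) ?p =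
     res_F b * res_G b * ((-1) ^ k * (deriv ^^ Suc k) (bern_prim k) ?p / of_nat (Suc k))
     + res_G b * ((-1) ^ k * (deriv ^^ k) (\<lambda>z. bern_prim k z * regular_part b z) ?p)
     + res_F b * (bern_prim k ?p * (deriv ^^ k) (G_part b) ?p)"
    by (rule residue_pole_product[OF _ bern_prim_holomorphic regular_part_holomorphic c.regular_part_holomorphic F_laurent c.F_laurent_deriv])
       (use q in auto)
  also have "(deriv ^^ Suc k) (bern_prim k) ?p = fact k / (2 * of_real pi * \<i>)"
    by (rule higher_deriv_bern_prim_top)
  also have "(deriv ^^ k) (\<lambda>z. bern_prim k z * regular_part b z) ?p =
     (deriv ^^ k) (\<lambda>z. regular_part b z * bern_prim k z) ?p" by (simp add: mult.commute)
  also have "\<dots> = (\<Sum>j=0..k. of_nat (k choose j) * (deriv ^^ j) (regular_part b) ?p * (deriv ^^ (k - j)) (bern_prim k) ?p)"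
    by (rule higher_deriv_mult[OF regular_part_holomorphic bern_prim_holomorphic _ pB]) simp
  also have "\<dots> = (\<Sum>j\<le>k. of_nat (k choose j) * fact k / fact j *
          (bern_prim j ?p * (deriv ^^ j) (regular_part b) ?p))"
    unfolding atMost_atLeast0
  proof (intro sum.cong refl)
    fix j assume "j \<in> {0..k}"
    then have "(deriv ^^ (k - j)) (bern_prim k) ?p = fact k / fact j * bern_prim j ?p"
      using higher_deriv_bern_prim[of "k - j" j ?p] by simp
    then show "of_nat (k choose j) * (deriv ^^ j) (regular_part b) ?p * (deriv ^^ (k - j)) (bern_prim k) ?p =
       of_nat (k choose j) * fact k / fact j * (bern_prim j ?p * (deriv ^^ j) (regular_part b) ?p)"
      by simp
  qed
  finally show ?thesis by simp
qed

text \<open>The sum over \<open>k\<close> of the residues with Stirling weights. The contribution of the regular part of \<open>F\<close>,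
  spread over all \<open>j \<le> k\<close> by Leibniz' rule, is collected by \<open>stirling_adjoint\<close>; that of the two polar
  parts by \<open>bernc_eq_sum_stirling\<close>.\<close>

lemma stirling_moments:
  "(\<Sum>k\<le>N. of_real (noncentral_stirling (-1/2) N k) * (LBINT x. of_real x ^ k * (F 0 (of_real x) * G k (of_real x)))) =
     - (\<Sum>b\<in>{1..<q}. res_F b * res_G b) * bernc N (1/2)
     - 2 * of_real pi * \<i> * (\<Sum>b\<in>{1..<q}. \<Sum>k\<le>N. of_real (noncentral_stirling (-1/2) N k) *
        (bern_prim k (lattice_pt q b) * ((-1) ^ N * res_G b * (deriv ^^ k) (regular_part b) (lattice_pt q b)
           + res_F b * (deriv ^^ k) (G_part b) (lattice_pt q b))))"
proof -
  let ?S = "\<lambda>k. complex_of_real (noncentral_stirling (-1/2) N k)"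
  let ?p = "lattice_pt q" and ?pi = "2 * of_real pi * \<i>"
  let ?\<Phi> = "\<lambda>b j. bern_prim j (?p b) * (deriv ^^ j) (regular_part b) (?p b)"
  let ?\<Psi> = "\<lambda>b j. bern_prim j (?p b) * (deriv ^^ j) (G_part b) (?p b)"
  let ?w = "\<lambda>k j. of_nat (k choose j) * fact k / fact j :: complex"
  \<comment> \<open>Reflection by the adjoint and the link to Bernoulli polynomials, as identities of complex numbers.\<close>
  have adj: "(\<Sum>k\<le>N. ?S k * ((-1) ^ k * ?w k j)) = (-1) ^ N * ?S j" for j
    using arg_cong[OF stirling_adjoint[of N j], of complex_of_real] by simp
  have bern: "(\<Sum>k\<le>N. ?S k * ((-1) ^ k * fact k / of_nat (Suc k))) = bernc N (1/2)"
    using bernc_eq_sum_stirling[of N "-1/2"] by (simp add: scaleR_conv_of_real)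
  have "(\<Sum>k\<le>N. ?S k * (LBINT x. of_real x ^ k * (F 0 (of_real x) * G k (of_real x)))) =
     - ?pi * (\<Sum>b\<in>{1..<q}. \<Sum>k\<le>N. ?S k * residue (\<lambda>z. bern_prim k z * (F 0 z * G k z)) (?p b))"
    unfolding moment_integral(2) by (subst sum.swap) (simp add: sum_distrib_left mult_ac)
  also have "(\<Sum>b\<in>{1..<q}. \<Sum>k\<le>N. ?S k * residue (\<lambda>z. bern_prim k z * (F 0 z * G k z)) (?p b)) =
     (\<Sum>b\<in>{1..<q}. res_F b * res_G b / ?pi * bernc N (1/2) + (\<Sum>k\<le>N. ?S k * ((-1) ^ N * res_G b * ?\<Phi> b k + res_F b * ?\<Psi> b k)))"
  proof (intro sum.cong refl)
    fix b
    have "(\<Sum>k\<le>N. ?S k * residue (\<lambda>z. bern_prim k z * (F 0 z * G k z)) (?p b)) =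
       (\<Sum>k\<le>N. res_F b * res_G b / ?pi * (?S k * ((-1) ^ k * fact k / of_nat (Suc k)))
           + res_G b * (?S k * ((-1) ^ k * (\<Sum>j\<le>k. ?w k j * ?\<Phi> b j)))
           + ?S k * (res_F b * ?\<Psi> b k))"
      unfolding moment_residue by (intro sum.cong refl) (simp add: ring_distribs mult_ac del: of_nat_Suc)
    also have "\<dots> = res_F b * res_G b / ?pi * bernc N (1/2) + res_G b * (\<Sum>k\<le>N. ?S k * ((-1) ^ k * (\<Sum>j\<le>k. ?w k j * ?\<Phi> b j)))
           + (\<Sum>k\<le>N. ?S k * (res_F b * ?\<Psi> b k))"
      unfolding bern[symmetric] sum_distrib_left[of "res_F b * res_G b / ?pi"] sum_distrib_left[of "res_G b"] sum.distrib ..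
    also have "(\<Sum>k\<le>N. ?S k * ((-1) ^ k * (\<Sum>j\<le>k. ?w k j * ?\<Phi> b j))) =
       (\<Sum>k\<le>N. \<Sum>j\<le>N. ?S k * ((-1) ^ k * ?w k j) * ?\<Phi> b j)"
    proof (intro sum.cong refl)
      fix k assume k: "k \<in> {..N}"
      have "(\<Sum>j\<le>k. ?w k j * ?\<Phi> b j) = (\<Sum>j\<le>N. ?w k j * ?\<Phi> b j)"
        using k by (intro sum.mono_neutral_left) (auto simp: binomial_eq_0)
      then show "?S k * ((-1) ^ k * (\<Sum>j\<le>k. ?w k j * ?\<Phi> b j)) = (\<Sum>j\<le>N. ?S k * ((-1) ^ k * ?w k j) * ?\<Phi> b j)"
        by (simp only: sum_distrib_left mult.assoc)
    qed
    also have "\<dots> = (\<Sum>j\<le>N. (-1) ^ N * ?S j * ?\<Phi> b j)"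
      by (subst sum.swap) (simp only: sum_distrib_right[symmetric] adj)
    finally show "(\<Sum>k\<le>N. ?S k * residue (\<lambda>z. bern_prim k z * (F 0 z * G k z)) (?p b)) =
       res_F b * res_G b / ?pi * bernc N (1/2) + (\<Sum>k\<le>N. ?S k * ((-1) ^ N * res_G b * ?\<Phi> b k + res_F b * ?\<Psi> b k))"
      by (simp add: sum_distrib_left sum.distrib ring_distribs mult_ac)
  qed
  also have "\<dots> = (\<Sum>b\<in>{1..<q}. res_F b * res_G b) / ?pi * bernc N (1/2) +
      (\<Sum>b\<in>{1..<q}. \<Sum>k\<le>N. ?S k * ((-1) ^ N * res_G b * ?\<Phi> b k + res_F b * ?\<Psi> b k))"
    by (simp add: sum.distrib sum_distrib_right sum_divide_distrib)
  finally show ?thesis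
    by (simp add: ring_distribs mult_ac)
qed

end


section \<open>Two-sided Laplace transforms\<close>

lemma exp_decay_add:
  assumes "exp_decay f" "exp_decay g"
  shows "exp_decay (\<lambda>x. f x + g x)"
proof -
  obtain a C where a: "a > 0" and C: "\<And>x. cmod (f x) \<le> C * exp (- (a * \<bar>x\<bar>))"
    using assms(1) unfolding exp_decay_def by blast
  obtain b D where b: "b > 0" and D: "\<And>x. cmod (g x) \<le> D * exp (- (b * \<bar>x\<bar>))"
    using assms(2) unfolding exp_decay_def by blast
  have "cmod (f x + g x) \<le> (\<bar>C\<bar> + \<bar>D\<bar>) * exp (- (min a b * \<bar>x\<bar>))" for x
  proof -
    have "C * exp (- (a * \<bar>x\<bar>)) \<le> \<bar>C\<bar> * exp (- (min a b * \<bar>x\<bar>))"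
      by (intro mult_mono) (auto intro!: mult_right_mono)
    moreover have "D * exp (- (b * \<bar>x\<bar>)) \<le> \<bar>D\<bar> * exp (- (min a b * \<bar>x\<bar>))"
      by (intro mult_mono) (auto intro!: mult_right_mono)
    ultimately show ?thesis
      using C[of x] D[of x] norm_triangle_ineq[of "f x" "g x"] unfolding ring_distribs by linarith
  qed
  then show ?thesis unfolding exp_decay_def using a b by (meson min_less_iff_conj)
qed

lemma exp_decay_scaleR:
  assumes "exp_decay f"
  shows "exp_decay (\<lambda>x. r *\<^sub>R f x)"
proof -
  obtain a C where a: "a > 0" and C: "\<And>x. cmod (f x) \<le> C * exp (- (a * \<bar>x\<bar>))"
    using assms(1) unfolding exp_decay_def by blast
  have "cmod (r *\<^sub>R f x) \<le> (\<bar>r\<bar> * C) * exp (- (a * \<bar>x\<bar>))" for x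
    using mult_left_mono[OF C[of x], of "\<bar>r\<bar>"] by simp
  then show ?thesis unfolding exp_decay_def using a by blast
qed

lemma exp_decay_sum:
  assumes "\<And>i. i \<in> A \<Longrightarrow> exp_decay (f i)"
  shows "exp_decay (\<lambda>x. \<Sum>i\<in>A. f i x)"
  using assms
proof (induction A rule: infinite_finite_induct)
  case (insert i A)
  then show ?case by (simp add: exp_decay_add)
next
  case empty
  have "cmod 0 \<le> 0 * exp (- (1 * \<bar>x\<bar>))" for x :: real by simp
  then show ?case unfolding exp_decay_def sum.empty using zero_less_one by blast
next
  case (infinite A)
  have "cmod 0 \<le> 0 * exp (- (1 * \<bar>x\<bar>))" for x :: real by simp
  then show ?case unfolding exp_decay_def sum.infinite[OF infinite(1)] using zero_less_one by blast
qed

lemma power_le_exp_scaled: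
  fixes x a :: real
  assumes "a > 0" "x \<ge> 0"
  shows "x ^ j \<le> fact j / a ^ j * exp (a * x)"
proof -
  have "(a * x) ^ j \<le> fact j * exp (a * x)"
    using assms by (intro power_le_fact_exp) simp
  then show ?thesis using assms(1) by (simp add: power_mult_distrib field_simps)
qed

definition laplace :: "(real \<Rightarrow> complex) \<Rightarrow> complex \<Rightarrow> complex" where
  "laplace g s = (LBINT u. g u * exp (of_real u * s))"

text \<open>The remainder estimate \<open>|exp z - 1 - z| \<le> |z|\<^sup>2 exp |Re z|\<close> bounds the error of the difference quotient by
  a multiple of the increment, because the integrand still decays exponentially after multiplication
  by \<open>u\<^sup>2\<close> and by an exponential of smaller rate.\<close>

lemma laplace_has_deriv:
  assumes cont: "continuous_on UNIV g" and dec: "exp_decay (\<lambda>u. g u * exp (of_real u * s))"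
  shows "\<exists>D. (laplace g has_field_derivative D) (at s)"
proof -
  obtain a C where a: "a > 0" and C: "\<And>u. cmod (g u * exp (of_real u * s)) \<le> C * exp (- (a * \<bar>u\<bar>))"
    using dec unfolding exp_decay_def by blast
  have C0: "C \<ge> 0" using order_trans[OF norm_ge_zero C[of 0]] by simp
  let ?e = "\<lambda>u. g u * exp (of_real u * s)"
  \<comment> \<open>Of the decay rate \<open>a\<close>, a quarter pays for \<open>u\<^sup>2\<close> and a quarter for the increment of the exponent.\<close>
  define K where "K = C * (fact 2 / (a / 4)\<^sup>2)"
  have K: "cmod (?e u) * (\<bar>u\<bar>\<^sup>2 * exp (\<bar>u\<bar> * (a / 4))) \<le> K * exp (- (a / 2 * \<bar>u\<bar>))" for u
  proof -
    have "\<bar>u\<bar>\<^sup>2 \<le> fact 2 / (a / 4)\<^sup>2 * exp (a / 4 * \<bar>u\<bar>)"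
      using a by (intro power_le_exp_scaled) auto
    then have "cmod (?e u) * (\<bar>u\<bar>\<^sup>2 * exp (\<bar>u\<bar> * (a / 4))) \<le>
      (C * exp (- (a * \<bar>u\<bar>))) * ((fact 2 / (a / 4)\<^sup>2 * exp (a / 4 * \<bar>u\<bar>)) * exp (\<bar>u\<bar> * (a / 4)))"
      using C C0 by (intro mult_mono) auto
    also have "\<dots> = K * (exp (- (a * \<bar>u\<bar>)) * exp (a / 4 * \<bar>u\<bar>) * exp (\<bar>u\<bar> * (a / 4)))"
      by (simp add: K_def)
    also have "exp (- (a * \<bar>u\<bar>)) * exp (a / 4 * \<bar>u\<bar>) * exp (\<bar>u\<bar> * (a / 4)) = exp (- (a / 2 * \<bar>u\<bar>))"
      by (simp flip: exp_add)
    finally show ?thesis .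
  qed
  have cont_e: "continuous_on UNIV (\<lambda>u. g u * exp (of_real u * z))" for z
    by (intro continuous_intros cont)
  have int_near: "integrable lborel (\<lambda>u. g u * exp (of_real u * (s + h)))" if h: "cmod h \<le> a / 2" for h
  proof (rule exp_decay_integrable[OF _ cont_e])
    have "cmod (g u * exp (of_real u * (s + h))) \<le> C * exp (- (a / 2 * \<bar>u\<bar>))" for u
    proof -
      have "u * Re h \<le> \<bar>u\<bar> * \<bar>Re h\<bar>" by (simp flip: abs_mult)
      also have "\<dots> \<le> \<bar>u\<bar> * cmod h" by (intro mult_left_mono abs_Re_le_cmod) auto
      also have "\<dots> \<le> \<bar>u\<bar> * (a / 2)" using h by (intro mult_left_mono) auto
      finally have e: "exp (u * Re h) \<le> exp (\<bar>u\<bar> * (a / 2))" by simp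
      have "cmod (g u * exp (of_real u * (s + h))) = cmod (?e u) * exp (u * Re h)"
        by (simp add: norm_mult ring_distribs exp_add)
      also have "\<dots> \<le> (C * exp (- (a * \<bar>u\<bar>))) * exp (\<bar>u\<bar> * (a / 2))"
        using C C0 e by (intro mult_mono) auto
      also have "\<dots> = C * (exp (- (a * \<bar>u\<bar>)) * exp (\<bar>u\<bar> * (a / 2)))" by simp
      also have "exp (- (a * \<bar>u\<bar>)) * exp (\<bar>u\<bar> * (a / 2)) = exp (- (a / 2 * \<bar>u\<bar>))"
        by (simp flip: exp_add)
      finally show ?thesis .
    qed
    then show "exp_decay (\<lambda>u. g u * exp (of_real u * (s + h)))"
      unfolding exp_decay_def using a by (meson half_gt_zero)
  qed
  have int0: "integrable lborel ?e" using int_near[of 0] a by simp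
  have int1: "integrable lborel (\<lambda>u. of_real u * ?e u)"
  proof (rule exp_decay_integrable)
    show "continuous_on UNIV (\<lambda>u. of_real u * ?e u)"
      by (intro continuous_intros cont)
    have "cmod (of_real u * ?e u) \<le> (C * (fact 1 / (a / 2) ^ 1)) * exp (- (a / 2 * \<bar>u\<bar>))" for u
    proof -
      have "\<bar>u\<bar> ^ 1 \<le> fact 1 / (a / 2) ^ 1 * exp (a / 2 * \<bar>u\<bar>)"
        using a by (intro power_le_exp_scaled) auto
      then have "cmod (?e u) * \<bar>u\<bar> ^ 1 \<le> (C * exp (- (a * \<bar>u\<bar>))) * (fact 1 / (a / 2) ^ 1 * exp (a / 2 * \<bar>u\<bar>))"
        using C C0 by (intro mult_mono) auto
      also have "\<dots> = (C * (fact 1 / (a / 2) ^ 1)) * (exp (- (a * \<bar>u\<bar>)) * exp (a / 2 * \<bar>u\<bar>))" by simp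
      also have "exp (- (a * \<bar>u\<bar>)) * exp (a / 2 * \<bar>u\<bar>) = exp (- (a / 2 * \<bar>u\<bar>))"
        by (simp flip: exp_add)
      finally show ?thesis by (simp add: norm_mult mult.commute)
    qed
    then show "exp_decay (\<lambda>u. of_real u * ?e u)"
      unfolding exp_decay_def using a by (meson half_gt_zero)
  qed
  define D where "D = (LBINT u. of_real u * ?e u)"
  define I where "I = (LBINT u. K * exp (- (a / 2 * \<bar>u\<bar>)))"
  have quot: "cmod ((laplace g (s + h) - laplace g s) / h - D) \<le> I * cmod h"
    if h: "h \<noteq> 0" "cmod h \<le> a / 4" for h
  proof -
    have "laplace g (s + h) - laplace g s - h * D =
      (LBINT u. g u * exp (of_real u * (s + h)) - ?e u - h * (of_real u * ?e u))"
      unfolding laplace_def D_def using int_near[of h] int0 int1 h a by simp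
    also have "\<dots> = (LBINT u. ?e u * (exp (of_real u * h) - 1 - of_real u * h))"
      by (intro Bochner_Integration.integral_cong refl) (simp add: ring_distribs exp_add algebra_simps)
    finally have e: "laplace g (s + h) - laplace g s - h * D = (LBINT u. ?e u * (exp (of_real u * h) - 1 - of_real u * h))" .
    have "cmod (laplace g (s + h) - laplace g s - h * D) \<le> (LBINT u. cmod h ^ 2 * (K * exp (- (a / 2 * \<bar>u\<bar>))))"
      unfolding e
    proof (rule Bochner_Integration.integral_norm_bound_integral)
      have "integrable lborel (\<lambda>u. g u * exp (of_real u * (s + h)) - ?e u - h * (of_real u * ?e u))"
        using int_near[of h] int0 int1 h a by (intro Bochner_Integration.integrable_diff integrable_mult_right) auto
      then show "integrable lborel (\<lambda>u. ?e u * (exp (of_real u * h) - 1 - of_real u * h))"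
        by (simp add: ring_distribs exp_add algebra_simps)
      show "integrable lborel (\<lambda>u. cmod h ^ 2 * (K * exp (- (a / 2 * \<bar>u\<bar>))))"
        using a by (intro integrable_mult_right integrable_exp_abs) simp
      fix u
      have "cmod (exp (of_real u * h) - 1 - of_real u * h) \<le> exp \<bar>Re (of_real u * h)\<bar> * cmod (of_real u * h) ^ 2"
        using Taylor_exp[of "of_real u * h" 1] by (simp add: algebra_simps power2_eq_square)
      also have "\<dots> \<le> exp (\<bar>u\<bar> * (a / 4)) * cmod (of_real u * h) ^ 2"
      proof -
        have "\<bar>Re h\<bar> \<le> a / 4" using abs_Re_le_cmod[of h] h(2) by linarith
        then have "\<bar>u\<bar> * \<bar>Re h\<bar> \<le> \<bar>u\<bar> * (a / 4)" by (intro mult_left_mono) auto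
        then show ?thesis by (intro mult_right_mono) (auto simp: abs_mult)
      qed
      finally have "cmod (?e u) * cmod (exp (of_real u * h) - 1 - of_real u * h) \<le>
        cmod (?e u) * (exp (\<bar>u\<bar> * (a / 4)) * cmod (of_real u * h) ^ 2)"
        by (intro mult_left_mono) auto
      also have "\<dots> = cmod h ^ 2 * (cmod (?e u) * (\<bar>u\<bar>\<^sup>2 * exp (\<bar>u\<bar> * (a / 4))))"
        by (simp add: norm_mult power_mult_distrib mult_ac)
      also have "\<dots> \<le> cmod h ^ 2 * (K * exp (- (a / 2 * \<bar>u\<bar>)))"
        by (intro mult_left_mono K) auto
      finally show "norm (?e u * (exp (of_real u * h) - 1 - of_real u * h)) \<le> cmod h ^ 2 * (K * exp (- (a / 2 * \<bar>u\<bar>)))"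
        by (simp add: norm_mult)
    qed
    then have "cmod (laplace g (s + h) - laplace g s - h * D) \<le> cmod h ^ 2 * I"
      by (simp only: integral_mult_right_zero I_def)
    moreover have "(laplace g (s + h) - laplace g s) / h - D = (laplace g (s + h) - laplace g s - h * D) / h"
      using h by (simp add: diff_divide_distrib)
    ultimately show ?thesis
      using h by (simp add: norm_divide divide_simps power2_eq_square mult_ac)
  qed
  have "((\<lambda>h. (laplace g (s + h) - laplace g s) / h - D) \<longlongrightarrow> 0) (at 0)"
  proof (rule Lim_null_comparison)
    have "eventually (\<lambda>h. h \<in> ball 0 (a / 4) - {0}) (at (0::complex))"
      using a by (intro eventually_at_in_open) auto
    then show "\<forall>\<^sub>F h in at 0. norm ((laplace g (s + h) - laplace g s) / h - D) \<le> I * cmod h"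
      by eventually_elim (intro quot, auto)
    have "((\<lambda>h. I * cmod h) \<longlongrightarrow> I * cmod 0) (at (0::complex))"
      by (intro tendsto_intros)
    then show "((\<lambda>h. I * cmod h) \<longlongrightarrow> 0) (at (0::complex))" by simp
  qed
  then have "((\<lambda>h. (laplace g (s + h) - laplace g s) / h) \<longlongrightarrow> D) (at 0)"
    by (simp only: LIM_zero_iff)
  then show ?thesis by (auto simp: DERIV_def)
qed

lemma laplace_derivative:
  assumes g: "\<And>u. (g has_vector_derivative g' u) (at u)" "continuous_on UNIV g'"
    and dec: "exp_decay (\<lambda>u. g u * exp (of_real u * s))" "exp_decay (\<lambda>u. g' u * exp (of_real u * s))"
  shows "laplace g' s = - s * laplace g s"
proof -
  let ?e = "\<lambda>u. exp (of_real u * s)"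
  have contg: "continuous_on UNIV g"
    using g(1) by (meson continuous_on_eq_continuous_within has_vector_derivative_continuous has_vector_derivative_at_within)
  have int: "integrable lborel (\<lambda>u. g u * ?e u)" "integrable lborel (\<lambda>u. g' u * ?e u)"
    by (intro exp_decay_integrable dec continuous_intros contg g)+
  have "(LBINT u. g' u * ?e u + s * (g u * ?e u)) = 0"
  proof (rule integral_derivative_eq_0[OF _ _ _ dec(1)])
    show "((\<lambda>u. g u * ?e u) has_vector_derivative g' u * ?e u + s * (g u * ?e u)) (at u)" for u
    proof -
      have "((\<lambda>z. exp (z * s)) has_field_derivative s * exp (of_real u * s)) (at (of_real u))"
        by (auto intro!: derivative_eq_intros)
      from has_vector_derivative_mult[OF g(1) has_vector_derivative_real_field[OF this]] show ?thesis
        by (simp add: mult_ac add.commute)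
    qed
    show "continuous_on UNIV (\<lambda>u. g' u * ?e u + s * (g u * ?e u))"
      by (intro continuous_intros contg g)
    show "integrable lborel (\<lambda>u. g' u * ?e u + s * (g u * ?e u))"
      using int by simp
  qed
  then show ?thesis
    using int by (simp add: laplace_def add_eq_0_iff)
qed

text \<open>The substitution \<open>x = exp (u + a)\<close>, from the line to the positive half line. The shift \<open>a\<close> absorbs a
  dilation of \<open>x\<close>.\<close>

lemma lborel_integral_exp_subst:
  fixes \<phi> :: "real \<Rightarrow> complex"
  assumes int: "integrable lborel (\<lambda>u. exp (u + a) *\<^sub>R \<phi> (exp (u + a)))"
  shows "\<phi> absolutely_integrable_on {0<..}"
    and "(LBINT u. exp (u + a) *\<^sub>R \<phi> (exp (u + a))) = integral {0<..} \<phi>"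
proof -
  have im: "(\<lambda>u. exp (u + a)) ` UNIV = {0::real<..}"
  proof (intro equalityI subsetI)
    fix x :: real assume "x \<in> {0<..}"
    then have "x = exp ((ln x - a) + a)" by simp
    then show "x \<in> (\<lambda>u. exp (u + a)) ` UNIV" by blast
  qed auto
  have "(\<lambda>u. exp (u + a) *\<^sub>R \<phi> (exp (u + a))) absolutely_integrable_on UNIV"
    using int by (simp add: set_integrable_def integrable_completion)
  then have "(\<lambda>u. \<bar>exp (u + a)\<bar> *\<^sub>R \<phi> (exp (u + a))) absolutely_integrable_on UNIV \<and>
     integral UNIV (\<lambda>u. \<bar>exp (u + a)\<bar> *\<^sub>R \<phi> (exp (u + a))) = (LBINT u. exp (u + a) *\<^sub>R \<phi> (exp (u + a)))"
    using integral_lborel[OF int] by simp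
  then have "\<phi> absolutely_integrable_on (\<lambda>u. exp (u + a)) ` UNIV \<and>
     integral ((\<lambda>u. exp (u + a)) ` UNIV) \<phi> = (LBINT u. exp (u + a) *\<^sub>R \<phi> (exp (u + a)))"
    by (subst (asm) has_absolute_integral_change_of_variables_real)
       (auto intro!: derivative_eq_intros simp: inj_on_def)
  then show "\<phi> absolutely_integrable_on {0<..}" "(LBINT u. exp (u + a) *\<^sub>R \<phi> (exp (u + a))) = integral {0<..} \<phi>"
    unfolding im by auto
qed

lemma exp_neg_exp_le:
  fixes u :: real
  shows "exp (- exp u) \<le> fact m * exp (- (real m * u))"
proof -
  have "exp u ^ m \<le> fact m * exp (exp u)" by (rule power_le_fact_exp) simp
  then show ?thesis
    by (simp add: exp_minus exp_of_nat_mult[symmetric] field_simps)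
qed

text \<open>After the substitution \<open>x = exp u\<close>, a function that decays like \<open>exp (-x)\<close> beats every power of \<open>x\<close> at
  \<open>+\<infinity>\<close>, and the factor \<open>exp (u * s)\<close> provides the decay at \<open>-\<infinity>\<close>.\<close>

lemma exp_decay_cutoff:
  fixes g :: "real \<Rightarrow> complex"
  assumes bdd: "\<And>u. u \<le> 0 \<Longrightarrow> cmod (g u) \<le> M" and dec: "\<And>u. u \<ge> 0 \<Longrightarrow> cmod (g u) \<le> C * exp (- exp u)"
    and s: "Re s > 0"
  shows "exp_decay (\<lambda>u. g u * exp (of_real u * s))"
proof -
  define \<sigma> where "\<sigma> = Re s"
  define a where "a = min 1 \<sigma>"
  \<comment> \<open>The power of \<open>x = exp u\<close> that is spent against \<open>exp (-x)\<close>; it has to exceed the growth of \<open>exp (u * s)\<close>.\<close>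
  obtain m :: nat where m: "\<sigma> + 1 \<le> real m" using real_arch_simple by blast
  have "cmod (g u * exp (of_real u * s)) \<le> (\<bar>M\<bar> + \<bar>C\<bar> * fact m) * exp (- (a * \<bar>u\<bar>))" for u
  proof (cases "u \<ge> 0")
    case True
    have "cmod (g u * exp (of_real u * s)) \<le> (\<bar>C\<bar> * exp (- exp u)) * exp (u * \<sigma>)"
      using dec[OF True] unfolding norm_mult \<sigma>_def
      by (intro mult_mono) (auto intro: order_trans[OF _ mult_right_mono[OF abs_ge_self]])
    also have "\<dots> \<le> (\<bar>C\<bar> * (fact m * exp (- (real m * u)))) * exp (u * \<sigma>)"
      by (intro mult_right_mono mult_left_mono exp_neg_exp_le) auto
    also have "\<dots> = \<bar>C\<bar> * fact m * exp (- ((real m - \<sigma>) * u))"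
      by (simp add: exp_add[symmetric] algebra_simps)
    also have "\<dots> \<le> (\<bar>M\<bar> + \<bar>C\<bar> * fact m) * exp (- (a * \<bar>u\<bar>))"
    proof (rule mult_mono)
      have "a * u \<le> (real m - \<sigma>) * u" using m True by (intro mult_right_mono) (auto simp: a_def)
      then show "exp (- ((real m - \<sigma>) * u)) \<le> exp (- (a * \<bar>u\<bar>))" using True by simp
    qed auto
    finally show ?thesis .
  next
    case False
    have "cmod (g u * exp (of_real u * s)) \<le> \<bar>M\<bar> * exp (u * \<sigma>)"
      using bdd[of u] False unfolding norm_mult \<sigma>_def by (intro mult_mono) auto
    also have "\<dots> \<le> (\<bar>M\<bar> + \<bar>C\<bar> * fact m) * exp (- (a * \<bar>u\<bar>))"
    proof (rule mult_mono)
      have "a * (- u) \<le> \<sigma> * (- u)" using False by (intro mult_right_mono) (auto simp: a_def)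
      then show "exp (u * \<sigma>) \<le> exp (- (a * \<bar>u\<bar>))" using False by (simp add: mult.commute)
    qed auto
    finally show ?thesis .
  qed
  moreover have "a > 0" using s by (simp add: a_def \<sigma>_def)
  ultimately show ?thesis unfolding exp_decay_def by blast
qed

text \<open>Euler's integral for the Gamma function, with \<open>t = (n + 1) exp u\<close>.\<close>

lemma laplace_exp_exp:
  assumes s: "Re s > 0"
  shows "exp_decay (\<lambda>u. exp (- of_nat (Suc n) * of_real (exp u)) * exp (of_real u * s))"
    and "laplace (\<lambda>u. exp (- of_nat (Suc n) * of_real (exp u))) s = Gamma s * of_nat (Suc n) powr (- s)"
proof -
  let ?g = "\<lambda>u::real. exp (- of_nat (Suc n) * complex_of_real (exp u))"
  \<comment> \<open>The dilation by \<open>n + 1\<close> as a shift of \<open>u\<close>.\<close>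
  define a where "a = ln (real (Suc n))"
  have ea: "exp a = real (Suc n)" by (simp add: a_def)
  have norm_g: "cmod (?g u) = exp (- (real (Suc n) * exp u))" for u by (simp add: algebra_simps)
  have le: "exp u \<le> real (Suc n) * exp u" for u :: real
    using mult_right_mono[of 1 "real (Suc n)" "exp u"] by simp
  show dec: "exp_decay (\<lambda>u. ?g u * exp (of_real u * s))"
    by (rule exp_decay_cutoff[of _ 1 1]) (use le s in \<open>auto simp: norm_g simp del: of_nat_Suc\<close>)
  define \<phi> where "\<phi> = (\<lambda>t. complex_of_real t powr (s - 1) / of_real (exp t))"
  have eq: "exp (u + a) *\<^sub>R \<phi> (exp (u + a)) = of_nat (Suc n) powr s * (?g u * exp (of_real u * s))" for u
  proof -
    have p: "complex_of_real (exp v) powr z = exp (of_real v * z)" for v z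
      by (simp add: powr_def mult.commute flip: exp_of_real)
    have nn: "of_nat (Suc n) = complex_of_real (exp a)" by (simp add: ea)
    have "exp (u + a) *\<^sub>R \<phi> (exp (u + a)) =
      (complex_of_real (exp (u + a)) powr 1 * complex_of_real (exp (u + a)) powr (s - 1)) * exp (- of_real (exp (u + a)))"
      by (simp add: \<phi>_def scaleR_conv_of_real exp_minus exp_of_real field_simps)
    also have "complex_of_real (exp (u + a)) powr 1 * complex_of_real (exp (u + a)) powr (s - 1) =
       complex_of_real (exp (u + a)) powr s"
      by (simp only: p) (simp add: exp_add[symmetric] algebra_simps)
    also have "complex_of_real (exp (u + a)) powr s = of_nat (Suc n) powr s * exp (of_real u * s)"
      unfolding nn p by (simp add: exp_add[symmetric] algebra_simps)
    also have "exp (- complex_of_real (exp (u + a))) = ?g u"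
      unfolding nn by (simp add: exp_add mult.commute)
    finally show ?thesis by (simp add: mult_ac)
  qed
  have "continuous_on UNIV (\<lambda>u. ?g u * exp (of_real u * s))"
    by (intro continuous_intros)
  then have int: "integrable lborel (\<lambda>u. ?g u * exp (of_real u * s))"
    using dec by (rule exp_decay_integrable[rotated])
  have "of_nat (Suc n) powr s * laplace ?g s = (LBINT u. exp (u + a) *\<^sub>R \<phi> (exp (u + a)))"
    unfolding eq laplace_def by simp
  also have "\<dots> = integral {0<..} \<phi>"
    by (rule lborel_integral_exp_subst(2)) (unfold eq, intro integrable_mult_right int)
  also have "\<dots> = Gamma s"
    using Gamma_integral_complex'[OF s] unfolding \<phi>_def by (rule integral_unique)
  finally have "of_nat (Suc n) powr s * laplace ?g s = Gamma s" .
  moreover have "of_nat (Suc n) powr s \<noteq> (0 :: complex)"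
    by (simp del: of_nat_Suc)
  ultimately show "laplace ?g s = Gamma s * of_nat (Suc n) powr (- s)"
    by (simp add: powr_minus field_simps del: of_nat_Suc)
qed

section \<open>Analytic continuation of the L-function\<close>

context balanced_char
begin

definition Fexp :: "nat \<Rightarrow> real \<Rightarrow> complex" where
  "Fexp k u = F k (of_real (exp u))"

lemma F_of_real_continuous: "continuous_on UNIV (\<lambda>x. F k (of_real x))"
proof -
  have "((\<lambda>x. F k (of_real x)) has_vector_derivative F (Suc k) (of_real x)) (at x)" for x
    by (rule has_vector_derivative_real_field[OF F_has_deriv[OF reg_of_real]])
  then show ?thesis
    by (meson continuous_on_eq_continuous_within has_vector_derivative_continuous has_vector_derivative_at_within)
qed

lemma Fexp_has_deriv: "(Fexp k has_vector_derivative of_real (exp u) * Fexp (Suc k) u) (at u)"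
proof -
  have "((\<lambda>z. F k (exp z)) has_field_derivative F (Suc k) (exp (of_real u)) * exp (of_real u)) (at (of_real u))"
    by (rule DERIV_chain2[OF F_has_deriv]) (auto intro!: derivative_eq_intros reg_of_real simp: exp_of_real)
  from has_vector_derivative_real_field[OF this] show ?thesis
    by (simp add: Fexp_def[abs_def] exp_of_real mult.commute)
qed

lemma Fexp_continuous: "continuous_on UNIV (Fexp k)"
  unfolding Fexp_def[abs_def]
  by (rule continuous_on_compose2[OF F_of_real_continuous]) (auto intro!: continuous_intros)

lemma Fexp_decay:
  assumes "Re s > 0"
  shows "exp_decay (\<lambda>u. Fexp k u * exp (of_real u * s))"
proof -
  obtain C where C: "\<And>z. \<bar>Re z\<bar> \<ge> 1 \<Longrightarrow> cmod (F k z) \<le> C * exp (- \<bar>Re z\<bar>)"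
    using F_bound by blast
  have "compact ((\<lambda>x. F k (of_real x)) ` {0..1})"
    by (intro compact_continuous_image continuous_on_subset[OF F_of_real_continuous]) auto
  then have "bounded ((\<lambda>x. F k (of_real x)) ` {0..1})" by (rule compact_imp_bounded)
  then obtain M where M: "\<And>x. x \<in> {0..1} \<Longrightarrow> cmod (F k (of_real x)) \<le> M"
    unfolding bounded_iff by blast
  show ?thesis
  proof (rule exp_decay_cutoff[of _ M C, OF _ _ assms])
    show "cmod (Fexp k u) \<le> M" if "u \<le> 0" for u
      unfolding Fexp_def using that by (intro M) auto
    show "cmod (Fexp k u) \<le> C * exp (- exp u)" if "u \<ge> 0" for u
      using C[of "of_real (exp u)"] that by (simp add: Fexp_def)
  qed
qed

text \<open>Integration by parts in the Mellin integral of \<open>F\<close>.\<close>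

lemma laplace_Fexp_Suc:
  assumes s: "Re s > 0"
  shows "laplace (Fexp (Suc k)) (s + 1) = - s * laplace (Fexp k) s"
proof -
  have e: "of_real (exp u) * Fexp (Suc k) u * exp (of_real u * s) = Fexp (Suc k) u * exp (of_real u * (s + 1))" for u
    by (simp add: ring_distribs exp_add mult_ac flip: exp_of_real)
  have "laplace (\<lambda>u. of_real (exp u) * Fexp (Suc k) u) s = - s * laplace (Fexp k) s"
  proof (rule laplace_derivative[OF Fexp_has_deriv _ Fexp_decay[OF s]])
    show "continuous_on UNIV (\<lambda>u. of_real (exp u) * Fexp (Suc k) u)"
      by (intro continuous_intros Fexp_continuous)
    show "exp_decay (\<lambda>u. of_real (exp u) * Fexp (Suc k) u * exp (of_real u * s))"
      unfolding e using s by (intro Fexp_decay) simp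
  qed
  then show ?thesis unfolding laplace_def e .
qed

text \<open>Up to sign, \<open>k\<close> integrations by parts in \<open>\<Gamma>(s) L(s) = \<integral>F(x) x\<^sup>s\<^sup>-\<^sup>1 dx\<close> move the integral to the \<open>k\<close>-th derivative
  and \<open>s\<close> to \<open>s + k\<close>. The integral then converges for \<open>Re s > -k\<close>.\<close>

definition L_cont :: "nat \<Rightarrow> complex \<Rightarrow> complex" where
  "L_cont k s = (-1) ^ k * rGamma (s + of_nat k) * laplace (Fexp k) (s + of_nat k)"

lemma L_cont_Suc:
  assumes "Re s > - real k"
  shows "L_cont (Suc k) s = L_cont k s"
proof -
  let ?z = "s + of_nat k"
  have "laplace (Fexp (Suc k)) (?z + 1) = - ?z * laplace (Fexp k) ?z"
    using assms by (intro laplace_Fexp_Suc) simp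
  moreover have "s + of_nat (Suc k) = ?z + 1" by simp
  ultimately have "L_cont (Suc k) s = (-1) ^ Suc k * rGamma (?z + 1) * (- ?z * laplace (Fexp k) ?z)"
    by (simp only: L_cont_def)
  also have "\<dots> = (-1) ^ k * (?z * rGamma (?z + 1)) * laplace (Fexp k) ?z"
  proof -
    have "(-1) ^ Suc k * r * (- z * l) = (-1) ^ k * (z * r) * l" for r z l :: complex by simp
    then show ?thesis .
  qed
  finally have "L_cont (Suc k) s = (-1) ^ k * (?z * rGamma (?z + 1)) * laplace (Fexp k) ?z" .
  then show ?thesis by (simp only: rGamma_plus1 L_cont_def)
qed

lemma L_cont_eq:
  assumes "Re s > - real k" "k \<le> j"
  shows "L_cont j s = L_cont k s"
  using assms(2)
proof (induction rule: dec_induct)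
  case (step n)
  then show ?case using assms(1) by (simp add: L_cont_Suc)
qed simp

lemma L_cont_differentiable:
  assumes "Re s > - real k"
  shows "L_cont k field_differentiable (at s)"
proof -
  have "\<exists>D. (laplace (Fexp k) has_field_derivative D) (at (s + of_nat k))"
    using assms by (intro laplace_has_deriv Fexp_continuous Fexp_decay) simp
  then obtain D where "(laplace (Fexp k) has_field_derivative D) (at (s + of_nat k))" ..
  then have "((\<lambda>s. laplace (Fexp k) (s + of_nat k)) has_field_derivative D * 1) (at s)"
    by (intro DERIV_chain2[of "laplace (Fexp k)" D "\<lambda>s. s + of_nat k"]) (auto intro!: derivative_eq_intros)
  then have "(\<lambda>s. laplace (Fexp k) (s + of_nat k)) field_differentiable (at s)"
    unfolding field_differentiable_def by blast
  moreover have "(\<lambda>s. rGamma (s + of_nat k)) field_differentiable (at s)"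
  proof -
    have "(\<lambda>s. rGamma (s + of_nat k)) holomorphic_on UNIV" by (intro holomorphic_intros)
    then show ?thesis by (simp add: holomorphic_on_def)
  qed
  ultimately show ?thesis
    unfolding L_cont_def[abs_def] by (intro field_differentiable_mult field_differentiable_const)
qed

text \<open>The index of \<open>L_cont\<close> is chosen such that \<open>s\<close> lies in its half plane; \<open>L_entire_eq\<close> shows that every other
  admissible index has the same value.\<close>

definition L_entire :: "complex \<Rightarrow> complex" where
  "L_entire s = L_cont (nat \<lceil>\<bar>Re s\<bar>\<rceil> + 1) s"

lemma L_entire_eq:
  assumes "Re s > - real k"
  shows "L_entire s = L_cont k s"
proof -
  define j where "j = nat \<lceil>\<bar>Re s\<bar>\<rceil> + 1"
  have j: "Re s > - real j" unfolding j_def by linarith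
  have "L_cont (max j k) s = L_cont j s" "L_cont (max j k) s = L_cont k s"
    using assms j by (intro L_cont_eq; simp)+
  then show ?thesis by (simp add: L_entire_def j_def)
qed

lemma L_entire_holomorphic: "L_entire holomorphic_on UNIV"
proof -
  have "L_entire field_differentiable (at s)" for s
  proof -
    obtain k :: nat where k: "- Re s < real k" using reals_Archimedean2 by blast
    then have k: "Re s > - real k" by linarith
    obtain D where D: "(L_cont k has_field_derivative D) (at s)"
      using L_cont_differentiable[OF k] unfolding field_differentiable_def by blast
    have "(L_entire has_field_derivative D) (at s)"
      by (rule has_field_derivative_transform_within_open[OF D, of "{s. Re s > - real k}"])
         (use k in \<open>auto simp: L_entire_eq open_halfspace_Re_gt\<close>)
    then show ?thesis unfolding field_differentiable_def by blast
  qed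
  then show ?thesis by (simp add: holomorphic_on_def)
qed

text \<open>Termwise integration of the series of \<open>F\<close>, justified by the convergence of \<open>\<Sum>n\<^sup>-\<^sup>\<sigma>\<close> for \<open>\<sigma> > 1\<close>.\<close>

lemma laplace_Fexp_0:
  assumes s: "Re s > 1"
  shows "(\<lambda>n. chi (int (Suc n)) * of_nat (Suc n) powr (- s)) sums (rGamma s * laplace (Fexp 0) s)"
proof -
  let ?g = "\<lambda>n u. exp (- of_nat (Suc n) * complex_of_real (exp u))"
  let ?f = "\<lambda>n u. chi (int (Suc n)) * (?g n u * exp (of_real u * s))"
  define \<sigma> where "\<sigma> = Re s"
  have \<sigma>: "\<sigma> > 1" using s by (simp add: \<sigma>_def)
  have int_g: "integrable lborel (\<lambda>u. ?g n u * exp (of_real u * z))" if "Re z > 0" for n z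
    using laplace_exp_exp(1)[OF that] by (rule exp_decay_integrable) (intro continuous_intros)
  have norm_g: "cmod (?g n u * exp (of_real u * s)) = Re (?g n u * exp (of_real u * of_real \<sigma>))" for n u
  proof -
    have "?g n u * exp (of_real u * of_real \<sigma>) = of_real (exp (- (real (Suc n) * exp u)) * exp (u * \<sigma>))"
      unfolding of_real_mult exp_of_real[symmetric] of_real_minus by (simp add: algebra_simps)
    then show ?thesis by (simp add: norm_mult \<sigma>_def algebra_simps del: of_nat_Suc)
  qed
  have norm_int: "(LBINT u. cmod (?g n u * exp (of_real u * s))) \<le> cmod (Gamma (of_real \<sigma>)) * real (Suc n) powr (- \<sigma>)" for n
  proof -
    have "(LBINT u. cmod (?g n u * exp (of_real u * s))) = Re (laplace (?g n) (of_real \<sigma>))"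
      unfolding norm_g laplace_def using \<sigma> int_g[of "of_real \<sigma>"] by (intro integral_Re) auto
    also have "\<dots> \<le> cmod (Gamma (of_real \<sigma>) * of_nat (Suc n) powr (- of_real \<sigma>))"
      using \<sigma> by (subst laplace_exp_exp(2)) (simp, rule complex_Re_le_cmod)
    also have "\<dots> = cmod (Gamma (of_real \<sigma>)) * real (Suc n) powr (- \<sigma>)"
      by (simp add: norm_mult norm_powr_real_powr' del: of_nat_Suc)
    finally show ?thesis .
  qed
  have "(\<lambda>n. LBINT u. ?f n u) sums (LBINT u. \<Sum>n. ?f n u)"
  proof (rule sums_integral)
    show "integrable lborel (?f n)" for n
      using s by (intro integrable_mult_right int_g) simp
    have point: "summable (\<lambda>n. norm (?f n u))" for u
    proof (rule summable_comparison_test')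
      show "summable (\<lambda>n. exp (- exp u) ^ n * cmod (exp (of_real u * s)))"
        by (intro summable_mult2 summable_geometric) simp
      fix n :: nat
      have "cmod (?f n u) \<le> 1 * (exp (- (real (Suc n) * exp u)) * cmod (exp (of_real u * s)))"
        unfolding norm_mult by (intro mult_mono char_norm_le) (auto simp flip: of_nat_Suc)
      also have "exp (- (real (Suc n) * exp u)) \<le> exp (- exp u) ^ n"
        by (simp add: exp_of_nat_mult[symmetric] ring_distribs)
      then have "1 * (exp (- (real (Suc n) * exp u)) * cmod (exp (of_real u * s))) \<le> exp (- exp u) ^ n * cmod (exp (of_real u * s))"
        unfolding mult_1 by (rule mult_right_mono) simp
      finally show "norm (norm (?f n u)) \<le> exp (- exp u) ^ n * cmod (exp (of_real u * s))" by simp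
    qed
    then show "AE u in lborel. summable (\<lambda>n. norm (?f n u))" by simp
    show "summable (\<lambda>n. LBINT u. norm (?f n u))"
    proof (rule summable_comparison_test')
      have "summable (\<lambda>n. real (Suc n) powr (- \<sigma>))"
        using \<sigma> by (subst summable_Suc_iff) (simp add: summable_real_powr_iff)
      then show "summable (\<lambda>n. cmod (Gamma (of_real \<sigma>)) * real (Suc n) powr (- \<sigma>))"
        by (rule summable_mult)
      fix n :: nat
      have "(LBINT u. norm (?f n u)) = cmod (chi (int (Suc n))) * (LBINT u. cmod (?g n u * exp (of_real u * s)))"
        unfolding norm_mult[of "chi (int (Suc n))"] by (rule integral_mult_right_zero)
      also have "\<dots> \<le> 1 * (cmod (Gamma (of_real \<sigma>)) * real (Suc n) powr (- \<sigma>))"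
        by (intro mult_mono char_norm_le norm_int) (auto intro!: integral_nonneg_AE)
      finally show "norm (LBINT u. norm (?f n u)) \<le> cmod (Gamma (of_real \<sigma>)) * real (Suc n) powr (- \<sigma>)"
        by (simp add: integral_nonneg_AE)
    qed
  qed
  also have "(LBINT u. \<Sum>n. ?f n u) = laplace (Fexp 0) s"
    unfolding laplace_def
  proof (intro Bochner_Integration.integral_cong refl)
    fix u :: real
    have "(\<lambda>n. chi (int (Suc n)) * ?g n u * exp (of_real u * s)) sums (Fexp 0 u * exp (of_real u * s))"
      unfolding Fexp_def by (intro sums_mult2 F_sums) simp
    from sums_unique[OF this, symmetric] show "(\<Sum>n. ?f n u) = Fexp 0 u * exp (of_real u * s)"
      by (simp only: mult.assoc)
  qed
  also have "(\<lambda>n. LBINT u. ?f n u) = (\<lambda>n. Gamma s * (chi (int (Suc n)) * of_nat (Suc n) powr (- s)))"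
  proof
    fix n
    have "(LBINT u. ?f n u) = chi (int (Suc n)) * laplace (?g n) s"
      unfolding laplace_def by (rule integral_mult_right_zero)
    also have "laplace (?g n) s = Gamma s * of_nat (Suc n) powr (- s)"
      using s by (intro laplace_exp_exp(2)) simp
    finally show "(LBINT u. ?f n u) = Gamma s * (chi (int (Suc n)) * of_nat (Suc n) powr (- s))"
      by (simp only: mult.left_commute)
  qed
  finally have "(\<lambda>n. rGamma s * (Gamma s * (chi (int (Suc n)) * of_nat (Suc n) powr (- s)))) sums (rGamma s * laplace (Fexp 0) s)"
    by (rule sums_mult)
  moreover have "rGamma s * Gamma s = 1"
  proof -
    have "rGamma s \<noteq> 0"
      using s by (auto simp: rGamma_eq_zero_iff elim!: nonpos_Ints_cases')
    then show ?thesis by (simp add: Gamma_def)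
  qed
  ultimately show ?thesis by (simp only: mult.assoc[symmetric] mult_1)
qed

lemma Dirichlet_L_eq: "Dirichlet_L chi = L_entire"
  unfolding Dirichlet_L_def
proof (rule the_equality)
  have series: "L_entire s = (\<Sum>n. chi (int (Suc n)) * of_nat (Suc n) powr (- s))" if "Re s > 1" for s
  proof -
    have "L_entire s = rGamma s * laplace (Fexp 0) s"
      using that L_entire_eq[of 0 s] by (simp add: L_cont_def)
    then show ?thesis using sums_unique[OF laplace_Fexp_0[OF that]] by simp
  qed
  then show "L_entire holomorphic_on UNIV \<and>
    (\<forall>s. Re s > 1 \<longrightarrow> L_entire s = (\<Sum>n. chi (int (Suc n)) * of_nat (Suc n) powr (- s)))"
    using L_entire_holomorphic by simp
  fix f assume f: "f holomorphic_on UNIV \<and>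
    (\<forall>s. Re s > 1 \<longrightarrow> f s = (\<Sum>n. chi (int (Suc n)) * of_nat (Suc n) powr (- s)))"
  show "f = L_entire"
  proof
    fix s
    show "f s = L_entire s"
    proof (rule analytic_continuation_open[where f = f and g = L_entire and s = "{s. Re s > 1}" and s' = UNIV])
      show "{s. Re s > 1} \<noteq> {}" by (auto intro!: exI[of _ 2])
    qed (use f series L_entire_holomorphic in \<open>auto simp: open_halfspace_Re_gt\<close>)
  qed
qed

lemma Dirichlet_L_laplace:
  assumes "Re s > 0"
  shows "Dirichlet_L chi s = rGamma s * laplace (Fexp 0) s"
  using assms L_entire_eq[of 0 s] by (simp add: Dirichlet_L_eq L_cont_def)

section \<open>The moments as integrals over the real line\<close>

text \<open>The \<open>n\<close>-th derivative of \<open>exp (u/2) F(exp u)\<close>, whose Fourier transform is \<open>\<Gamma>(1/2 + it) L(1/2 + it)\<close>. In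
  the variable \<open>x = exp u\<close>, differentiation is \<open>\<theta> + 1/2\<close> acting on \<open>F\<close>, which explains the Stirling
  numbers.\<close>

definition crit :: "nat \<Rightarrow> real \<Rightarrow> complex" where
  "crit n u = (\<Sum>k\<le>n. noncentral_stirling (-1/2) n k *\<^sub>R (Fexp k u * exp (of_real u * (of_nat k + 1/2))))"

lemma smooth_decay_crit: "smooth_decay crit"
proof
  let ?h = "\<lambda>k u. Fexp k u * exp (of_real u * (of_nat k + 1/2))"
  fix n
  show "exp_decay (crit n)"
    unfolding crit_def[abs_def] by (intro exp_decay_sum exp_decay_scaleR Fexp_decay) simp
  fix u
  have h: "(?h k has_vector_derivative ?h (Suc k) u + (real k - (-1/2)) *\<^sub>R ?h k u) (at u)" for k
  proof -
    have "((\<lambda>z. exp (z * (of_nat k + 1/2))) has_field_derivative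
        (of_nat k + 1/2) * exp (of_real u * (of_nat k + 1/2))) (at (of_real u))"
      by (auto intro!: derivative_eq_intros)
    from has_vector_derivative_mult[OF Fexp_has_deriv has_vector_derivative_real_field[OF this]]
    have "(?h k has_vector_derivative Fexp k u * ((of_nat k + 1/2) * exp (of_real u * (of_nat k + 1/2))) +
       of_real (exp u) * Fexp (Suc k) u * exp (of_real u * (of_nat k + 1/2))) (at u)" .
    moreover have "of_real (exp u) * Fexp (Suc k) u * exp (of_real u * (of_nat k + 1/2)) = ?h (Suc k) u"
    proof -
      have "of_real u * (of_nat (Suc k) + 1/2) = of_real u + of_real u * (of_nat k + 1/2 :: complex)"
        by (simp add: algebra_simps)
      then show ?thesis by (simp only: exp_add exp_of_real mult_ac)
    qed
    moreover have "Fexp k u * ((of_nat k + 1/2) * exp (of_real u * (of_nat k + 1/2))) = (real k - (-1/2)) *\<^sub>R ?h k u"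
      by (simp add: scaleR_conv_of_real)
    ultimately show ?thesis by (simp add: add.commute)
  qed
  have "(crit n has_vector_derivative
     (\<Sum>k\<le>n. noncentral_stirling (-1/2) n k *\<^sub>R (?h (Suc k) u + (real k - (-1/2)) *\<^sub>R ?h k u))) (at u)"
    unfolding crit_def[abs_def]
    by (intro has_vector_derivative_sum bounded_linear.has_vector_derivative[OF bounded_linear_scaleR_right] h)
  then show "(crit n has_vector_derivative crit (Suc n) u) (at u)"
    unfolding crit_def by (simp only: sum_stirling_Suc)
qed

end


lemma lborel_integral_even_exp_subst:
  fixes \<phi> :: "real \<Rightarrow> complex"
  assumes cont: "continuous_on UNIV \<phi>" and int: "integrable lborel \<phi>" and even: "\<And>x. \<phi> (- x) = \<phi> x"
  shows "integrable lborel (\<lambda>u. exp u *\<^sub>R \<phi> (exp u))"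
    and "(LBINT u. exp u *\<^sub>R \<phi> (exp u)) = (LBINT x. \<phi> x) / 2"
proof -
  have im: "exp ` UNIV = {0::real<..}"
  proof (intro equalityI subsetI)
    fix x :: real assume "x \<in> {0<..}"
    then have "x = exp (ln x)" by simp
    then show "x \<in> range exp" by blast
  qed auto
  have "integrable lborel (\<lambda>x. indicator {0<..} x *\<^sub>R \<phi> x)"
    by (rule integrable_mult_indicator[OF _ int]) simp
  then have "\<phi> absolutely_integrable_on {0<..}"
    unfolding set_integrable_def by (subst integrable_completion) auto
  then have "(\<lambda>u. \<bar>exp u\<bar> *\<^sub>R \<phi> (exp u)) absolutely_integrable_on UNIV"
    by (subst absolutely_integrable_change_of_variables_real[symmetric])
       (auto intro!: derivative_eq_intros simp: im inj_on_def)
  moreover have meas: "(\<lambda>u. exp u *\<^sub>R \<phi> (exp u)) \<in> borel_measurable lborel"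
    using continuous_on_compose2[OF cont, of UNIV exp]
    by (simp add: borel_measurable_continuous_onI continuous_on_scaleR continuous_on_exp)
  ultimately show int_u: "integrable lborel (\<lambda>u. exp u *\<^sub>R \<phi> (exp u))"
    unfolding set_integrable_def by (subst (asm) integrable_completion) auto
  have "(LBINT u. exp u *\<^sub>R \<phi> (exp u)) = integral {0<..} \<phi>"
    using lborel_integral_exp_subst(2)[of 0 \<phi>] int_u by simp
  also have "\<dots> = integral {0..} \<phi>"
    by (rule integral_spike_set) (auto intro: negligible_subset[of "{0}"])
  finally have eq: "(LBINT u. exp u *\<^sub>R \<phi> (exp u)) = integral {0..} \<phi>" .
  have set_int: "set_integrable lborel {0..} \<phi>"
    unfolding set_integrable_def by (rule integrable_mult_indicator[OF _ int]) simp
  then have "has_bochner_integral lborel (\<lambda>x. indicator {0..} x *\<^sub>R \<phi> x) (integral {0..} \<phi>)"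
    using set_borel_integral_eq_integral(2)[OF set_int]
    by (simp add: has_bochner_integral_iff set_integrable_def set_lebesgue_integral_def)
  then have "has_bochner_integral lborel \<phi> (2 *\<^sub>R integral {0..} \<phi>)"
    using even by (rule has_bochner_integral_even_function)
  then have "(LBINT x. \<phi> x) = 2 *\<^sub>R integral {0..} \<phi>"
    by (rule has_bochner_integral_integral_eq)
  then show "(LBINT u. exp u *\<^sub>R \<phi> (exp u)) = (LBINT x. \<phi> x) / 2"
    unfolding eq by (simp add: scaleR_conv_of_real)
qed

text \<open>The reflection formula, since on the critical line \<open>1 - s\<close> is the complex conjugate of \<open>s\<close>.\<close>

lemma norm_rGamma_critical: "(cmod (rGamma (1/2 + \<i> * of_real t)))\<^sup>2 = cosh (pi * t) / pi"
proof -
  let ?s = "1/2 + \<i> * complex_of_real t"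
  have "complex_of_real ((cmod (rGamma ?s))\<^sup>2) = rGamma ?s * rGamma (1 - ?s)"
    by (simp add: complex_norm_square cnj_rGamma del: of_real_power)
  also have "\<dots> = sin (of_real pi * ?s) / of_real pi"
    by (rule rGamma_reflection_complex)
  also have "of_real pi * ?s = of_real (pi / 2) + \<i> * of_real (pi * t)"
    by (simp add: ring_distribs)
  also have "sin \<dots> = cos (\<i> * of_real (pi * t))"
    by (simp add: sin_add flip: sin_of_real cos_of_real)
  also have "\<dots> = of_real (cosh (pi * t))"
    by (simp add: cos_exp_eq cosh_field_def flip: exp_of_real)
  finally have "complex_of_real ((cmod (rGamma ?s))\<^sup>2) = complex_of_real (cosh (pi * t) / pi)"
    by simp
  then show ?thesis by (simp only: of_real_eq_iff)
qed

context balanced_char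
begin

lemma F_of_real_cnj: "cnj (F k (of_real x)) = G k (of_real x)"
  by (simp add: F_cnj)

text \<open>Substituting \<open>x = exp u\<close> gives integrals over the positive half line of the functions
  \<open>x\<^sup>k F(x) G\<^sup>(\<^sup>k\<^sup>)(x)\<close>. These are even: \<open>F\<close> and \<open>G\<close> have the same parity, and \<open>x\<^sup>k\<close> compensates the change of parity
  by the \<open>k\<close>-fold derivative.\<close>

lemma crit_product_integral:
  "(LBINT u. crit 0 u * cnj (crit N u)) =
     (\<Sum>k\<le>N. of_real (noncentral_stirling (-1/2) N k) * (LBINT x. of_real x ^ k * (F 0 (of_real x) * G k (of_real x)))) / 2"
proof -
  interpret c: balanced_char q "cnj_character chi" by (rule balanced_char_cnj)
  define \<phi> where "\<phi> = (\<lambda>k x. complex_of_real x ^ k * (F 0 (of_real x) * G k (of_real x)))"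
  have cont: "continuous_on UNIV (\<phi> k)" for k
    unfolding \<phi>_def by (intro continuous_intros F_of_real_continuous c.F_of_real_continuous)
  have even: "\<phi> k (- x) = \<phi> k x" for k x
  proof -
    have sgn: "chi (-1) * cnj_character chi (-1) = 1"
      using char_neg1_sq by (simp add: cnj_character_def char_neg1_cnj)
    have "\<phi> k (- x) = (- of_real x) ^ k * ((- chi (-1) * F 0 (of_real x)) *
        ((-1) ^ Suc k * cnj_character chi (-1) * G k (of_real x)))"
      using F_minus[OF reg_of_real, of 0 x] c.F_minus[OF c.reg_of_real, of k x] by (simp add: \<phi>_def)
    also have "\<dots> = ((-1) ^ k * (-1) ^ k) * (chi (-1) * cnj_character chi (-1)) * \<phi> k x"
      by (simp add: \<phi>_def power_minus[of "of_real x"])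
    also have "\<dots> = \<phi> k x"
      by (simp add: sgn flip: power_mult_distrib)
    finally show ?thesis .
  qed
  have int: "integrable lborel (\<phi> k)" for k
    unfolding \<phi>_def by (rule moment_integral(1))
  note sub = lborel_integral_even_exp_subst[OF cont int even]
  have "crit 0 u * cnj (crit N u) = (\<Sum>k\<le>N. noncentral_stirling (-1/2) N k *\<^sub>R (exp u *\<^sub>R \<phi> k (exp u)))" for u
  proof -
    have "crit 0 u * cnj (crit N u) = (\<Sum>k\<le>N. noncentral_stirling (-1/2) N k *\<^sub>R
        ((Fexp 0 u * exp (of_real u * (1/2))) * (cnj (Fexp k u) * cnj (exp (of_real u * (of_nat k + 1/2))))))"
      by (simp add: crit_def sum_distrib_left)
    also have "\<dots> = (\<Sum>k\<le>N. noncentral_stirling (-1/2) N k *\<^sub>R (exp u *\<^sub>R \<phi> k (exp u)))"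
    proof (intro sum.cong refl arg_cong2[where f = scaleR])
      fix k
      have "complex_of_real (exp u) * of_real (exp u) ^ k = exp (of_real u + of_nat k * of_real u)"
        by (simp add: exp_add exp_of_nat_mult exp_of_real)
      also have "of_real u + of_nat k * of_real u = of_real u * (1/2) + of_real u * (of_nat k + 1/2 :: complex)"
        by (simp add: algebra_simps)
      also have "exp \<dots> = exp (of_real u * (1/2)) * cnj (exp (of_real u * (of_nat k + 1/2)))"
        by (simp add: exp_add exp_cnj)
      finally have e: "exp (of_real u * (1/2)) * cnj (exp (of_real u * (of_nat k + 1/2))) =
        complex_of_real (exp u) * of_real (exp u) ^ k" by simp
      have "(Fexp 0 u * exp (of_real u * (1/2))) * (cnj (Fexp k u) * cnj (exp (of_real u * (of_nat k + 1/2)))) =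
        (exp (of_real u * (1/2)) * cnj (exp (of_real u * (of_nat k + 1/2)))) * (Fexp 0 u * cnj (Fexp k u))"
        by (simp only: mult_ac)
      also have "\<dots> = exp u *\<^sub>R \<phi> k (exp u)"
        unfolding e by (simp add: \<phi>_def Fexp_def F_of_real_cnj scaleR_conv_of_real mult.assoc)
      finally show "(Fexp 0 u * exp (of_real u * (1/2))) * (cnj (Fexp k u) * cnj (exp (of_real u * (of_nat k + 1/2)))) =
        exp u *\<^sub>R \<phi> k (exp u)" .
    qed
    finally show ?thesis .
  qed
  then have "(LBINT u. crit 0 u * cnj (crit N u)) =
     (LBINT u. \<Sum>k\<le>N. noncentral_stirling (-1/2) N k *\<^sub>R (exp u *\<^sub>R \<phi> k (exp u)))"
    by simp
  also have "\<dots> = (\<Sum>k\<le>N. LBINT u. noncentral_stirling (-1/2) N k *\<^sub>R (exp u *\<^sub>R \<phi> k (exp u)))"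
    by (rule Bochner_Integration.integral_sum) (intro integrable_scaleR_right sub(1))
  also have "\<dots> = (\<Sum>k\<le>N. noncentral_stirling (-1/2) N k *\<^sub>R (LBINT u. exp u *\<^sub>R \<phi> k (exp u)))"
    by (intro sum.cong refl integral_scaleR_right sub(1))
  also have "\<dots> = (\<Sum>k\<le>N. of_real (noncentral_stirling (-1/2) N k) * (LBINT x. \<phi> k x)) / 2"
    unfolding sub(2) by (simp add: scaleR_conv_of_real sum_divide_distrib)
  finally show ?thesis by (simp add: \<phi>_def)
qed

lemma L_critical_line:
  "(cmod (Dirichlet_L chi (1/2 + \<i> * of_real t)))\<^sup>2 * (t ^ N / cosh (pi * t)) =
     t ^ N * (cmod (fourier (crit 0) t))\<^sup>2 / pi"
proof -
  have "laplace (Fexp 0) (1/2 + \<i> * of_real t) = fourier (crit 0) t"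
    unfolding laplace_def fourier_def
    by (intro Bochner_Integration.integral_cong refl) (simp add: crit_def exp_add[symmetric] algebra_simps)
  then have "Dirichlet_L chi (1/2 + \<i> * of_real t) = rGamma (1/2 + \<i> * of_real t) * fourier (crit 0) t"
    by (simp add: Dirichlet_L_laplace)
  then show ?thesis
    using cosh_real_pos[of "pi * t"] by (simp add: norm_mult power_mult_distrib norm_rGamma_critical)
qed

lemma L_moment:
  shows "integrable lborel (\<lambda>t. (cmod (Dirichlet_L chi (1/2 + \<i> * of_real t)))\<^sup>2 * (t ^ N / cosh (pi * t)))"
    and "complex_of_real (LBINT t. (cmod (Dirichlet_L chi (1/2 + \<i> * of_real t)))\<^sup>2 * (t ^ N / cosh (pi * t))) =
      (- \<i>) ^ N * (\<Sum>k\<le>N. of_real (noncentral_stirling (-1/2) N k) *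
        (LBINT x. of_real x ^ k * (F 0 (of_real x) * G k (of_real x))))"
proof -
  interpret s: smooth_decay crit by (rule smooth_decay_crit)
  show "integrable lborel (\<lambda>t. (cmod (Dirichlet_L chi (1/2 + \<i> * of_real t)))\<^sup>2 * (t ^ N / cosh (pi * t)))"
    unfolding L_critical_line using s.integrable_weighted by simp
  show "complex_of_real (LBINT t. (cmod (Dirichlet_L chi (1/2 + \<i> * of_real t)))\<^sup>2 * (t ^ N / cosh (pi * t))) =
      (- \<i>) ^ N * (\<Sum>k\<le>N. of_real (noncentral_stirling (-1/2) N k) *
        (LBINT x. of_real x ^ k * (F 0 (of_real x) * G k (of_real x))))"
    unfolding L_critical_line using s.weighted_parseval[of N]
    by (simp add: crit_product_integral)
qed

text \<open>The substitution \<open>a \<mapsto> q - a\<close> and the reflection of the Bernoulli polynomials turn the exponents \<open>-ab\<close> into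
  \<open>ab\<close>.\<close>

lemma higher_deriv_regular_part_reflected:
  "(deriv ^^ k) (regular_part b) (lattice_pt q b) =
     chi (-1) * of_nat q ^ k / of_nat (Suc k) *
       (\<Sum>a=1..q. chi (int a) * add_char q (int a * int b) * bernc (Suc k) (of_nat a / of_nat q))"
proof -
  let ?t = "\<lambda>a. chi (int a) * add_char q (int a * int b) * bernc (Suc k) (of_nat a / of_nat q)"
  let ?u = "\<lambda>a. chi (int a) * add_char q (- (int a * int b)) * bernc (Suc k) (of_nat a / of_nat q)"
  have drop: "(\<Sum>a=1..q. h a) = (\<Sum>a\<in>{1..<q}. h a)" if "h q = 0" for h :: "nat \<Rightarrow> complex"
  proof -
    have "{1..q} = insert q {1..<q}" using q by auto
    then show ?thesis using that by simp
  qed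
  have "(\<Sum>a=1..q. ?u a) = (\<Sum>a\<in>{1..<q}. ?u a)"
    by (rule drop) (simp add: char_modulus)
  also have "\<dots> = (\<Sum>a\<in>{1..<q}. ?u (q - a))"
    by (rule sum.reindex_bij_witness[of _ "\<lambda>a. q - a" "\<lambda>a. q - a"]) auto
  also have "\<dots> = (\<Sum>a\<in>{1..<q}. chi (-1) * (-1) ^ Suc k * ?t a)"
  proof (intro sum.cong refl)
    fix a assume a: "a \<in> {1..<q}"
    have "chi (int (q - a)) = chi (- int a)"
      using a by (intro char_cong) (simp add: cong_def of_nat_diff)
    then have 1: "chi (int (q - a)) = chi (-1) * chi (int a)" by (simp only: char_minus[of "int a"])
    have 2: "add_char q (- (int (q - a) * int b)) = add_char q (int a * int b)"
    proof (rule add_char_cong)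
      have "- (int (q - a) * int b) - int a * int b = int q * (- int b)"
        using a by (simp add: of_nat_diff algebra_simps)
      then show "[- (int (q - a) * int b) = int a * int b] (mod int q)"
        by (simp add: cong_iff_dvd_diff)
    qed (use q in simp)
    have "of_nat (q - a) / of_nat q = (1 - of_nat a / of_nat q :: complex)"
      using a by (simp add: of_nat_diff diff_divide_distrib)
    then have 3: "bernc (Suc k) (of_nat (q - a) / of_nat q) = (-1) ^ Suc k * bernc (Suc k) (of_nat a / of_nat q)"
      by (simp only: bernc_reflect)
    show "?u (q - a) = chi (-1) * (-1) ^ Suc k * ?t a"
      unfolding 1 2 3 by (simp only: mult_ac)
  qed
  also have "\<dots> = chi (-1) * (-1) ^ Suc k * (\<Sum>a\<in>{1..<q}. ?t a)"
    by (simp only: sum_distrib_left)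
  also have "(\<Sum>a\<in>{1..<q}. ?t a) = (\<Sum>a=1..q. ?t a)"
    by (rule drop[symmetric]) (simp add: char_modulus)
  finally have "(\<Sum>a=1..q. ?u a) = chi (-1) * (-1) ^ Suc k * (\<Sum>a=1..q. ?t a)" .
  moreover have "- ((- of_nat q) ^ k / m * (x * (-1) ^ Suc k * t)) = x * of_nat q ^ k / m * t" for m x t :: complex
  proof -
    have e: "(- of_nat q) ^ k * (-1) ^ k = (of_nat q ^ k :: complex)"
      by (simp flip: power_mult_distrib)
    have "- (P / m * (x * (-1 * s) * t)) = (P * s) * (x * t / m)" for P s :: complex
      by simp
    from this[of "(- of_nat q) ^ k" "(-1) ^ k"] show ?thesis
      unfolding e power_Suc by simp
  qed
  ultimately show ?thesis
    unfolding higher_deriv_regular_part by simp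
qed

end

section \<open>The moment formula\<close>

theorem theorem1p1:
  fixes q :: nat and chi :: "int \<Rightarrow> complex" and N :: nat
  assumes "q > 1" and "primitive_character q chi"
  shows "integrable lborel
      (\<lambda>t::real. (cmod (Dirichlet_L chi (1/2 + \<i> * of_real t)))\<^sup>2 * (t ^ N / cosh (pi * t))) \<and>
    complex_of_real
      (LBINT t. (cmod (Dirichlet_L chi (1/2 + \<i> * of_real t)))\<^sup>2 * (t ^ N / cosh (pi * t))) =
      - chi (-1) * (-1) ^ (N div 2) * of_real (bernoulli_poly N (1/2)) * (of_nat (totient q) / of_nat q)
      + (\<Sum>k=1..N+1. of_real (noncentral_stirling (-1/2) N (k - 1))
           * ((2 * of_real pi * \<i> * of_nat q) ^ k / ((of_nat q)\<^sup>2 * (of_nat k)\<^sup>2))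
           * (\<Sum>a=1..q. \<Sum>b=1..q.
                of_real (bernoulli_poly k (real a / real q)) * of_real (bernoulli_poly k (real b / real q))
                * T_twist q chi N (int (a * b)) * xi q ^ (a * b)))"
proof -
  have dc: "dirichlet_character q chi" using assms(2) by (simp add: primitive_character_def)
  interpret balanced_char q chi
    by (rule dirichlet_char.balanced_if_primitive[OF _ assms(2)]) (unfold_locales, fact assms(1), fact dc)
  interpret c: balanced_char q "cnj_character chi" by (rule balanced_char_cnj)
  note prim = assms(2)
  let ?S = "\<lambda>k. complex_of_real (noncentral_stirling (-1/2) N k)"
  let ?p = "lattice_pt q" and ?\<tau> = "gauss_sum q chi" and ?\<tau>' = "gauss_sum q (cnj_character chi)"
  let ?B = "\<lambda>k a. complex_of_real (bernoulli_poly k (real a / real q))"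
  let ?T = "\<lambda>k a b. ?B k a * ?B k b * T_twist q chi N (int (a * b)) * xi q ^ (a * b)"
  let ?X = "\<lambda>b k. bern_prim k (?p b) *
       ((-1) ^ N * res_G b * (deriv ^^ k) (regular_part b) (?p b) + res_F b * (deriv ^^ k) (G_part b) (?p b))"
  have q0: "of_nat q \<noteq> (0 :: complex)" using assms(1) by simp
  have B: "bernc k (of_nat a / of_nat q) = ?B k a" for k a
    using bernc_of_real[of k "real a / real q"] by simp
  have res_F_eq: "res_F b = chi (-1) * ?\<tau> * cnj (chi (int b)) / of_nat q" for b
    by (rule char_coeff_eq[OF prim])
  have res_G_eq: "res_G b = chi (-1) * ?\<tau>' * chi (int b) / of_nat q" for b
  proof -
    have "res_G b = cnj (char_coeff q chi (- int b))"
      using char_coeff_cnj[of "- int b"] by simp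
    also have "\<dots> = chi (-1) * cnj (res_F b)"
      by (simp add: char_coeff_minus char_neg1_cnj)
    also have "\<dots> = chi (-1) * (chi (-1) * cnj ?\<tau> * chi (int b) / of_nat q)"
      by (simp add: res_F_eq char_neg1_cnj)
    also have "\<dots> = cnj ?\<tau> * chi (int b) / of_nat q"
      using char_neg1_sq by (simp add: mult.assoc[symmetric])
    finally show ?thesis by (simp add: gauss_sum_cnj)
  qed
  \<comment> \<open>The range of summation changes freely, as everything carries the factor \<open>chi q = 0\<close> at \<open>q\<close>.\<close>
  have drop: "(\<Sum>b\<in>{1..<q}. h b) = (\<Sum>b=1..q. h b)" if "h q = 0" for h :: "nat \<Rightarrow> complex"
  proof -
    have "{1..q} = insert q {1..<q}" using assms(1) by auto
    then show ?thesis using that by simp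
  qed
  have \<tau>\<tau>: "?\<tau> * (chi (-1) * ?\<tau>') = of_nat q"
    using gauss_sum_norm[OF prim] by (simp add: gauss_sum_cnj)
  have cd: "(\<Sum>b\<in>{1..<q}. res_F b * res_G b) = chi (-1) * (of_nat (totient q) / of_nat q)"
  proof -
    have "res_F b * res_G b = chi (-1) / of_nat q * (chi (int b) * cnj (chi (int b)))" for b
    proof -
      have "res_F b * res_G b = chi (-1) * (?\<tau> * (chi (-1) * ?\<tau>')) * (chi (int b) * cnj (chi (int b))) / (of_nat q * of_nat q)"
        by (simp add: res_F_eq res_G_eq)
      then show ?thesis unfolding \<tau>\<tau> using q0 by simp
    qed
    then have "(\<Sum>b\<in>{1..<q}. res_F b * res_G b) = chi (-1) / of_nat q * (\<Sum>b\<in>{1..<q}. chi (int b) * cnj (chi (int b)))"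
      by (simp add: sum_distrib_left)
    also have "(\<Sum>b\<in>{1..<q}. chi (int b) * cnj (chi (int b))) = (\<Sum>b=1..q. chi (int b) * cnj (chi (int b)))"
      by (rule drop) (simp add: char_modulus)
    finally show ?thesis by (simp only: sum_char_mult_cnj) simp
  qed
  have bernN: "(- \<i>) ^ N * bernc N (1/2) = (-1) ^ (N div 2) * of_real (bernoulli_poly N (1/2))"
  proof (cases "even N")
    case True
    then obtain m where m: "N = 2 * m" by blast
    have "(- \<i>) ^ N = (-1) ^ (N div 2)" by (simp add: m power_mult)
    then show ?thesis using bernc_of_real[of N "1/2"] by simp
  next
    case False
    then show ?thesis using bernc_half_odd[of N] bernc_of_real[of N "1/2"] by simp
  qed
  \<comment> \<open>The pole with index \<open>b\<close> contributes the inner sum over \<open>a\<close>, for every order \<open>k\<close>.\<close>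
  have main: "(- \<i>) ^ N * (- 2 * of_real pi * \<i>) * ?X b k =
     (2 * of_real pi * \<i> * of_nat q) ^ Suc k / ((of_nat q)\<^sup>2 * (of_nat (Suc k))\<^sup>2) *
       (\<Sum>a=1..q. ?T (Suc k) a b)" for k b
  proof -
    let ?W = "\<lambda>h. \<Sum>a=1..q. h (int a) * add_char q (int a * int b) * ?B (Suc k) a"
    have pb: "bern_prim k (?p b) = (2 * of_real pi * \<i>) ^ k * ?B (Suc k) b / of_nat (Suc k)"
    proof -
      have "?p b / (2 * of_real pi * \<i>) = of_nat b / of_nat q" by (simp add: lattice_pt_def)
      then show ?thesis by (simp only: bern_prim_def B)
    qed
    have 1: "res_G b * (deriv ^^ k) (regular_part b) (?p b) =
        of_nat q ^ k / (of_nat q * of_nat (Suc k)) * (?\<tau>' * (chi (int b) * ?W chi))"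
    proof -
      have "res_G b * (deriv ^^ k) (regular_part b) (?p b) =
        (chi (-1) * chi (-1)) * (of_nat q ^ k / (of_nat q * of_nat (Suc k)) * (?\<tau>' * (chi (int b) * ?W chi)))"
        unfolding res_G_eq higher_deriv_regular_part_reflected B by simp
      then show ?thesis by (simp only: char_neg1_sq mult_1)
    qed
    have 2: "res_F b * (deriv ^^ k) (G_part b) (?p b) =
        of_nat q ^ k / (of_nat q * of_nat (Suc k)) * (?\<tau> * (cnj (chi (int b)) * ?W (cnj_character chi)))"
    proof -
      have "res_F b * (deriv ^^ k) (G_part b) (?p b) =
        (chi (-1) * chi (-1)) * (of_nat q ^ k / (of_nat q * of_nat (Suc k)) * (?\<tau> * (cnj (chi (int b)) * ?W (cnj_character chi))))"
        unfolding res_F_eq c.higher_deriv_regular_part_reflected B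
        by (simp add: cnj_character_def char_neg1_cnj)
      then show ?thesis by (simp only: char_neg1_sq mult_1)
    qed
    have T: "(\<Sum>a=1..q. ?T (Suc k) a b) =
      - (\<i> ^ N) * ?B (Suc k) b * (?\<tau>' * (chi (int b) * ?W chi) + (-1) ^ N * (?\<tau> * (cnj (chi (int b)) * ?W (cnj_character chi))))"
    proof -
      have "?T (Suc k) a b =
        - (\<i> ^ N) * ?B (Suc k) b * (?\<tau>' * (chi (int b) * (chi (int a) * add_char q (int a * int b) * ?B (Suc k) a))
         + (-1) ^ N * (?\<tau> * (cnj (chi (int b)) * (cnj_character chi (int a) * add_char q (int a * int b) * ?B (Suc k) a))))" for a
        unfolding T_twist_def xi_power cnj_character_def of_nat_mult char_mult complex_cnj_mult
        by (simp add: ring_distribs mult_ac)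
      then show ?thesis
        by (simp only: sum_distrib_left[symmetric] sum.distrib)
    qed
    have sgn: "(- \<i>) ^ N * (-1) ^ N = \<i> ^ N" "(- \<i>) ^ N = \<i> ^ N * (-1) ^ N"
      by (simp_all flip: power_mult_distrib)
    have alg: "(- \<i>) ^ N * (- P) * (P ^ k * X / m * ((-1) ^ N * (Q ^ k / (Q * m) * U) + Q ^ k / (Q * m) * V)) =
       (P * Q) ^ Suc k / (Q\<^sup>2 * m\<^sup>2) * (- (\<i> ^ N) * X * (U + (-1) ^ N * V))"
      if "Q \<noteq> 0" "m \<noteq> 0" for P Q X m U V :: complex
    proof -
      have "(- \<i>) ^ N * (- P) * (P ^ k * X / m * ((-1) ^ N * (Q ^ k / (Q * m) * U) + Q ^ k / (Q * m) * V)) =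
        - (P ^ Suc k * Q ^ k / (Q * m\<^sup>2)) * X * ((- \<i>) ^ N * (-1) ^ N * U + (- \<i>) ^ N * V)"
        by (simp add: power2_eq_square ring_distribs add_divide_distrib mult_ac)
      also have "(- \<i>) ^ N * (-1) ^ N * U + (- \<i>) ^ N * V = \<i> ^ N * (U + (-1) ^ N * V)"
        unfolding sgn by (simp add: ring_distribs mult_ac)
      also have "P ^ Suc k * Q ^ k / (Q * m\<^sup>2) = (P * Q) ^ Suc k / (Q\<^sup>2 * m\<^sup>2)"
        using that by (simp add: power_mult_distrib power2_eq_square)
      finally show ?thesis by simp
    qed
    have m0: "of_nat (Suc k) \<noteq> (0 :: complex)" by (rule of_nat_neq_0)
    have "(-1) ^ N * res_G b * (deriv ^^ k) (regular_part b) (?p b) = (-1) ^ N * (res_G b * (deriv ^^ k) (regular_part b) (?p b))"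
      by (simp only: mult.assoc)
    then show ?thesis
      unfolding T pb 1 2 using alg[OF q0 m0, of "2 * of_real pi * \<i>"] by simp
  qed
  have "complex_of_real (LBINT t. (cmod (Dirichlet_L chi (1/2 + \<i> * of_real t)))\<^sup>2 * (t ^ N / cosh (pi * t))) =
     - chi (-1) * (-1) ^ (N div 2) * of_real (bernoulli_poly N (1/2)) * (of_nat (totient q) / of_nat q) +
     (\<Sum>b\<in>{1..<q}. \<Sum>k\<le>N. ?S k * ((- \<i>) ^ N * (- 2 * of_real pi * \<i>) * ?X b k))"
  proof -
    let ?Z = "\<Sum>b\<in>{1..<q}. \<Sum>k\<le>N. ?S k * ?X b k"
    have "complex_of_real (LBINT t. (cmod (Dirichlet_L chi (1/2 + \<i> * of_real t)))\<^sup>2 * (t ^ N / cosh (pi * t))) =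
      (- \<i>) ^ N * (- (chi (-1) * (of_nat (totient q) / of_nat q)) * bernc N (1/2) - 2 * of_real pi * \<i> * ?Z)"
      unfolding L_moment(2) stirling_moments cd ..
    also have "\<dots> = - chi (-1) * (of_nat (totient q) / of_nat q) * ((- \<i>) ^ N * bernc N (1/2))
        + (- \<i>) ^ N * (- 2 * of_real pi * \<i>) * ?Z"
    proof -
      have "u * (- (x * y) * B - P * Z) = - x * y * (u * B) + u * (- P) * Z" for u x y B P Z :: complex
        by (simp add: algebra_simps)
      from this[of "(- \<i>) ^ N" "chi (-1)" "of_nat (totient q) / of_nat q" _ "2 * of_real pi * \<i>"]
      show ?thesis by (simp only: mult_minus_left)
    qed
    also have "(- \<i>) ^ N * (- 2 * of_real pi * \<i>) * ?Z =
       (\<Sum>b\<in>{1..<q}. \<Sum>k\<le>N. ?S k * ((- \<i>) ^ N * (- 2 * of_real pi * \<i>) * ?X b k))"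
      unfolding sum_distrib_left by (intro sum.cong refl) (rule mult.left_commute)
    finally show ?thesis
      unfolding bernN by (simp only: mult_ac)
  qed
  also have "(\<Sum>b\<in>{1..<q}. \<Sum>k\<le>N. ?S k * ((- \<i>) ^ N * (- 2 * of_real pi * \<i>) * ?X b k)) =
     (\<Sum>k\<le>N. ?S k * ((2 * of_real pi * \<i> * of_nat q) ^ Suc k / ((of_nat q)\<^sup>2 * (of_nat (Suc k))\<^sup>2)) *
       (\<Sum>b\<in>{1..<q}. \<Sum>a=1..q. ?T (Suc k) a b))"
    unfolding main by (subst sum.swap) (simp only: sum_distrib_left mult.assoc)
  also have "\<dots> = (\<Sum>k\<le>N. ?S k * ((2 * of_real pi * \<i> * of_nat q) ^ Suc k / ((of_nat q)\<^sup>2 * (of_nat (Suc k))\<^sup>2)) *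
       (\<Sum>a=1..q. \<Sum>b=1..q. ?T (Suc k) a b))"
  proof (rule sum.cong[OF refl], rule arg_cong2[where f = "(*)", OF refl])
    fix k
    have "T_twist q chi N (int (a * q)) = 0" for a
      using char_mult[of "int a" "int q"] char_modulus by (simp add: T_twist_def cnj_character_def)
    then have "(\<Sum>b\<in>{1..<q}. \<Sum>a=1..q. ?T (Suc k) a b) =
      (\<Sum>b=1..q. \<Sum>a=1..q. ?T (Suc k) a b)"
      by (intro drop) simp
    also have "\<dots> = (\<Sum>a=1..q. \<Sum>b=1..q. ?T (Suc k) a b)"
      by (rule sum.swap)
    finally show "(\<Sum>b\<in>{1..<q}. \<Sum>a=1..q. ?T (Suc k) a b) =
      (\<Sum>a=1..q. \<Sum>b=1..q. ?T (Suc k) a b)" .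
  qed
  also have "\<dots> = (\<Sum>k=1..N+1. of_real (noncentral_stirling (-1/2) N (k - 1))
           * ((2 * of_real pi * \<i> * of_nat q) ^ k / ((of_nat q)\<^sup>2 * (of_nat k)\<^sup>2))
           * (\<Sum>a=1..q. \<Sum>b=1..q. ?T k a b))"
    by (rule sum.reindex_bij_witness[of _ "\<lambda>k. k - 1" Suc]) auto
  finally show ?thesis using L_moment(1) by blast
qed

end
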